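(* Let $p_{\mathrm{data}}$ be a probability density on $\mathbb{R}^d$ such that $\ln p_{\mathrm{data}}$ is $C^1$, $\nabla\ln p_{\mathrm{data}}$ is $L$-Lipschitz with $L\ge1$, $p_{\mathrm{data}}$ satisfies a log-Sobolev inequality with constant $C_{\mathrm{LS}}\ge1$, $\|\mathbb{E}_{p_{\mathrm{data}}}x\|\le M_1$ and $\mathbb{E}_{p_{\mathrm{data}}}\|x\|^2\le M_2$ with $M_2=O(d)$. Let $\tilde p_t$ be the law at time $t$ of the DDPM forward process with $g\equiv1$, and suppose $\nabla\ln\tilde p_t$ is $L$-Lipschitz for every $t\ge0$. Suppose that for each $t$, $s(\cdot,t)$ is $C^1$ and $L_s$-Lipschitz with $L_s\ge1$, and $\mathbb{E}_{\tilde p_t}\|\nabla\ln\tilde p_t(x)-s(x,t)\|^2\le\varepsilon^2$. Suppose $0<\varepsilon_{\mathrm{TV}}<1$ with $\varepsilon_{\mathrm{TV}}^3=O\Big(\frac{1}{(1+L_s/L)^2(1+C_{\mathrm{LS}}/d)(\ln(C_{\mathrm{LS}}d)\vee C_{\mathrm{LS}})}\Big)$, and let $\varepsilon_\chi:=\varepsilon_{\mathrm{TV}}/2$. If $$\varepsilon=O\!\left(\frac{\varepsilon_{\mathrm{TV}}^4}{dL^2C_{\mathrm{LS}}^{5/2}\ln(1/\varepsilon_\chi^2)}\right),$$ then the predictor-corrector algorithm, with appropriate choices of $T=\Theta\big(\ln(C_{\mathrm{LS}}d)\vee C_{\mathrm{LS}}\log\frac1{\varepsilon_{\mathrm{TV}}}\big)$,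 numbers of corrector steps $N_m$, corrector step sizes $h_m$ and predictor step size $h$, produces a sample from a distribution $q_T$ with $\mathrm{TV}(q_T,p_{\mathrm{data}})<\varepsilon_{\mathrm{TV}}$.
   Context: DDPM forward process with $g\equiv1$: $d\tilde x_t=-\frac12\tilde x_t\,dt+dw_t$, $\tilde x_0\sim p_{\mathrm{data}}$; $\tilde p_t$ is the law of $\tilde x_t$. Prior: $N(0,(1-e^{-T})I_d)$. Predictor-corrector algorithm: draw $z_0\sim$ prior; for $m=1,\dots,T/h$: (predictor) $z_{mh}=z_{(m-1)h}+h\big(\frac12z_{(m-1)h}+s(z_{(m-1)h},T-(m-1)h)\big)+\sqrt h\,\xi$ with $\xi\sim N(0,I_d)$; (corrector) starting from $z_{mh,0}:=z_{mh}$ run $N_m$ steps of Langevin Monte Carlo $z_{mh,j+1}=z_{mh,j}+h_m s(z_{mh,j},T-mh)+\sqrt{2h_m}\,\xi_j$ ($\xi_j\sim N(0,I_d)$ i.i.d.), and set $z_{mh}\leftarrow z_{mh,N_m}$. Output $z_T$, whose law is $q_T$. Log-Sobolev inequality with constant $C$: $\mathrm{KL}(q\|p)\le\frac C2\mathbb{E}_q\|\nabla\ln(q/p)\|^2$ for all $q$. $O,\Theta$ hide absolute constants. *)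

theory Defs
  imports "HOL-Probability.Probability"
begin

text \<open>Euclidean space R^d is represented by the extensional functions
  nat => real on the index set {..<d}; d varies inside the statement, so it
  cannot be a type. Lebesgue measure on R^d is the finite product of lborel.\<close>

definition Rd :: "nat \<Rightarrow> (nat \<Rightarrow> real) set" where
  "Rd d = PiE {..<d} (\<lambda>_. UNIV)"

definition lebd :: "nat \<Rightarrow> (nat \<Rightarrow> real) measure" where
  "lebd d = PiM {..<d} (\<lambda>_. lborel)"

definition vnorm :: "nat \<Rightarrow> (nat \<Rightarrow> real) \<Rightarrow> real" where
  "vnorm d x = sqrt (\<Sum>i<d. (x i)^2)"

definition vdist :: "nat \<Rightarrow> (nat \<Rightarrow> real) \<Rightarrow> (nat \<Rightarrow> real) \<Rightarrow> real" where
  "vdist d x y = sqrt (\<Sum>i<d. (x i - y i)^2)"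

definition has_grad :: "nat \<Rightarrow> ((nat \<Rightarrow> real) \<Rightarrow> real) \<Rightarrow> ((nat \<Rightarrow> real) \<Rightarrow> (nat \<Rightarrow> real)) \<Rightarrow> bool" where
  "has_grad d f G \<longleftrightarrow> (\<forall>x\<in>Rd d. \<forall>i<d.
      ((\<lambda>t. f (x(i := x i + t))) has_real_derivative G x i) (at 0))"

definition cont_vec :: "nat \<Rightarrow> ((nat \<Rightarrow> real) \<Rightarrow> (nat \<Rightarrow> real)) \<Rightarrow> bool" where
  "cont_vec d G \<longleftrightarrow> (\<forall>x\<in>Rd d. \<forall>e>0. \<exists>\<delta>>0. \<forall>y\<in>Rd d.
      vdist d y x < \<delta> \<longrightarrow> vdist d (G y) (G x) < e)"

definition C1 :: "nat \<Rightarrow> ((nat \<Rightarrow> real) \<Rightarrow> real) \<Rightarrow> bool" where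
  "C1 d f \<longleftrightarrow> (\<exists>G. has_grad d f G \<and> cont_vec d G)"

definition lipschitz_vec :: "nat \<Rightarrow> real \<Rightarrow> ((nat \<Rightarrow> real) \<Rightarrow> (nat \<Rightarrow> real)) \<Rightarrow> bool" where
  "lipschitz_vec d L F \<longleftrightarrow> (\<forall>x\<in>Rd d. \<forall>y\<in>Rd d. vdist d (F x) (F y) \<le> L * vdist d x y)"

definition gauss_dens :: "nat \<Rightarrow> (nat \<Rightarrow> real) \<Rightarrow> real \<Rightarrow> (nat \<Rightarrow> real) \<Rightarrow> real" where
  "gauss_dens d m v x = (2 * pi * v) powr (- real d / 2) * exp (- ((vdist d x m)^2 / (2 * v)))"

definition gauss :: "nat \<Rightarrow> (nat \<Rightarrow> real) \<Rightarrow> real \<Rightarrow> (nat \<Rightarrow> real) measure" where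
  "gauss d m v = density (lebd d) (\<lambda>x. ennreal (gauss_dens d m v x))"

text \<open>Density of the law of the DDPM forward process (g = 1) at time t:
  x_t = e^{-t/2} x_0 + sqrt(1 - e^{-t}) Z, i.e. the explicit solution of
  dx = -x/2 dt + dw.\<close>
definition fwd_dens :: "nat \<Rightarrow> ((nat \<Rightarrow> real) \<Rightarrow> real) \<Rightarrow> real \<Rightarrow> (nat \<Rightarrow> real) \<Rightarrow> real" where
  "fwd_dens d p t x = (if t = 0 then p x else
     (\<integral>y. p y * gauss_dens d (\<lambda>i. exp (- t / 2) * y i) (1 - exp (- t)) x \<partial>lebd d))"

definition LSI :: "nat \<Rightarrow> ((nat \<Rightarrow> real) \<Rightarrow> real) \<Rightarrow> real \<Rightarrow> bool" where
  "LSI d p C \<longleftrightarrow> (\<forall>q g. q \<in> borel_measurable (lebd d) \<and> (\<forall>x\<in>Rd d. q x > 0)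
      \<and> (\<integral>\<^sup>+x. ennreal (q x) \<partial>lebd d) = 1
      \<and> has_grad d (\<lambda>x. ln (q x / p x)) g \<longrightarrow>
      ennreal (\<integral>x. q x * ln (q x / p x) \<partial>lebd d)
        \<le> ennreal (C / 2) * (\<integral>\<^sup>+x. ennreal (q x * (vnorm d (g x))^2) \<partial>lebd d))"

definition tv :: "nat \<Rightarrow> (nat \<Rightarrow> real) measure \<Rightarrow> (nat \<Rightarrow> real) measure \<Rightarrow> real" where
  "tv d \<mu> \<nu> = (SUP A \<in> sets (lebd d). \<bar>measure \<mu> A - measure \<nu> A\<bar>)"

fun lmc :: "nat \<Rightarrow> ((nat \<Rightarrow> real) \<Rightarrow> real \<Rightarrow> (nat \<Rightarrow> real)) \<Rightarrow> real \<Rightarrow> real \<Rightarrow> nat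
            \<Rightarrow> (nat \<Rightarrow> real) measure \<Rightarrow> (nat \<Rightarrow> real) measure" where
  "lmc d s t hm 0 \<mu> = \<mu>"
| "lmc d s t hm (Suc N) \<mu> =
     bind (lmc d s t hm N \<mu>) (\<lambda>z. gauss d (\<lambda>i. z i + hm * s z t i) (2 * hm))"

fun pc_law :: "nat \<Rightarrow> ((nat \<Rightarrow> real) \<Rightarrow> real \<Rightarrow> (nat \<Rightarrow> real)) \<Rightarrow> real \<Rightarrow> real
            \<Rightarrow> (nat \<Rightarrow> nat) \<Rightarrow> (nat \<Rightarrow> real) \<Rightarrow> nat \<Rightarrow> (nat \<Rightarrow> real) measure" where
  "pc_law d s T h Ns hs 0 = gauss d (\<lambda>_. 0) (1 - exp (- T))"
| "pc_law d s T h Ns hs (Suc m) =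
     lmc d s (T - real (Suc m) * h) (hs (Suc m)) (Ns (Suc m))
       (bind (pc_law d s T h Ns hs m)
          (\<lambda>z. gauss d (\<lambda>i. z i + h * (z i / 2 + s z (T - real m * h) i)) h))"

end

theory Submission
  imports Defs
begin

text \<open>
  The predictor alone suffices: take no corrector steps and let the step size \<open>h\<close> tend to 0.
  Let \<open>p\<^sub>t\<close> be the forward density, \<open>H\<close> its entropy and \<open>I\<close> its Fisher
  information. By the chain rule, the relative entropy of the data with respect to the output is at
  most the relative entropy of \<open>p\<^sub>T\<close> with respect to the prior, of order \<open>exp (- T) d\<close>, plus the
  sum over the steps of the expected relative entropy of the true reverse kernel with respect to the
  Gaussian kernel of the algorithm. Bayes' rule gives the reverse kernel in terms of \<open>p\<^sub>t\<close> and the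
  Gaussian forward kernel; by Tweedie's formula the expectation of the quadratic term of a step is
  explicit, and the summand becomes
  \<open>H(p\<^sub>t\<^sub>+\<^sub>h) - H(p\<^sub>t) + h d / 2 + h / 2 (E|s - \<nabla> ln p\<^sub>t\<^sub>+\<^sub>h|\<^sup>2 - I(p\<^sub>t\<^sub>+\<^sub>h)) + O(h\<^sup>2)\<close>.
  Finally \<open>H(p\<^sub>t\<^sub>+\<^sub>h) - H(p\<^sub>t) \<le> - h d / 2 + h / 2 I(p\<^sub>t) + O(h\<^sup>3\<^sup>/\<^sup>2)\<close>, so the Fisher informations
  telescope and the sum is at most \<open>T \<epsilon>\<^sup>2 / 2 + h / 2 I(p\<^sub>0) + O(\<surd>h)\<close>.
\<close>

text \<open>The relative entropy runs from the data to the output, so every expectation in the chain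
  is taken under the forward process, which is exactly where the score error is bounded in mean
  square. The obstacle is regularity. The score is merely Lipschitz, so the usual entropy estimate,
  which integrates the Laplacian of ln p by parts, is replaced by second differences of ln p:
  Gaussian displacements z and -z are paired, and translation invariance of Lebesgue measure does
  the rest. The coefficient of I(p_t) must be h / 2 to leading order, otherwise the Fisher
  informations would not telescope; separating it from the Taylor error by Young's inequality with
  weight sqrt h costs h^(3/2) per step. The entropy of p_(t+h) is never computed: Gibbs' inequality
  replaces it by the cross entropy with the rescaled density a^(-d) p_t(x / a), for which the noised
  variable is a Gaussian perturbation of the earlier one. The step size is chosen after all other
  quantities, so the constants of the discretisation error can be crude.\<close>

subsection \<open>Lebesgue measure on coordinate space\<close>

interpretation leb: product_sigma_finite "\<lambda>_::nat. lborel :: real measure"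
  by standard

lemma space_lebd [simp]: "space (lebd d) = Rd d"
  by (simp add: lebd_def Rd_def space_PiM)

lemma sigma_finite_lebd: "sigma_finite_measure (lebd d)"
  unfolding lebd_def by (rule leb.sigma_finite) simp

interpretation lebd: sigma_finite_measure "lebd d" for d
  by (rule sigma_finite_lebd)

interpretation lebd2: pair_sigma_finite "lebd d" "lebd e" for d e
  by standard

lemma measurable_lebd_component [measurable]:
  "i < d \<Longrightarrow> (\<lambda>x. x i) \<in> borel_measurable (lebd d)"
  unfolding lebd_def by (rule measurable_component_singleton[where M="\<lambda>_. lborel", simplified]) auto

lemma measurable_restrict_lebd [measurable (raw)]:
  assumes "\<And>i. i < d \<Longrightarrow> (\<lambda>x. f x i) \<in> borel_measurable M"
  shows "(\<lambda>x. \<lambda>i\<in>{..<d}. f x i) \<in> M \<rightarrow>\<^sub>M lebd d"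
  unfolding lebd_def by (rule measurable_restrict) (use assms in auto)

lemma restrict_in_Rd [simp]: "restrict f {..<d} \<in> Rd d"
  by (auto simp: Rd_def)

lemma Rd_restrict: "x \<in> Rd d \<Longrightarrow> restrict x {..<d} = x"
  by (auto simp: Rd_def)

text \<open>The factor |c|^d splits into one factor per coordinate, so uniqueness of product
  measures reduces the change of variables to the one-dimensional one on boxes.\<close>

lemma lebd_affine:
  assumes c: "c \<noteq> 0"
  shows "lebd d = density (distr (lebd d) (lebd d) (\<lambda>x. \<lambda>i\<in>{..<d}. m i + c * x i)) (\<lambda>_. ennreal (\<bar>c\<bar> ^ d))"
    (is "_ = density (distr _ _ ?T) _")
proof -
  have T [measurable]: "?T \<in> lebd d \<rightarrow>\<^sub>M lebd d"
    by measurable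
  have "density (distr (lebd d) (lebd d) ?T) (\<lambda>_. ennreal (\<bar>c\<bar> ^ d)) = PiM {..<d} (\<lambda>_. lborel)"
  proof (rule leb.PiM_eqI)
    show "sets (density (distr (lebd d) (lebd d) ?T) (\<lambda>_. ennreal (\<bar>c\<bar> ^ d))) = sets (PiM {..<d} (\<lambda>_. lborel))"
      by (simp add: lebd_def)
  next
    fix A :: "nat \<Rightarrow> real set" assume A: "\<And>i. i \<in> {..<d} \<Longrightarrow> A i \<in> sets lborel"
    have PA: "Pi\<^sub>E {..<d} A \<in> sets (lebd d)"
      unfolding lebd_def using A by (intro sets_PiM_I_finite) auto
    have one: "ennreal \<bar>c\<bar> * emeasure lborel {x. m i + c * x \<in> A i} = emeasure lborel (A i)" if "i < d" for i
    proof -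
      have [measurable]: "A i \<in> sets borel" using A that by simp
      have "emeasure lborel (A i) = (\<integral>\<^sup>+x. indicator (A i) x \<partial>lborel)" by simp
      also have "\<dots> = ennreal \<bar>c\<bar> * (\<integral>\<^sup>+x. indicator (A i) (m i + c * x) \<partial>lborel)"
        using c by (subst nn_integral_real_affine[where t="m i" and c=c]) auto
      also have "(\<integral>\<^sup>+x. indicator (A i) (m i + c * x) \<partial>lborel) = (\<integral>\<^sup>+x. indicator {x. m i + c * x \<in> A i} x \<partial>lborel)"
        by (intro nn_integral_cong) (auto simp: indicator_def)
      also have "\<dots> = emeasure lborel {x. m i + c * x \<in> A i}"
        by (rule nn_integral_indicator) measurable
      finally show ?thesis by simp
    qed
    have pre: "?T -` Pi\<^sub>E {..<d} A \<inter> space (lebd d) = Pi\<^sub>E {..<d} (\<lambda>i. {x. m i + c * x \<in> A i})"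
      unfolding space_lebd Rd_def by (rule set_eqI) (simp add: PiE_iff conj_commute)
    have "emeasure (density (distr (lebd d) (lebd d) ?T) (\<lambda>_. ennreal (\<bar>c\<bar> ^ d))) (Pi\<^sub>E {..<d} A)
        = ennreal (\<bar>c\<bar> ^ d) * emeasure (lebd d) (Pi\<^sub>E {..<d} (\<lambda>i. {x. m i + c * x \<in> A i}))"
      using PA by (subst emeasure_density_const) (auto simp: emeasure_distr[OF T] pre[simplified])
    also have "emeasure (lebd d) (Pi\<^sub>E {..<d} (\<lambda>i. {x. m i + c * x \<in> A i}))
       = (\<Prod>i<d. emeasure lborel {x. m i + c * x \<in> A i})"
      unfolding lebd_def
    proof (rule leb.emeasure_PiM)
      fix i assume i: "i \<in> {..<d}"
      then have [measurable]: "A i \<in> sets borel" using A by simp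
      show "{x. m i + c * x \<in> A i} \<in> sets lborel" by measurable
    qed simp
    also have "ennreal (\<bar>c\<bar> ^ d) * \<dots> = (\<Prod>i<d. ennreal \<bar>c\<bar> * emeasure lborel {x. m i + c * x \<in> A i})"
      using c by (simp add: prod.distrib ennreal_power)
    also have "\<dots> = (\<Prod>i<d. emeasure lborel (A i))"
      by (intro prod.cong) (auto simp: one)
    finally show "emeasure (density (distr (lebd d) (lebd d) ?T) (\<lambda>_. ennreal (\<bar>c\<bar> ^ d))) (Pi\<^sub>E {..<d} A)
       = (\<Prod>i\<in>{..<d}. emeasure lborel (A i))" .
  qed simp
  then show ?thesis by (simp add: lebd_def)
qed

lemma nn_integral_lebd_affine:
  assumes c: "c \<noteq> 0" and f [measurable]: "f \<in> borel_measurable (lebd d)"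
  shows "(\<integral>\<^sup>+x. f x \<partial>lebd d) = ennreal (\<bar>c\<bar> ^ d) * (\<integral>\<^sup>+x. f (\<lambda>i\<in>{..<d}. m i + c * x i) \<partial>lebd d)"
  by (subst lebd_affine[OF c, of d m])
     (simp add: nn_integral_density nn_integral_distr nn_integral_cmult)

text \<open>Translation invariance is what the discrete summation by parts for the entropy rests
  on.\<close>

lemma integral_lebd_shift:
  fixes f :: "(nat \<Rightarrow> real) \<Rightarrow> real"
  assumes f [measurable]: "f \<in> borel_measurable (lebd d)"
  shows "(\<integral>x. f (\<lambda>i\<in>{..<d}. x i + m i) \<partial>lebd d) = (\<integral>x. f x \<partial>lebd d)"
    and "integrable (lebd d) (\<lambda>x. f (\<lambda>i\<in>{..<d}. x i + m i)) \<longleftrightarrow> integrable (lebd d) f"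
proof -
  have T [measurable]: "(\<lambda>x. \<lambda>i\<in>{..<d}. x i + m i) \<in> lebd d \<rightarrow>\<^sub>M lebd d"
    by measurable
  have *: "distr (lebd d) (lebd d) (\<lambda>x. \<lambda>i\<in>{..<d}. x i + m i) = lebd d"
    using lebd_affine[of 1 d m] by (simp add: density_1 add.commute)
  show "(\<integral>x. f (\<lambda>i\<in>{..<d}. x i + m i) \<partial>lebd d) = (\<integral>x. f x \<partial>lebd d)"
    by (subst (2) *[symmetric], subst integral_distr) auto
  show "integrable (lebd d) (\<lambda>x. f (\<lambda>i\<in>{..<d}. x i + m i)) \<longleftrightarrow> integrable (lebd d) f"
    by (subst (2) *[symmetric], subst integrable_distr_eq) auto
qed

subsection \<open>Gaussian measures\<close>

lemma vdist_sq: "(vdist d x y)^2 = (\<Sum>i<d. (x i - y i)^2)"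
  by (simp add: vdist_def sum_nonneg)

lemma vnorm_sq: "(vnorm d x)^2 = (\<Sum>i<d. (x i)^2)"
  by (simp add: vnorm_def sum_nonneg)

lemma vdist_nonneg [simp]: "vdist d x y \<ge> 0"
  by (simp add: vdist_def sum_nonneg)

lemma gauss_dens_eq: "gauss_dens d m v x = (2 * pi * v) powr (- real d / 2) * exp (- ((\<Sum>i<d. (x i - m i)^2) / (2 * v)))"
  by (simp add: gauss_dens_def vdist_sq)

lemma gauss_dens_pos: "v > 0 \<Longrightarrow> gauss_dens d m v x > 0"
  by (simp add: gauss_dens_eq)

lemma gauss_dens_nonneg [simp]: "gauss_dens d m v x \<ge> 0"
  by (simp add: gauss_dens_eq)

lemma ln_gauss_dens:
  "v > 0 \<Longrightarrow> ln (gauss_dens d m v x) = - (real d / 2) * ln (2 * pi * v) - (\<Sum>i<d. (x i - m i)^2) / (2 * v)"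
  by (simp add: gauss_dens_eq ln_mult ln_powr)

lemma measurable_gauss_dens [measurable (raw)]:
  assumes "\<And>i. i < d \<Longrightarrow> (\<lambda>w. m w i) \<in> borel_measurable M"
    and "\<And>i. i < d \<Longrightarrow> (\<lambda>w. f w i) \<in> borel_measurable M"
  shows "(\<lambda>w. gauss_dens d (m w) v (f w)) \<in> borel_measurable M"
  unfolding gauss_dens_eq using assms by measurable

lemma gauss_dens_prod:
  assumes v: "v > 0"
  shows "gauss_dens d m v x = (\<Prod>i<d. normal_density (m i) (sqrt v) (x i))"
proof -
  have "(2 * pi * v) powr (- real d / 2) = (1 / sqrt (2 * pi * v)) ^ d"
  proof -
    have "(2 * pi * v) powr (- real d / 2) = ((2 * pi * v) powr (- 1 / 2)) powr real d"
      by (simp add: powr_powr)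
    also have "(2 * pi * v) powr (- 1 / 2) = 1 / sqrt (2 * pi * v)"
      using v by (simp add: powr_minus_divide powr_half_sqrt)
    finally show ?thesis using v by (simp add: powr_realpow)
  qed
  moreover have "exp (- ((\<Sum>i<d. (x i - m i)^2) / (2 * v))) = (\<Prod>i<d. exp (- ((x i - m i)^2) / (2 * v)))"
    by (simp add: exp_sum[symmetric] sum_negf sum_divide_distrib)
  ultimately show ?thesis
    using v by (simp add: gauss_dens_eq normal_density_def prod.distrib prod_dividef power_one_over)
qed

lemma nn_integral_gauss_dens:
  assumes v: "v > 0" shows "(\<integral>\<^sup>+x. ennreal (gauss_dens d m v x) \<partial>lebd d) = 1"
proof -
  have "(\<integral>\<^sup>+x. ennreal (gauss_dens d m v x) \<partial>lebd d)
      = (\<integral>\<^sup>+x. (\<Prod>i<d. ennreal (normal_density (m i) (sqrt v) (x i))) \<partial>PiM {..<d} (\<lambda>_. lborel))"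
    using v by (simp add: gauss_dens_prod lebd_def prod_ennreal)
  also have "\<dots> = (\<Prod>i<d. \<integral>\<^sup>+x. ennreal (normal_density (m i) (sqrt v) x) \<partial>lborel)"
    by (rule leb.product_nn_integral_prod) auto
  also have "\<dots> = 1"
    using v by (simp add: nn_integral_eq_integral)
  finally show ?thesis .
qed

lemma sets_gauss [simp, measurable_cong]: "sets (gauss d m v) = sets (lebd d)"
  by (simp add: gauss_def)

lemma space_gauss [simp]: "space (gauss d m v) = Rd d"
  by (simp add: gauss_def)

lemma prob_space_gauss: "v > 0 \<Longrightarrow> prob_space (gauss d m v)"
  unfolding gauss_def
proof (rule prob_spaceI)
  assume v: "v > 0"
  have "emeasure (density (lebd d) (\<lambda>x. ennreal (gauss_dens d m v x))) (space (lebd d)) = (\<integral>\<^sup>+x. ennreal (gauss_dens d m v x) * indicator (space (lebd d)) x \<partial>lebd d)"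
    by (rule emeasure_density[OF _ sets.top]) measurable
  also have "\<dots> = (\<integral>\<^sup>+x. ennreal (gauss_dens d m v x) \<partial>lebd d)"
    by (rule nn_integral_cong) auto
  finally show "emeasure (density (lebd d) (\<lambda>x. ennreal (gauss_dens d m v x))) (space (density (lebd d) (\<lambda>x. ennreal (gauss_dens d m v x)))) = 1"
    using v by (simp add: nn_integral_gauss_dens)
qed

lemma nn_integral_gauss:
  assumes "f \<in> borel_measurable (lebd d)"
  shows "(\<integral>\<^sup>+x. f x \<partial>gauss d m v) = (\<integral>\<^sup>+x. ennreal (gauss_dens d m v x) * f x \<partial>lebd d)"
  unfolding gauss_def using assms by (subst nn_integral_density) auto

lemma gauss_dens_scale:
  assumes "v > 0"
  shows "sqrt v ^ d * gauss_dens d m v (\<lambda>i\<in>{..<d}. m i + sqrt v * x i) = gauss_dens d (\<lambda>_. 0) 1 x"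
proof -
  have "sqrt v ^ d * (2 * pi * v) powr (- real d / 2) = (2 * pi) powr (- real d / 2)"
  proof -
    have "sqrt v ^ d = v powr (real d / 2)"
      using assms by (simp add: powr_half_sqrt[symmetric] powr_realpow[symmetric] powr_powr)
    then show ?thesis using assms
      by (simp add: powr_mult powr_add[symmetric] mult.left_commute)
  qed
  then have *: "sqrt v ^ d * ((2 * pi * v) powr (- real d / 2) * e) = (2 * pi) powr (- real d / 2) * e" for e
    by (simp only: mult.assoc[symmetric])
  have **: "(\<Sum>i<d. ((\<lambda>i\<in>{..<d}. m i + sqrt v * x i) i - m i)^2) / (2 * v) = (\<Sum>i<d. (x i - 0)^2) / (2 * 1)"
    using assms by (simp add: power_mult_distrib sum_distrib_left[symmetric])
  show ?thesis
    unfolding gauss_dens_eq ** * by simp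
qed

text \<open>Reparametrisation moves all randomness to one fixed standard Gaussian, so a forward step
  can be studied on the product of the earlier law with the law of the noise.\<close>

lemma gauss_eq_distr:
  assumes v: "v > 0"
  shows "gauss d m v = distr (gauss d (\<lambda>_. 0) 1) (lebd d) (\<lambda>z. \<lambda>i\<in>{..<d}. m i + sqrt v * z i)"
    (is "_ = distr _ _ ?T")
proof (rule measure_eqI)
  fix A assume "A \<in> sets (gauss d m v)"
  then have A [measurable]: "A \<in> sets (lebd d)" by simp
  have T [measurable]: "?T \<in> lebd d \<rightarrow>\<^sub>M lebd d" by measurable
  have "emeasure (gauss d m v) A = (\<integral>\<^sup>+x. ennreal (gauss_dens d m v x) * indicator A x \<partial>lebd d)"
    unfolding gauss_def by (rule emeasure_density) measurable
  also have "\<dots> = ennreal (sqrt v ^ d) * (\<integral>\<^sup>+x. ennreal (gauss_dens d m v (?T x)) * indicator A (?T x) \<partial>lebd d)"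
    using v by (subst nn_integral_lebd_affine[of "sqrt v" _ _ m]) auto
  also have "\<dots> = (\<integral>\<^sup>+x. ennreal (sqrt v ^ d * gauss_dens d m v (?T x)) * indicator A (?T x) \<partial>lebd d)"
    by (subst nn_integral_cmult[symmetric]) (auto simp: ennreal_mult' mult.assoc v less_imp_le)
  also have "\<dots> = (\<integral>\<^sup>+x. ennreal (gauss_dens d (\<lambda>_. 0) 1 x) * indicator A (?T x) \<partial>lebd d)"
    by (simp add: gauss_dens_scale v)
  also have "\<dots> = (\<integral>\<^sup>+x. indicator A (?T x) \<partial>gauss d (\<lambda>_. 0) 1)"
    by (subst nn_integral_gauss) auto
  also have "\<dots> = emeasure (distr (gauss d (\<lambda>_. 0) 1) (lebd d) ?T) A"
    by (subst nn_integral_indicator[symmetric], simp, subst nn_integral_distr) auto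
  finally show "emeasure (gauss d m v) A = emeasure (distr (gauss d (\<lambda>_. 0) 1) (lebd d) ?T) A" .
qed simp

lemma measurable_lebd_fst [measurable]:
  "i < d \<Longrightarrow> (\<lambda>w. fst w i) \<in> borel_measurable (lebd d \<Otimes>\<^sub>M M)"
  by (rule measurable_compose[OF measurable_fst measurable_lebd_component])

lemma measurable_lebd_snd [measurable]:
  "i < d \<Longrightarrow> (\<lambda>w. snd w i) \<in> borel_measurable (M \<Otimes>\<^sub>M lebd d)"
  by (rule measurable_compose[OF measurable_snd measurable_lebd_component])

section \<open>The standard Gaussian: independent coordinates, moments, symmetry\<close>

abbreviation std_gauss :: "nat \<Rightarrow> (nat \<Rightarrow> real) measure" where
  "std_gauss d \<equiv> gauss d (\<lambda>_. 0) 1"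

interpretation std_gauss: prob_space "std_gauss d" for d
  by (rule prob_space_gauss) simp

interpretation std_normal: product_sigma_finite "\<lambda>_::nat. std_normal_distribution"
  by (intro product_sigma_finite.intro prob_space_imp_sigma_finite prob_space_normal_density) simp

lemma std_gauss_eq_PiM: "std_gauss d = PiM {..<d} (\<lambda>_. std_normal_distribution)"
proof (rule std_normal.PiM_eqI)
  show "sets (std_gauss d) = sets (Pi\<^sub>M {..<d} (\<lambda>_. std_normal_distribution))"
    unfolding sets_gauss lebd_def by (rule sets_PiM_cong) auto
next
  fix A :: "nat \<Rightarrow> real set" assume A: "\<And>i. i \<in> {..<d} \<Longrightarrow> A i \<in> sets std_normal_distribution"
  have PA: "Pi\<^sub>E {..<d} A \<in> sets (lebd d)"
    unfolding lebd_def using A by (intro sets_PiM_I_finite) auto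
  have "emeasure (std_gauss d) (Pi\<^sub>E {..<d} A)
    = (\<integral>\<^sup>+x. ennreal (gauss_dens d (\<lambda>_. 0) 1 x) * indicator (Pi\<^sub>E {..<d} A) x \<partial>lebd d)"
    unfolding gauss_def using PA by (intro emeasure_density) measurable
  also have "\<dots> = (\<integral>\<^sup>+x. (\<Prod>i<d. ennreal (std_normal_density (x i)) * indicator (A i) (x i)) \<partial>lebd d)"
  proof (rule nn_integral_cong)
    fix x assume x: "x \<in> space (lebd d)"
    have "indicator (Pi\<^sub>E {..<d} A) x = (\<Prod>i<d. indicator (A i) (x i) :: ennreal)"
    proof (cases "x \<in> Pi\<^sub>E {..<d} A")
      case True
      then have "\<And>i. i < d \<Longrightarrow> x i \<in> A i" by (auto simp: PiE_iff)
      with True show ?thesis by simp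
    next
      case False
      then obtain i where "i < d" "x i \<notin> A i" using x by (auto simp: Rd_def PiE_iff)
      then have "\<exists>i\<in>{..<d}. indicator (A i) (x i) = (0::ennreal)"
        by (intro bexI[of _ i]) (auto simp: indicator_def)
      then have "(\<Prod>i<d. indicator (A i) (x i) :: ennreal) = 0" by (intro prod_zero) auto
      with False show ?thesis by simp
    qed
    then show "ennreal (gauss_dens d (\<lambda>_. 0) 1 x) * indicator (Pi\<^sub>E {..<d} A) x
       = (\<Prod>i<d. ennreal (std_normal_density (x i)) * indicator (A i) (x i))"
      by (simp add: gauss_dens_prod prod_ennreal prod.distrib)
  qed
  also have "\<dots> = (\<Prod>i<d. \<integral>\<^sup>+x. ennreal (std_normal_density x) * indicator (A i) x \<partial>lborel)"
    unfolding lebd_def using A by (intro leb.product_nn_integral_prod) auto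
  also have "\<dots> = (\<Prod>i<d. emeasure std_normal_distribution (A i))"
    using A by (intro prod.cong refl emeasure_density[symmetric]) auto
  finally show "emeasure (std_gauss d) (Pi\<^sub>E {..<d} A) = (\<Prod>i\<in>{..<d}. emeasure std_normal_distribution (A i))" .
qed simp

lemma std_normal_distribution_power:
  "integrable std_normal_distribution (\<lambda>z. z ^ k)"
  using integrable_normal_moment[of 1 0 k]
  by (subst integrable_density) (auto simp: mult.commute)

lemma std_gauss_component:
  assumes "i < d" and [measurable]: "f \<in> borel_measurable borel"
  shows "(\<integral>z. f (z i) \<partial>std_gauss d) = (\<integral>z. f z \<partial>std_normal_distribution :: real)"
    and "integrable (std_gauss d) (\<lambda>z. f (z i)) \<longleftrightarrow> integrable std_normal_distribution f"
proof -
  have *: "distr (std_gauss d) std_normal_distribution (\<lambda>z. z i) = std_normal_distribution"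
    unfolding std_gauss_eq_PiM using assms(1)
    by (intro distr_PiM_component) (auto intro: prob_space_normal_density)
  have "(\<lambda>z. z i) \<in> borel_measurable (std_gauss d)"
    using assms(1) by measurable
  then have m: "(\<lambda>z. z i) \<in> std_gauss d \<rightarrow>\<^sub>M std_normal_distribution"
    by simp
  have f: "f \<in> borel_measurable std_normal_distribution" by simp
  show "(\<integral>z. f (z i) \<partial>std_gauss d) = (\<integral>z. f z \<partial>std_normal_distribution)"
    by (subst *[symmetric], rule integral_distr[OF m f, symmetric])
  show "integrable (std_gauss d) (\<lambda>z. f (z i)) \<longleftrightarrow> integrable std_normal_distribution f"
    by (subst *[symmetric], rule integrable_distr_eq[OF m f, symmetric])
qed

lemma integrable_std_gauss_power: "i < d \<Longrightarrow> integrable (std_gauss d) (\<lambda>z. z i ^ k)"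
  using std_gauss_component(2)[of i d "\<lambda>x. x ^ k"] by (simp add: std_normal_distribution_power)

lemma integrable_mult_of_squares:
  fixes f g :: "'a \<Rightarrow> real"
  assumes [measurable]: "f \<in> borel_measurable M" "g \<in> borel_measurable M"
    and "integrable M (\<lambda>x. f x ^ 2)" "integrable M (\<lambda>x. g x ^ 2)"
  shows "integrable M (\<lambda>x. f x * g x)"
proof (rule Bochner_Integration.integrable_bound[where f="\<lambda>x. f x ^ 2 + g x ^ 2"])
  have "\<bar>a * b\<bar> \<le> a\<^sup>2 + b\<^sup>2" for a b :: real
    using sum_squares_bound[of "\<bar>a\<bar>" "\<bar>b\<bar>"] mult_nonneg_nonneg[of "\<bar>a\<bar>" "\<bar>b\<bar>"]
    by (simp add: abs_mult del: mult_nonneg_nonneg)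
  then show "AE x in M. norm (f x * g x) \<le> norm (f x ^ 2 + g x ^ 2)"
    by (auto intro!: AE_I2)
qed (use assms in auto)

lemma integrable_std_gauss_mult: "i < d \<Longrightarrow> j < d \<Longrightarrow> integrable (std_gauss d) (\<lambda>z. z i * z j)"
  by (intro integrable_mult_of_squares integrable_std_gauss_power; measurable)

lemma std_gauss_mean: "i < d \<Longrightarrow> (\<integral>z. z i \<partial>std_gauss d) = 0"
  using integral_normal_moment_odd[of 1 0 0]
  by (subst std_gauss_component) (auto simp: integral_density mult.commute)

lemma std_gauss_second: "i < d \<Longrightarrow> (\<integral>z. z i ^ 2 \<partial>std_gauss d) = 1"
  using integral_normal_moment_even[of 1 0 1]
  by (subst std_gauss_component) (auto simp: integral_density mult.commute)

lemma std_gauss_cov: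
  assumes i: "i < d" and j: "j < d" and ne: "i \<noteq> j"
  shows "(\<integral>z. z i * z j \<partial>std_gauss d) = 0"
proof -
  \<comment> \<open>Padding with the constant one writes \<open>z i * z j\<close> as a product over
    all coordinates, and the factor at \<open>i\<close> integrates to zero.\<close>
  define f :: "nat \<Rightarrow> real \<Rightarrow> real" where "f k x = (if k = i \<or> k = j then x else 1)" for k x
  have f: "integrable std_normal_distribution (f k)" for k
    using std_normal_distribution_power[of 1] std_normal_distribution_power[of 0]
    by (cases "k = i \<or> k = j") (auto simp: f_def[abs_def])
  have "(\<Prod>k<d. f k (z k)) = z i * z j" for z
  proof -
    have "(\<Prod>k<d. f k (z k)) = (\<Prod>k\<in>{i,j}. f k (z k))"
      using i j by (intro prod.mono_neutral_right) (auto simp: f_def)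
    then show ?thesis using ne by (simp add: f_def)
  qed
  then have "(\<integral>z. z i * z j \<partial>std_gauss d) = (\<integral>z. (\<Prod>k<d. f k (z k)) \<partial>PiM {..<d} (\<lambda>_. std_normal_distribution))"
    by (simp add: std_gauss_eq_PiM)
  also have "\<dots> = (\<Prod>k<d. \<integral>x. f k x \<partial>std_normal_distribution)"
    using f by (intro std_normal.product_integral_prod) auto
  also have "\<dots> = 0"
  proof (rule prod_zero)
    have "(\<integral>x. f i x \<partial>std_normal_distribution) = 0"
      using std_gauss_mean[OF i] std_gauss_component(1)[OF i, of "\<lambda>x. x"] by (simp add: f_def[abs_def])
    then show "\<exists>k\<in>{..<d}. (\<integral>x. f k x \<partial>std_normal_distribution) = 0" using i by auto
  qed simp
  finally show ?thesis .
qed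

lemma integrable_std_gauss_norm4: "integrable (std_gauss d) (\<lambda>z. (\<Sum>i<d. z i ^ 2) ^ 2)"
proof -
  have "integrable (std_gauss d) (\<lambda>z. z i ^ 2 * z j ^ 2)" if "i < d" "j < d" for i j
    using that integrable_std_gauss_power[of _ d 4]
    by (intro integrable_mult_of_squares) (simp_all add: power_mult[symmetric])
  then show ?thesis
    unfolding power2_eq_square[of "sum _ _"] sum_product
    by (intro Bochner_Integration.integrable_sum) auto
qed

text \<open>Pairing z with -z is what cancels the first-order term of ln p in the entropy
  estimate.\<close>

lemma std_gauss_sym:
  assumes [measurable]: "f \<in> borel_measurable (lebd d)"
  shows "(\<integral>z. f (\<lambda>i\<in>{..<d}. - z i) \<partial>std_gauss d) = (\<integral>z. f z \<partial>std_gauss d :: real)"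
    and "integrable (std_gauss d) (\<lambda>z. f (\<lambda>i\<in>{..<d}. - z i)) \<longleftrightarrow> integrable (std_gauss d) f"
proof -
  let ?T = "\<lambda>z. \<lambda>i\<in>{..<d}. - z i :: real"
  have T [measurable]: "?T \<in> lebd d \<rightarrow>\<^sub>M lebd d" by measurable
  have *: "distr (std_gauss d) (lebd d) ?T = std_gauss d"
  proof (rule measure_eqI)
    fix A assume "A \<in> sets (distr (std_gauss d) (lebd d) ?T)"
    then have A [measurable]: "A \<in> sets (lebd d)" by simp
    have "emeasure (std_gauss d) A = (\<integral>\<^sup>+x. ennreal (gauss_dens d (\<lambda>_. 0) 1 x) * indicator A x \<partial>lebd d)"
      unfolding gauss_def by (rule emeasure_density) measurable
    also have "\<dots> = (\<integral>\<^sup>+x. ennreal (gauss_dens d (\<lambda>_. 0) 1 (?T x)) * indicator A (?T x) \<partial>lebd d)"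
      by (subst nn_integral_lebd_affine[of "-1" _ _ "\<lambda>_. 0"]) auto
    also have "\<dots> = (\<integral>\<^sup>+x. ennreal (gauss_dens d (\<lambda>_. 0) 1 x) * indicator A (?T x) \<partial>lebd d)"
      by (simp add: gauss_dens_eq)
    also have "\<dots> = (\<integral>\<^sup>+x. indicator A (?T x) \<partial>std_gauss d)"
      by (subst nn_integral_gauss) auto
    also have "\<dots> = emeasure (distr (std_gauss d) (lebd d) ?T) A"
      by (subst nn_integral_indicator[symmetric], simp, subst nn_integral_distr) auto
    finally show "emeasure (distr (std_gauss d) (lebd d) ?T) A = emeasure (std_gauss d) A" by simp
  qed simp
  show "(\<integral>z. f (?T z) \<partial>std_gauss d) = (\<integral>z. f z \<partial>std_gauss d)"
    by (subst (2) *[symmetric], subst integral_distr) auto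
  show "integrable (std_gauss d) (\<lambda>z. f (?T z)) \<longleftrightarrow> integrable (std_gauss d) f"
    by (subst (2) *[symmetric], subst integrable_distr_eq) auto
qed

text \<open>The substitution y = m + u / a turns the integral into a convolution of two centred
  normal densities.\<close>

lemma normal_density_compose:
  assumes a: "a > 0" and v: "v > 0" and w: "w > 0"
  shows "(\<integral>\<^sup>+y. ennreal (normal_density m (sqrt w) y * normal_density (a * y) (sqrt v) x) \<partial>lborel)
    = ennreal (normal_density (a * m) (sqrt (v + a\<^sup>2 * w)) x)"
proof -
  have *: "normal_density m (sqrt w) (m + 1/a * u) = a * normal_density 0 (a * sqrt w) u" for u
    using a w by (simp add: normal_density_def power_mult_distrib power_divide real_sqrt_mult field_simps)
  have **: "normal_density (a * (m + 1/a * u)) (sqrt v) x = normal_density 0 (sqrt v) ((x - a * m) - u)" for u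
    using a by (simp add: normal_density_def distrib_left diff_diff_eq)
  have "(\<integral>\<^sup>+y. ennreal (normal_density m (sqrt w) y * normal_density (a * y) (sqrt v) x) \<partial>lborel)
     = ennreal (1/a) * (\<integral>\<^sup>+u. ennreal (normal_density m (sqrt w) (m + 1/a * u) * normal_density (a * (m + 1/a * u)) (sqrt v) x) \<partial>lborel)"
    using a by (subst nn_integral_real_affine[where c="1/a" and t=m]) (auto simp: normal_density_def)
  also have "\<dots> = (\<integral>\<^sup>+u. ennreal (normal_density 0 (sqrt v) ((x - a * m) - u) * normal_density 0 (a * sqrt w) u) \<partial>lborel)"
    unfolding * ** using a
    by (subst nn_integral_cmult[symmetric]) (auto simp: ennreal_mult'[symmetric] mult_ac)
  also have "\<dots> = ennreal (normal_density 0 (sqrt ((sqrt v)\<^sup>2 + (a * sqrt w)\<^sup>2)) (x - a * m))"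
    using conv_normal_density_zero_mean[of "sqrt v" "a * sqrt w"] a v w by (auto dest: fun_cong)
  also have "\<dots> = ennreal (normal_density (a * m) (sqrt (v + a\<^sup>2 * w)) x)"
    using v w by (simp add: normal_density_def power_mult_distrib)
  finally show ?thesis .
qed

text \<open>Chapman-Kolmogorov identity for the Gaussian kernels, obtained coordinate by coordinate;
  it makes the forward densities a Markov evolution.\<close>

lemma gauss_dens_compose:
  assumes a: "a > 0" and v: "v > 0" and w: "w > 0"
  shows "(\<integral>\<^sup>+y. ennreal (gauss_dens d m w y * gauss_dens d (\<lambda>i. a * y i) v x) \<partial>lebd d)
    = ennreal (gauss_dens d (\<lambda>i. a * m i) (v + a\<^sup>2 * w) x)"
proof -
  have "(\<integral>\<^sup>+y. ennreal (gauss_dens d m w y * gauss_dens d (\<lambda>i. a * y i) v x) \<partial>lebd d)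
     = (\<integral>\<^sup>+y. (\<Prod>i<d. ennreal (normal_density (m i) (sqrt w) (y i) * normal_density (a * y i) (sqrt v) (x i))) \<partial>lebd d)"
    using v w by (simp add: gauss_dens_prod prod.distrib[symmetric] prod_ennreal)
  also have "\<dots> = (\<Prod>i<d. \<integral>\<^sup>+y. ennreal (normal_density (m i) (sqrt w) y * normal_density (a * y) (sqrt v) (x i)) \<partial>lborel)"
    unfolding lebd_def by (intro leb.product_nn_integral_prod) (auto simp: normal_density_def)
  also have "\<dots> = ennreal (gauss_dens d (\<lambda>i. a * m i) (v + a\<^sup>2 * w) x)"
  proof -
    have "v + a\<^sup>2 * w > 0" using v w by (simp add: add_pos_nonneg)
    then show ?thesis
      using assms by (simp add: normal_density_compose gauss_dens_prod prod_ennreal)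
  qed
  finally show ?thesis .
qed

subsection \<open>Positive densities and Gaussian blurring\<close>

locale pos_dens =
  fixes d :: nat and p :: "(nat \<Rightarrow> real) \<Rightarrow> real"
  assumes meas [measurable]: "p \<in> borel_measurable (lebd d)"
    and pos: "\<And>x. x \<in> Rd d \<Longrightarrow> p x > 0"
    and mass: "(\<integral>\<^sup>+x. ennreal (p x) \<partial>lebd d) = 1"
begin

definition P :: "(nat \<Rightarrow> real) measure" where
  "P = density (lebd d) (\<lambda>x. ennreal (p x))"

lemma sets_P [simp, measurable_cong]: "sets P = sets (lebd d)"
  by (simp add: P_def)

lemma space_P [simp]: "space P = Rd d"
  by (simp add: P_def)

lemma prob_space_P: "prob_space P"
proof (rule prob_spaceI)
  have "emeasure P (space (lebd d)) = (\<integral>\<^sup>+x. ennreal (p x) * indicator (space (lebd d)) x \<partial>lebd d)"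
    unfolding P_def by (rule emeasure_density[OF _ sets.top]) measurable
  also have "\<dots> = (\<integral>\<^sup>+x. ennreal (p x) \<partial>lebd d)"
    by (rule nn_integral_cong) auto
  finally show "emeasure P (space P) = 1" by (simp add: mass)
qed

sublocale P: prob_space P by (rule prob_space_P)

sublocale PN: pair_prob_space P "std_gauss d" ..

abbreviation PZ :: "((nat \<Rightarrow> real) \<times> (nat \<Rightarrow> real)) measure" where
  "PZ \<equiv> P \<Otimes>\<^sub>M std_gauss d"

lemma integral_P:
  "f \<in> borel_measurable (lebd d) \<Longrightarrow> (\<integral>x. f x \<partial>P) = (\<integral>x. p x * f x \<partial>lebd d :: real)"
  unfolding P_def by (subst integral_density) (auto intro!: AE_I2 less_imp_le pos)

lemma integrable_P:
  "f \<in> borel_measurable (lebd d) \<Longrightarrow> integrable P f \<longleftrightarrow> integrable (lebd d) (\<lambda>x. p x * f x :: real)"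
  unfolding P_def by (subst integrable_density) (auto intro!: AE_I2 less_imp_le pos)

lemma nn_integral_P:
  "f \<in> borel_measurable (lebd d) \<Longrightarrow> (\<integral>\<^sup>+x. f x \<partial>P) = (\<integral>\<^sup>+x. ennreal (p x) * f x \<partial>lebd d)"
  unfolding P_def by (subst nn_integral_density) auto

lemma integrable_p: "integrable (lebd d) p"
  using mass by (intro integrableI_nonneg) (auto intro!: AE_I2 less_imp_le pos)

end

text \<open>Density of a Y + sqrt v Z, where Y has density \<open>p\<close> and Z is an independent
  standard Gaussian. With a = exp (- h / 2) and v = 1 - exp (- h) this is the Ornstein-Uhlenbeck
  evolution over time h.\<close>

definition blur :: "nat \<Rightarrow> real \<Rightarrow> real \<Rightarrow> ((nat \<Rightarrow> real) \<Rightarrow> real) \<Rightarrow> (nat \<Rightarrow> real) \<Rightarrow> real" where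
  "blur d a v p x = (\<integral>y. p y * gauss_dens d (\<lambda>i. a * y i) v x \<partial>lebd d)"

lemma fwd_dens_blur: "t \<noteq> 0 \<Longrightarrow> fwd_dens d p t = blur d (exp (- t / 2)) (1 - exp (- t)) p"
  by (auto simp: fwd_dens_def blur_def)

lemma fwd_dens_0 [simp]: "fwd_dens d p 0 = p"
  by (auto simp: fwd_dens_def)

lemma gauss_dens_le: "v > 0 \<Longrightarrow> gauss_dens d m v x \<le> (2 * pi * v) powr (- real d / 2)"
  unfolding gauss_dens_eq by (rule mult_right_le_one_le) (auto simp: sum_nonneg)

abbreviation noised :: "nat \<Rightarrow> real \<Rightarrow> real \<Rightarrow> (nat \<Rightarrow> real) \<Rightarrow> (nat \<Rightarrow> real) \<Rightarrow> nat \<Rightarrow> real" where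
  "noised d a v y z \<equiv> (\<lambda>i\<in>{..<d}. a * y i + sqrt v * z i)"

context pos_dens begin

lemma integrable_blur:
  assumes "v > 0" shows "integrable (lebd d) (\<lambda>y. p y * gauss_dens d (\<lambda>i. a * y i) v x)"
proof (rule Bochner_Integration.integrable_bound)
  show "integrable (lebd d) (\<lambda>y. p y * (2 * pi * v) powr (- real d / 2))"
    using integrable_p by simp
  show "AE y in lebd d. norm (p y * gauss_dens d (\<lambda>i. a * y i) v x) \<le> norm (p y * (2 * pi * v) powr (- real d / 2))"
    using gauss_dens_le[OF assms] by (intro AE_I2) (auto simp: abs_mult intro!: mult_left_mono)
qed measurable

lemma nn_integral_blur:
  assumes "v > 0"
  shows "ennreal (blur d a v p x) = (\<integral>\<^sup>+y. ennreal (p y * gauss_dens d (\<lambda>i. a * y i) v x) \<partial>lebd d)"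
  unfolding blur_def
  by (rule nn_integral_eq_integral[symmetric, OF integrable_blur[OF assms]])
     (auto intro!: AE_I2 mult_nonneg_nonneg less_imp_le[OF pos])

lemma blur_measurable [measurable]: "blur d a v p \<in> borel_measurable (lebd d)"
proof -
  have [measurable]: "(\<lambda>(x, y). p y * gauss_dens d (\<lambda>i. a * y i) v x) \<in> borel_measurable (lebd d \<Otimes>\<^sub>M lebd d)"
    unfolding split_beta' by measurable
  show ?thesis unfolding blur_def by measurable
qed

text \<open>The total mass one of \<open>p\<close> witnesses that Lebesgue measure is not zero; this
  is what makes blurred densities strictly positive.\<close>

lemma lebd_not_AE_False: "\<not> (AE x in lebd d. False)"
proof
  assume "AE x in lebd d. False"
  then have "(\<integral>\<^sup>+x. ennreal (p x) \<partial>lebd d) = (\<integral>\<^sup>+x. 0 \<partial>lebd d)"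
    by (intro nn_integral_cong_AE) auto
  then show False using mass by simp
qed

lemma blur_pos:
  assumes v: "v > 0" and x: "x \<in> Rd d" shows "blur d a v p x > 0"
proof (rule ccontr)
  assume "\<not> ?thesis"
  then have "ennreal (blur d a v p x) = 0" by (simp add: ennreal_eq_0_iff)
  then have "AE y in lebd d. ennreal (p y * gauss_dens d (\<lambda>i. a * y i) v x) = 0"
    unfolding nn_integral_blur[OF v] by (subst (asm) nn_integral_0_iff_AE) auto
  moreover have "AE y in lebd d. ennreal (p y * gauss_dens d (\<lambda>i. a * y i) v x) \<noteq> 0"
    using pos gauss_dens_pos[OF v] by (auto intro!: AE_I2 simp: ennreal_eq_0_iff not_le)
  ultimately have "AE y in lebd d. False" by eventually_elim auto
  then show False using lebd_not_AE_False by blast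
qed

text \<open>Tonelli exchanges the mixture with the noise, and the inner Gaussian integral is
  reparametrised; this identifies \<open>blur\<close> as the density of the noised variable.\<close>

lemma nn_integral_blur_noised:
  assumes v: "v > 0" and [measurable]: "f \<in> borel_measurable (lebd d)"
  shows "(\<integral>\<^sup>+x. ennreal (blur d a v p x) * f x \<partial>lebd d)
    = (\<integral>\<^sup>+w. f (noised d a v (fst w) (snd w)) \<partial>PZ)"
proof -
  have 1: "(\<integral>\<^sup>+x. ennreal (gauss_dens d (\<lambda>i. a * y i) v x) * f x \<partial>lebd d) = (\<integral>\<^sup>+z. f (noised d a v y z) \<partial>std_gauss d)" for y
  proof -
    have "(\<integral>\<^sup>+x. ennreal (gauss_dens d (\<lambda>i. a * y i) v x) * f x \<partial>lebd d) = (\<integral>\<^sup>+x. f x \<partial>gauss d (\<lambda>i. a * y i) v)"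
      by (simp add: nn_integral_gauss)
    also have "\<dots> = (\<integral>\<^sup>+z. f (noised d a v y z) \<partial>std_gauss d)"
      by (subst gauss_eq_distr[OF v]) (auto intro!: nn_integral_distr)
    finally show ?thesis .
  qed
  have "(\<integral>\<^sup>+x. ennreal (blur d a v p x) * f x \<partial>lebd d)
     = (\<integral>\<^sup>+x. \<integral>\<^sup>+y. ennreal (p y * gauss_dens d (\<lambda>i. a * y i) v x) * f x \<partial>lebd d \<partial>lebd d)"
    unfolding nn_integral_blur[OF v] by (intro nn_integral_cong nn_integral_multc[symmetric]) measurable
  also have "\<dots> = (\<integral>\<^sup>+y. \<integral>\<^sup>+x. ennreal (p y * gauss_dens d (\<lambda>i. a * y i) v x) * f x \<partial>lebd d \<partial>lebd d)"
    by (rule lebd2.Fubini'[symmetric]) (unfold split_beta', measurable)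
  also have "\<dots> = (\<integral>\<^sup>+y. ennreal (p y) * \<integral>\<^sup>+z. f (noised d a v y z) \<partial>std_gauss d \<partial>lebd d)"
  proof (intro nn_integral_cong)
    fix y assume y: "y \<in> space (lebd d)"
    have "(\<integral>\<^sup>+x. ennreal (p y * gauss_dens d (\<lambda>i. a * y i) v x) * f x \<partial>lebd d)
       = (\<integral>\<^sup>+x. ennreal (p y) * (ennreal (gauss_dens d (\<lambda>i. a * y i) v x) * f x) \<partial>lebd d)"
      using pos[of y] y by (simp add: ennreal_mult mult.assoc less_imp_le)
    also have "\<dots> = ennreal (p y) * \<integral>\<^sup>+x. ennreal (gauss_dens d (\<lambda>i. a * y i) v x) * f x \<partial>lebd d"
      by (rule nn_integral_cmult) measurable
    finally show "(\<integral>\<^sup>+x. ennreal (p y * gauss_dens d (\<lambda>i. a * y i) v x) * f x \<partial>lebd d)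
      = ennreal (p y) * \<integral>\<^sup>+z. f (noised d a v y z) \<partial>std_gauss d" by (simp add: 1)
  qed
  also have "\<dots> = (\<integral>\<^sup>+y. \<integral>\<^sup>+z. f (noised d a v y z) \<partial>std_gauss d \<partial>P)"
    by (rule nn_integral_P[symmetric]) measurable
  also have "\<dots> = (\<integral>\<^sup>+w. f (noised d a v (fst w) (snd w)) \<partial>PZ)"
    by (subst std_gauss.nn_integral_fst[symmetric]) auto
  finally show ?thesis .
qed

lemma pos_dens_blur: "v > 0 \<Longrightarrow> pos_dens d (blur d a v p)"
proof
  assume v: "v > 0"
  interpret PN: pair_prob_space P "std_gauss d" ..
  show "(\<integral>\<^sup>+x. ennreal (blur d a v p x) \<partial>lebd d) = 1"
    using nn_integral_blur_noised[OF v, of "\<lambda>_. 1"] PN.emeasure_space_1 by simp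
qed (auto simp: blur_pos)

lemma blur_eq_distr:
  assumes v: "v > 0"
  shows "density (lebd d) (\<lambda>x. ennreal (blur d a v p x))
    = distr PZ (lebd d) (\<lambda>w. noised d a v (fst w) (snd w))"
proof (rule measure_eqI)
  fix A assume "A \<in> sets (density (lebd d) (\<lambda>x. ennreal (blur d a v p x)))"
  then have A [measurable]: "A \<in> sets (lebd d)" by simp
  have T [measurable]: "(\<lambda>w. noised d a v (fst w) (snd w)) \<in> PZ \<rightarrow>\<^sub>M lebd d"
    by measurable
  show "emeasure (density (lebd d) (\<lambda>x. ennreal (blur d a v p x))) A
    = emeasure (distr PZ (lebd d) (\<lambda>w. noised d a v (fst w) (snd w))) A"
    by (subst emeasure_density, simp, simp, subst nn_integral_blur_noised[OF v], simp,
        subst nn_integral_indicator[symmetric], simp, subst nn_integral_distr) auto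
qed simp

end

lemma fwd_dens_pos_dens:
  assumes "pos_dens d p" "t \<ge> 0" shows "pos_dens d (fwd_dens d p t)"
  using assms pos_dens.pos_dens_blur[OF assms(1)] by (cases "t = 0") (auto simp: fwd_dens_blur)

text \<open>\<open>fwd_dens\<close> blurs the data directly from time 0, whereas the reverse chain
  needs the transition from t to t + h. Both agree because the contractions multiply and the
  variances combine as v + a^2 w.\<close>

lemma fwd_dens_step:
  assumes "pos_dens d p" and t: "t \<ge> 0" and h: "h > 0" and x: "x \<in> Rd d"
  shows "fwd_dens d p (t + h) x = blur d (exp (- h / 2)) (1 - exp (- h)) (fwd_dens d p t) x"
proof (cases "t = 0")
  case True then show ?thesis using h by (simp add: fwd_dens_blur)
next
  case False
  interpret pos_dens d p by fact
  let ?a = "exp (- h / 2)" and ?v = "1 - exp (- h)" and ?b = "exp (- t / 2)" and ?w = "1 - exp (- t)"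
  have v: "?v > 0" and w: "?w > 0" and u: "1 - exp (- (t + h)) > 0" using False t h by auto
  interpret q: pos_dens d "fwd_dens d p t" using assms t by (intro fwd_dens_pos_dens)
  have e: "?v + ?a\<^sup>2 * ?w = 1 - exp (- (t + h))" "\<And>c. ?a * (?b * c) = exp (- (t + h) / 2) * c"
    by (simp_all add: power2_eq_square algebra_simps exp_add[symmetric] mult.assoc[symmetric] add_divide_distrib)
  have "ennreal (blur d ?a ?v (fwd_dens d p t) x) = (\<integral>\<^sup>+y. ennreal (fwd_dens d p t y * gauss_dens d (\<lambda>i. ?a * y i) ?v x) \<partial>lebd d)"
    by (rule q.nn_integral_blur[OF v])
  also have "\<dots> = (\<integral>\<^sup>+y. ennreal (blur d ?b ?w p y) * ennreal (gauss_dens d (\<lambda>i. ?a * y i) ?v x) \<partial>lebd d)"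
    using False by (intro nn_integral_cong) (auto simp: fwd_dens_blur ennreal_mult intro!: ennreal_mult less_imp_le[OF blur_pos] w)
  also have "\<dots> = (\<integral>\<^sup>+y. \<integral>\<^sup>+y0. ennreal (p y0 * gauss_dens d (\<lambda>i. ?b * y0 i) ?w y) * ennreal (gauss_dens d (\<lambda>i. ?a * y i) ?v x) \<partial>lebd d \<partial>lebd d)"
    unfolding nn_integral_blur[OF w] by (intro nn_integral_cong nn_integral_multc[symmetric]) measurable
  also have "\<dots> = (\<integral>\<^sup>+y0. \<integral>\<^sup>+y. ennreal (p y0 * gauss_dens d (\<lambda>i. ?b * y0 i) ?w y) * ennreal (gauss_dens d (\<lambda>i. ?a * y i) ?v x) \<partial>lebd d \<partial>lebd d)"
    by (rule lebd2.Fubini'[symmetric]) (unfold split_beta', measurable)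
  also have "\<dots> = (\<integral>\<^sup>+y0. ennreal (p y0) * \<integral>\<^sup>+y. ennreal (gauss_dens d (\<lambda>i. ?b * y0 i) ?w y * gauss_dens d (\<lambda>i. ?a * y i) ?v x) \<partial>lebd d \<partial>lebd d)"
    by (intro nn_integral_cong, subst nn_integral_cmult[symmetric])
       (auto intro!: nn_integral_cong simp: ennreal_mult less_imp_le[OF pos] mult.assoc)
  also have "\<dots> = (\<integral>\<^sup>+y0. ennreal (p y0 * gauss_dens d (\<lambda>i. exp (- (t + h) / 2) * y0 i) (1 - exp (- (t + h))) x) \<partial>lebd d)"
    unfolding gauss_dens_compose[OF exp_gt_zero v w] e
    by (intro nn_integral_cong) (auto simp: ennreal_mult less_imp_le[OF pos])
  also have "\<dots> = ennreal (fwd_dens d p (t + h) x)"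
    using t h by (subst nn_integral_blur[OF u, symmetric]) (simp add: fwd_dens_blur)
  finally show ?thesis
    using q.blur_pos[OF v x] pos_dens.pos[OF fwd_dens_pos_dens[OF assms(1)] x, of "t + h"] t h
    by (subst (asm) ennreal_inj) (auto intro: less_imp_le)
qed

subsection \<open>Lipschitz scores\<close>

lemma abs_component_le_vdist: "i < d \<Longrightarrow> \<bar>x i - y i\<bar> \<le> vdist d x y"
  unfolding vdist_def
  by (rule real_le_rsqrt) (auto intro!: member_le_sum[where f="\<lambda>i. (x i - y i)^2"])

lemma lipschitz_vec_component:
  assumes "lipschitz_vec d L F" "x \<in> Rd d" "y \<in> Rd d" "i < d"
  shows "\<bar>F x i - F y i\<bar> \<le> L * vdist d x y"
  using assms abs_component_le_vdist[of i d "F x" "F y"] unfolding lipschitz_vec_def by force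

text \<open>The field is only controlled on \<open>Rd d\<close>, which is not a whole topological
  space here. Precomposing with restriction gives a function on the full product space that is
  continuous because it sees only finitely many coordinates; extension by zero then carries Borel
  measurability back to \<open>lebd d\<close>.\<close>

lemma lipschitz_vec_measurable:
  assumes F: "lipschitz_vec d L F" and i: "i < d"
  shows "(\<lambda>x. F x i) \<in> borel_measurable (lebd d)"
proof -
  define G where "G z = F (restrict z {..<d}) i" for z
  have "isCont G z" for z
  proof -
    have "((\<lambda>z'. L * sqrt (\<Sum>i<d. (z' i - z i)^2)) \<longlongrightarrow> L * sqrt (\<Sum>i<d. (z i - z i)^2)) (at z)"
    proof (intro tendsto_intros)
      fix j
      have "isCont (\<lambda>x::nat \<Rightarrow> real. x j) z"
        using continuous_on_product_coordinates[where i=j and 'b=real and 'a=nat]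
          continuous_on_eq_continuous_at[OF open_UNIV] by blast
      then show "((\<lambda>x. x j) \<longlongrightarrow> z j) (at z)" by (simp add: isCont_def)
    qed
    then have lim: "((\<lambda>z'. L * sqrt (\<Sum>i<d. (z' i - z i)^2)) \<longlongrightarrow> 0) (at z)" by simp
    have "norm (G z' - G z) \<le> L * sqrt (\<Sum>i<d. (z' i - z i)^2)" for z'
      using lipschitz_vec_component[OF F _ _ i, of "restrict z' {..<d}" "restrict z {..<d}"]
      by (simp add: G_def vdist_def)
    then have "((\<lambda>z'. G z' - G z) \<longlongrightarrow> 0) (at z)"
      by (intro Lim_null_comparison[OF _ lim] always_eventually) simp
    then show ?thesis by (simp add: isCont_def LIM_zero_iff)
  qed
  then have "continuous_on UNIV G" by (simp add: continuous_at_imp_continuous_on)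
  then have [measurable]: "G \<in> borel_measurable borel" by (rule borel_measurable_continuous_onI)
  let ?e = "\<lambda>(x::nat\<Rightarrow>real) i. if i < d then x i else 0"
  have [measurable]: "?e \<in> borel_measurable (lebd d)"
  proof (rule measurable_coordinatewise_then_product)
    fix i show "(\<lambda>x. ?e x i) \<in> borel_measurable (lebd d)" by (cases "i < d") auto
  qed
  have "(\<lambda>x. G (?e x)) \<in> borel_measurable (lebd d)" by measurable
  moreover have "G (?e x) = F x i" if "x \<in> space (lebd d)" for x
  proof -
    have "restrict (?e x) {..<d} = x" using that by (auto simp: Rd_def PiE_iff extensional_def fun_eq_iff)
    then show ?thesis by (simp add: G_def)
  qed
  ultimately show ?thesis by (subst measurable_cong[where g="\<lambda>x. G (?e x)"]) auto
qed

text \<open>\<open>has_grad\<close> provides partial derivatives only, so the increment is split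
  into d axis-parallel legs and the mean value theorem is applied to each. Every point of the path
  stays within sqrt W of x, where W is the squared length of w, hence each leg costs at most L W.
  The resulting factor d enters only the discretisation error, which vanishes with h.\<close>

lemma score_taylor:
  assumes g: "has_grad d u f" and F: "lipschitz_vec d L f" and L: "L \<ge> 0" and x: "x \<in> Rd d"
  shows "\<bar>u (\<lambda>i\<in>{..<d}. x i + w i) - u x - (\<Sum>i<d. f x i * w i)\<bar> \<le> d * L * (\<Sum>i<d. (w i)^2)"
proof -
  define xi where "xi k = (\<lambda>i\<in>{..<d}. x i + (if i < k then w i else 0))" for k :: nat
  define W where "W = (\<Sum>i<d. (w i)^2)"
  have W0: "W \<ge> 0" by (simp add: W_def sum_nonneg)
  have step: "\<bar>u (xi (Suc k)) - u (xi k) - f x k * w k\<bar> \<le> L * W" if k: "k < d" for k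
  proof -
    define y where "y \<tau> = (xi k)(k := x k + \<tau>)" for \<tau>
    have y_Rd: "y \<tau> \<in> Rd d" for \<tau> using k by (auto simp: y_def xi_def Rd_def PiE_iff extensional_def)
    have y0: "y 0 = xi k" using k by (auto simp: y_def xi_def)
    have y1: "y (w k) = xi (Suc k)" using k by (auto simp: y_def xi_def fun_eq_iff)
    have wk: "\<bar>w k\<bar> \<le> sqrt W"
      using k unfolding W_def by (intro real_le_rsqrt) (auto intro!: member_le_sum[where f="\<lambda>i. (w i)^2"])
    have der: "((\<lambda>\<tau>. u (y \<tau>)) has_field_derivative f (y \<tau>) k) (at \<tau>)" for \<tau>
    proof -
      have "((\<lambda>t. u ((y \<tau>)(k := y \<tau> k + t))) has_real_derivative f (y \<tau>) k) (at 0)"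
        using g y_Rd k unfolding has_grad_def by blast
      moreover have "(y \<tau>)(k := y \<tau> k + t) = y (\<tau> + t)" for t by (auto simp: y_def)
      ultimately have "((\<lambda>t. u (y (\<tau> + t))) has_real_derivative f (y \<tau>) k) (at 0)" by simp
      then show ?thesis using DERIV_at_within_shift[of "\<lambda>\<tau>. u (y \<tau>)" "f (y \<tau>) k" \<tau> 0 UNIV] by simp
    qed
    have "norm ((u (y (w k)) - f x k * w k) - (u (y 0) - f x k * 0)) \<le> (L * sqrt W) * norm (w k - 0)"
    proof (rule field_differentiable_bound[where S="closed_segment 0 (w k)" and f="\<lambda>\<tau>. u (y \<tau>) - f x k * \<tau>"])
      fix \<tau> assume tau: "\<tau> \<in> closed_segment 0 (w k)"
      show "((\<lambda>\<tau>. u (y \<tau>) - f x k * \<tau>) has_field_derivative (f (y \<tau>) k - f x k)) (at \<tau> within closed_segment 0 (w k))"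
        by (rule has_field_derivative_at_within) (auto intro!: derivative_eq_intros der)
      have "\<bar>\<tau>\<bar> \<le> \<bar>w k\<bar>" using tau by (auto simp: closed_segment_eq_real_ivl split: if_splits)
      then have "vdist d (y \<tau>) x \<le> sqrt W"
        unfolding vdist_def W_def
        by (intro real_sqrt_le_mono sum_mono) (auto simp: y_def xi_def abs_le_square_iff)
      then have "L * vdist d (y \<tau>) x \<le> L * sqrt W" using L by (rule mult_left_mono)
      then show "norm (f (y \<tau>) k - f x k) \<le> L * sqrt W"
        using lipschitz_vec_component[OF F y_Rd x k, of \<tau>] by simp
    qed auto
    also have "\<dots> \<le> L * sqrt W * sqrt W" using wk L W0 by (intro mult_left_mono) auto
    also have "\<dots> = L * W" using W0 by simp
    finally show ?thesis by (simp add: y0 y1)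
  qed
  have "u (xi d) - u (xi 0) - (\<Sum>i<d. f x i * w i) = (\<Sum>k<d. u (xi (Suc k)) - u (xi k) - f x k * w k)"
    using sum_lessThan_telescope[of "\<lambda>k. u (xi k)" d] by (simp add: sum_subtractf)
  also have "\<bar>\<dots>\<bar> \<le> (\<Sum>k<d. L * W)"
    by (intro order_trans[OF sum_abs] sum_mono step) simp
  finally have "\<bar>u (xi d) - u (xi 0) - (\<Sum>i<d. f x i * w i)\<bar> \<le> d * L * W" by simp
  moreover have "xi 0 = x" using x by (auto simp: xi_def Rd_restrict)
  moreover have "xi d = (\<lambda>i\<in>{..<d}. x i + w i)" by (auto simp: xi_def)
  ultimately show ?thesis by (simp add: W_def)
qed

text \<open>The logarithmic mean is at most the arithmetic mean: a discrete counterpart of grad p .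
  grad ln p = p |grad ln p|^2. Dividing by p leaves the single variable t = ln q - ln p, where a
  monotonicity argument rests on 1 - t <= exp (- t).\<close>

lemma log_mean_le_arith_mean:
  fixes p q :: real
  assumes p: "p > 0" and q: "q > 0"
  shows "(q - p) * (ln q - ln p) \<le> (p + q) / 2 * (ln q - ln p)^2"
proof -
  have *: "exp t - 1 \<le> (1 + exp t) / 2 * t" if "t \<ge> 0" for t :: real
  proof -
    have "((\<lambda>t. (1 + exp t) / 2 * t - exp t) has_real_derivative (1 + (t - 1) * exp t) / 2) (at t)" for t :: real
      by (auto intro!: derivative_eq_intros simp: field_simps)
    moreover have "(1 + (t - 1) * exp t) / 2 \<ge> 0" for t :: real
    proof -
      have "(1 - t) * exp t \<le> exp (- t) * exp t"
        using exp_ge_add_one_self[of "- t"] by (intro mult_right_mono) auto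
      then show ?thesis by (simp add: exp_add[symmetric] algebra_simps)
    qed
    ultimately have "(1 + exp 0) / 2 * 0 - exp 0 \<le> (1 + exp t) / 2 * t - exp t"
      using that by (intro DERIV_nonneg_imp_nondecreasing[where f="\<lambda>t. (1 + exp t) / 2 * t - exp t"]) blast+
    then show ?thesis by simp
  qed
  have main: "(q - p) * (ln q - ln p) \<le> (p + q) / 2 * (ln q - ln p)^2" if "p \<le> q" "p > 0" for p q :: real
  proof -
    define t where "t = ln q - ln p"
    have t: "t \<ge> 0" using that by (simp add: t_def)
    have qe: "q = p * exp t" using that by (simp add: t_def exp_diff)
    have "(q - p) * t = p * ((exp t - 1) * t)" by (simp add: qe algebra_simps)
    also have "\<dots> \<le> p * ((1 + exp t) / 2 * t * t)"
      using that t *[OF t] by (intro mult_left_mono mult_right_mono) auto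
    also have "\<dots> = (p + q) / 2 * t^2" by (simp add: qe power2_eq_square field_simps)
    finally show ?thesis by (simp add: t_def)
  qed
  show ?thesis
  proof (cases "p \<le> q")
    case True then show ?thesis using main p by blast
  next
    case False
    then have "(p - q) * (ln p - ln q) \<le> (q + p) / 2 * (ln p - ln q)^2" using main[of q p] q by simp
    then show ?thesis by (simp add: algebra_simps power2_eq_square)
  qed
qed

section \<open>Integrals of products over a product of probability spaces\<close>

lemma (in pair_prob_space) integrable_prod_fst_snd:
  fixes f :: "'a \<Rightarrow> real" and g :: "'b \<Rightarrow> real"
  assumes f [measurable]: "integrable M1 f" and g [measurable]: "integrable M2 g"
  shows "integrable (M1 \<Otimes>\<^sub>M M2) (\<lambda>w. f (fst w) * g (snd w))"
    and "(\<integral>w. f (fst w) * g (snd w) \<partial>(M1 \<Otimes>\<^sub>M M2)) = (\<integral>x. f x \<partial>M1) * (\<integral>y. g y \<partial>M2)"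
proof -
  show *: "integrable (M1 \<Otimes>\<^sub>M M2) (\<lambda>w. f (fst w) * g (snd w))"
    using f g by (intro Fubini_integrable) (auto simp: abs_mult)
  show "(\<integral>w. f (fst w) * g (snd w) \<partial>(M1 \<Otimes>\<^sub>M M2)) = (\<integral>x. f x \<partial>M1) * (\<integral>y. g y \<partial>M2)"
    by (subst integral_fst'[OF *, symmetric]) simp
qed

lemma (in pair_prob_space) integrable_fst_only:
  fixes f :: "'a \<Rightarrow> real"
  assumes "integrable M1 f"
  shows "integrable (M1 \<Otimes>\<^sub>M M2) (\<lambda>w. f (fst w))"
    and "(\<integral>w. f (fst w) \<partial>(M1 \<Otimes>\<^sub>M M2)) = (\<integral>x. f x \<partial>M1)"
  using integrable_prod_fst_snd[OF assms, of "\<lambda>_. 1"] by (simp_all add: M2.prob_space)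

lemma (in pair_prob_space) integrable_snd_only:
  fixes f :: "'b \<Rightarrow> real"
  assumes "integrable M2 f"
  shows "integrable (M1 \<Otimes>\<^sub>M M2) (\<lambda>w. f (snd w))"
    and "(\<integral>w. f (snd w) \<partial>(M1 \<Otimes>\<^sub>M M2)) = (\<integral>x. f x \<partial>M2)"
  using integrable_prod_fst_snd[OF _ assms, of "\<lambda>_. 1"] by (simp_all add: M1.prob_space)

subsection \<open>Entropy growth along a Gaussian perturbation\<close>

lemma integrable_std_gauss_norm_sq: "integrable (std_gauss d) (\<lambda>z. \<Sum>i<d. (z i)^2)"
  by (intro Bochner_Integration.integrable_sum integrable_std_gauss_power) simp

locale score_dens = pos_dens +
  fixes f :: "(nat \<Rightarrow> real) \<Rightarrow> nat \<Rightarrow> real" and L :: real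
  assumes grad: "has_grad d (\<lambda>x. ln (p x)) f"
    and lip: "lipschitz_vec d L f"
    and L_nonneg: "L \<ge> 0"
    and second_moment: "\<And>i. i < d \<Longrightarrow> integrable P (\<lambda>x. (x i)^2)"
begin

lemma score_measurable [measurable]: "i < d \<Longrightarrow> (\<lambda>x. f x i) \<in> borel_measurable (lebd d)"
  by (rule lipschitz_vec_measurable[OF lip])

definition u :: "(nat \<Rightarrow> real) \<Rightarrow> real" where "u x = ln (p x)"

lemma u_measurable [measurable]: "u \<in> borel_measurable (lebd d)"
  unfolding u_def[abs_def] by measurable

definition fisher :: real where "fisher = (\<integral>x. (\<Sum>i<d. (f x i)^2) \<partial>P)"

definition zero :: "nat \<Rightarrow> real" where "zero = (\<lambda>i\<in>{..<d}. 0)"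

lemma zero_Rd [simp]: "zero \<in> Rd d"
  by (simp add: zero_def)

lemma integrable_norm_sq: "integrable P (\<lambda>x. \<Sum>i<d. (x i)^2)"
  by (intro Bochner_Integration.integrable_sum second_moment) simp

lemma score_sq_le:
  assumes "x \<in> Rd d" "i < d"
  shows "(f x i)^2 \<le> 2 * (f zero i)^2 + 2 * L^2 * (\<Sum>i<d. (x i)^2)"
proof -
  have "\<bar>f x i - f zero i\<bar> \<le> L * vdist d x zero"
    using lipschitz_vec_component[OF lip _ zero_Rd] assms by blast
  then have "(f x i - f zero i)^2 \<le> (L * vdist d x zero)^2"
    using L_nonneg by (subst abs_le_square_iff[symmetric]) auto
  also have "\<dots> = L^2 * (\<Sum>i<d. (x i)^2)"
    by (simp add: power_mult_distrib vdist_sq zero_def)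
  finally have "(f x i - f zero i)^2 \<le> L^2 * (\<Sum>i<d. (x i)^2)" .
  moreover have "(f x i)^2 \<le> 2 * (f zero i)^2 + 2 * (f x i - f zero i)^2"
    using zero_le_power2[of "f x i - 2 * f zero i"] by (simp add: power2_eq_square algebra_simps)
  ultimately show ?thesis by linarith
qed

lemma integrable_score_sq: "i < d \<Longrightarrow> integrable P (\<lambda>x. (f x i)^2)"
proof (rule Bochner_Integration.integrable_bound)
  show "integrable P (\<lambda>x. 2 * (f zero i)^2 + 2 * L^2 * (\<Sum>i<d. (x i)^2))"
    using integrable_norm_sq by (intro Bochner_Integration.integrable_add integrable_mult_right) auto
  assume "i < d"
  then show "AE x in P. norm ((f x i)^2) \<le> norm (2 * (f zero i)^2 + 2 * L^2 * (\<Sum>i<d. (x i)^2))"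
    using score_sq_le by (auto intro!: AE_I2 order_trans[OF _ abs_ge_self])
qed measurable

lemma integrable_score_norm_sq: "integrable P (\<lambda>x. \<Sum>i<d. (f x i)^2)"
  by (intro Bochner_Integration.integrable_sum integrable_score_sq) simp

lemma integrable_score_mult: "i < d \<Longrightarrow> j < d \<Longrightarrow> integrable P (\<lambda>x. f x i * f x j)"
  by (intro integrable_mult_of_squares integrable_score_sq) measurable

lemma taylor:
  "x \<in> Rd d \<Longrightarrow> \<bar>u (\<lambda>i\<in>{..<d}. x i + w i) - u x - (\<Sum>i<d. f x i * w i)\<bar> \<le> d * L * (\<Sum>i<d. (w i)^2)"
  unfolding u_def by (rule score_taylor[OF grad lip L_nonneg])

lemma u_diff_le:
  assumes "x \<in> Rd d"
  shows "\<bar>u (\<lambda>i\<in>{..<d}. x i + w i) - u x\<bar> \<le> (\<Sum>i<d. (f x i)^2) + (d * L + 1) * (\<Sum>i<d. (w i)^2)"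
proof -
  have "\<bar>f x i * w i\<bar> \<le> (f x i)^2 + (w i)^2" for i
    using sum_squares_bound[of "\<bar>f x i\<bar>" "\<bar>w i\<bar>"] mult_nonneg_nonneg[of "\<bar>f x i\<bar>" "\<bar>w i\<bar>"]
    by (simp add: abs_mult del: mult_nonneg_nonneg)
  then have "\<bar>\<Sum>i<d. f x i * w i\<bar> \<le> (\<Sum>i<d. (f x i)^2) + (\<Sum>i<d. (w i)^2)"
    unfolding sum.distrib[symmetric] by (intro order_trans[OF sum_abs] sum_mono)
  with taylor[OF assms, of w] show ?thesis by (simp add: algebra_simps)
qed

text \<open>A Lipschitz gradient gives ln p at most quadratic growth, so finite second moments make
  the entropy finite.\<close>

lemma integrable_u: "integrable P u"
proof (rule Bochner_Integration.integrable_bound)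
  let ?b = "\<lambda>x. \<bar>u zero\<bar> + (\<Sum>i<d. (f zero i)^2) + (d * L + 1) * (\<Sum>i<d. (x i)^2)"
  show "integrable P ?b"
    using integrable_norm_sq by (intro Bochner_Integration.integrable_add integrable_mult_right) auto
  show "AE x in P. norm (u x) \<le> norm (?b x)"
  proof (rule AE_I2)
    fix x assume "x \<in> space P"
    then have "(\<lambda>i\<in>{..<d}. zero i + x i) = x" by (auto simp: zero_def Rd_def PiE_iff extensional_def fun_eq_iff)
    then show "norm (u x) \<le> norm (?b x)"
      using u_diff_le[OF zero_Rd, of x] by (simp add: abs_le_iff) linarith
  qed
qed measurable

lemma integrable_u_shift:
   "integrable PZ (\<lambda>w. u (\<lambda>i\<in>{..<d}. fst w i + c * snd w i) - u (fst w))"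
proof (rule Bochner_Integration.integrable_bound)
  let ?b = "\<lambda>w. (\<Sum>i<d. (f (fst w) i)^2) + (d * L + 1) * c^2 * (\<Sum>i<d. (snd w i)^2)"
  show "integrable PZ ?b"
    using PN.integrable_snd_only(1)[OF integrable_std_gauss_norm_sq] integrable_score_norm_sq
    by (intro Bochner_Integration.integrable_add integrable_mult_right PN.integrable_fst_only(1))
  have [measurable]: "(\<lambda>w. u (\<lambda>i\<in>{..<d}. fst w i + c * snd w i)) \<in> borel_measurable PZ"
    by measurable
  show "(\<lambda>w. u (\<lambda>i\<in>{..<d}. fst w i + c * snd w i) - u (fst w)) \<in> borel_measurable PZ"
    by measurable
  show "AE w in PZ. norm (u (\<lambda>i\<in>{..<d}. fst w i + c * snd w i) - u (fst w)) \<le> norm (?b w)"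
  proof (rule AE_I2)
    fix w assume "w \<in> space PZ"
    then have "fst w \<in> Rd d" by (auto simp: space_pair_measure)
    from u_diff_le[OF this, of "\<lambda>i. c * snd w i"]
    show "norm (u (\<lambda>i\<in>{..<d}. fst w i + c * snd w i) - u (fst w)) \<le> norm (?b w)"
      by (simp add: power_mult_distrib sum_distrib_left[symmetric] mult.assoc)
  qed
qed

text \<open>Square of the Taylor bound for an increment of ln p along w. It is even in w, so the
  same function controls the step from x to x + w and the step back.\<close>

definition rem :: "(nat \<Rightarrow> real) \<Rightarrow> (nat \<Rightarrow> real) \<Rightarrow> real" where
  "rem w x = (\<bar>\<Sum>i<d. f x i * w i\<bar> + d * L * (\<Sum>i<d. (w i)^2))^2"

lemma rem_nonneg: "rem w x \<ge> 0"
  by (simp add: rem_def)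

lemma u_diff_sq_le:
  assumes "x \<in> Rd d"
  shows "(u (\<lambda>i\<in>{..<d}. x i + w i) - u x)^2 \<le> rem w x"
proof -
  have "d * L * (\<Sum>i<d. (w i)^2) \<ge> 0" using L_nonneg by (simp add: sum_nonneg)
  then show ?thesis
    unfolding rem_def using taylor[OF assms, of w]
    by (subst abs_le_square_iff[symmetric]) linarith
qed

lemma integrable_rem: "integrable P (rem w)"
proof (rule Bochner_Integration.integrable_bound)
  let ?b = "\<lambda>x. 2 * (\<Sum>i<d. \<Sum>j<d. (f x i * f x j) * (w i * w j)) + 2 * (d * L * (\<Sum>i<d. (w i)^2))^2"
  show "integrable P ?b"
    using integrable_score_mult
    by (intro Bochner_Integration.integrable_add integrable_mult_right Bochner_Integration.integrable_sum integrable_mult_left) auto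
  have 1: "(\<Sum>i<d. f x i * w i)^2 = (\<Sum>i<d. \<Sum>j<d. (f x i * f x j) * (w i * w j))" for x
    by (simp add: power2_eq_square sum_product mult_ac)
  have 2: "(\<bar>a\<bar> + b)^2 \<le> 2 * a^2 + 2 * b^2" for a b :: real
    using zero_le_power2[of "\<bar>a\<bar> - b"] by (simp add: power2_eq_square algebra_simps)
  have "rem w x \<le> ?b x" for x
    unfolding rem_def 1[symmetric] by (rule 2)
  then show "AE x in P. norm (rem w x) \<le> norm (?b x)"
    by (auto simp: rem_nonneg intro!: AE_I2 order_trans[OF _ abs_ge_self])
  show "rem w \<in> borel_measurable P" unfolding rem_def by measurable
qed

lemma integrable_u_translate: "integrable P (\<lambda>x. u (\<lambda>i\<in>{..<d}. x i + w i))"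
proof -
  have "integrable P (\<lambda>x. u (\<lambda>i\<in>{..<d}. x i + w i) - u x)"
  proof (rule Bochner_Integration.integrable_bound)
    let ?b = "\<lambda>x. (\<Sum>i<d. (f x i)^2) + (d * L + 1) * (\<Sum>i<d. (w i)^2)"
    show "integrable P ?b" using integrable_score_norm_sq by simp
    show "AE x in P. norm (u (\<lambda>i\<in>{..<d}. x i + w i) - u x) \<le> norm (?b x)"
      using u_diff_le by (auto intro!: AE_I2 order_trans[OF _ abs_ge_self])
  qed measurable
  from Bochner_Integration.integrable_add[OF this integrable_u] show ?thesis by simp
qed

text \<open>Discrete summation by parts replaces the second derivative of \<open>ln p\<close>: translating one of the
  two integrals turns the second difference of \<open>ln p\<close> into a product of first differences.\<close>

lemma second_difference_le:
  "(\<integral>x. u x - u (\<lambda>i\<in>{..<d}. x i + w i) \<partial>P) + (\<integral>x. u x - u (\<lambda>i\<in>{..<d}. x i + - w i) \<partial>P) \<le> (\<integral>x. rem w x \<partial>P)"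
proof -
  let ?s = "\<lambda>x. \<lambda>i\<in>{..<d}. x i + w i" and ?t = "\<lambda>x. \<lambda>i\<in>{..<d}. x i + - w i"
  have ts: "?t (?s x) = x" if "x \<in> Rd d" for x
    using that by (auto simp: Rd_def PiE_iff extensional_def fun_eq_iff)
  define A where "A x = p x * (u x - u (?s x))" for x
  define B where "B x = p x * (u x - u (?t x))" for x
  define R where "R x = p x * rem w x" for x
  have [measurable]: "rem w \<in> borel_measurable (lebd d)" unfolding rem_def by measurable
  have s: "?s \<in> lebd d \<rightarrow>\<^sub>M lebd d" and t: "?t \<in> lebd d \<rightarrow>\<^sub>M lebd d" by measurable
  have [measurable]: "(\<lambda>x. u (?s x)) \<in> borel_measurable (lebd d)" "(\<lambda>x. u (?t x)) \<in> borel_measurable (lebd d)"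
    using measurable_compose[OF s u_measurable] measurable_compose[OF t u_measurable] by auto
  have [measurable]: "A \<in> borel_measurable (lebd d)" "B \<in> borel_measurable (lebd d)" "R \<in> borel_measurable (lebd d)"
    unfolding A_def[abs_def] B_def[abs_def] R_def[abs_def] by measurable
  have iA: "integrable (lebd d) A" and iB: "integrable (lebd d) B" and iR: "integrable (lebd d) R"
    using integrable_P[of "\<lambda>x. u x - u (?s x)"] integrable_P[of "\<lambda>x. u x - u (?t x)"] integrable_P[of "rem w"]
      integrable_u integrable_u_translate[of w] integrable_u_translate[of "\<lambda>i. - w i"] integrable_rem[of w]
    unfolding A_def[abs_def] B_def[abs_def] R_def[abs_def] by auto
  have iB': "integrable (lebd d) (\<lambda>x. B (?s x))" and iR': "integrable (lebd d) (\<lambda>x. R (?s x))"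
    using iB iR by (simp_all add: integral_lebd_shift)
  have "(\<integral>x. u x - u (?s x) \<partial>P) + (\<integral>x. u x - u (?t x) \<partial>P) = (\<integral>x. A x \<partial>lebd d) + (\<integral>x. B x \<partial>lebd d)"
    unfolding A_def B_def by (subst (1 2) integral_P) auto
  also have "\<dots> = (\<integral>x. A x \<partial>lebd d) + (\<integral>x. B (?s x) \<partial>lebd d)"
    by (simp add: integral_lebd_shift)
  also have "\<dots> = (\<integral>x. A x + B (?s x) \<partial>lebd d)"
    using iA iB' by simp
  \<comment> \<open>Each endpoint of the displacement gets its own majorant with weight one half; by
    translation invariance the two halves have the same integral.\<close>
  also have "\<dots> \<le> (\<integral>x. (R x + R (?s x)) / 2 \<partial>lebd d)"
  proof (rule integral_mono)
    show "integrable (lebd d) (\<lambda>x. A x + B (?s x))" using iA iB' by simp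
    show "integrable (lebd d) (\<lambda>x. (R x + R (?s x)) / 2)" using iR iR' by simp
    fix x assume "x \<in> space (lebd d)"
    then have x: "x \<in> Rd d" by simp
    have p0: "p x > 0" "p (?s x) > 0" using pos x by auto
    have 1: "(u (?s x) - u x)^2 \<le> rem w x" by (rule u_diff_sq_le[OF x])
    have "(u (?t (?s x)) - u (?s x))^2 \<le> rem (\<lambda>i. - w i) (?s x)"
      by (rule u_diff_sq_le[OF restrict_in_Rd])
    then have 2: "(u (?s x) - u x)^2 \<le> rem w (?s x)"
      unfolding ts[OF x] by (simp add: rem_def sum_negf power2_commute[of "u x"])
    have "A x + B (?s x) = (p (?s x) - p x) * (u (?s x) - u x)"
      unfolding A_def B_def ts[OF x] by (simp add: algebra_simps)
    also have "\<dots> \<le> (p x + p (?s x)) / 2 * (u (?s x) - u x)^2"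
      unfolding u_def using p0 by (rule log_mean_le_arith_mean)
    also have "\<dots> = (p x * (u (?s x) - u x)^2 + p (?s x) * (u (?s x) - u x)^2) / 2"
      by (simp add: algebra_simps)
    also have "\<dots> \<le> (p x * rem w x + p (?s x) * rem w (?s x)) / 2"
      using p0 1 2 by (intro divide_right_mono add_mono mult_left_mono) auto
    finally show "A x + B (?s x) \<le> (R x + R (?s x)) / 2" by (simp add: R_def)
  qed
  also have "\<dots> = ((\<integral>x. R x \<partial>lebd d) + (\<integral>x. R (?s x) \<partial>lebd d)) / 2"
    using iR iR' by simp
  also have "\<dots> = (\<integral>x. R x \<partial>lebd d)"
    by (simp add: integral_lebd_shift)
  also have "\<dots> = (\<integral>x. rem w x \<partial>P)"
    unfolding R_def by (subst integral_P) auto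
  finally show ?thesis .
qed


text \<open>Independence of variable and noise together with the identity covariance removes the
  off-diagonal products. This is where the Fisher information enters, with exact constant
  one.\<close>

lemma integral_score_dot_sq:
  shows "integrable PZ (\<lambda>w. (\<Sum>i<d. f (fst w) i * snd w i)^2)"
    and "(\<integral>w. (\<Sum>i<d. f (fst w) i * snd w i)^2 \<partial>PZ) = fisher"
proof -
  have eq: "(\<Sum>i<d. f y i * z i)^2 = (\<Sum>i<d. \<Sum>j<d. (f y i * f y j) * (z i * z j))" for y z
    by (simp add: power2_eq_square sum_product mult_ac)
  have int: "integrable PZ (\<lambda>w. (f (fst w) i * f (fst w) j) * (snd w i * snd w j))"
    if "i < d" "j < d" for i j
    using that by (intro PN.integrable_prod_fst_snd(1) integrable_score_mult integrable_std_gauss_mult)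
  show "integrable PZ (\<lambda>w. (\<Sum>i<d. f (fst w) i * snd w i)^2)"
    unfolding eq by (intro Bochner_Integration.integrable_sum int) auto
  have val: "(\<integral>w. (f (fst w) i * f (fst w) j) * (snd w i * snd w j) \<partial>PZ)
      = (if j = i then (\<integral>y. (f y i)^2 \<partial>P) else 0)" if "i < d" "j < d" for i j
    using PN.integrable_prod_fst_snd(2)[OF integrable_score_mult[OF that] integrable_std_gauss_mult[OF that]]
      std_gauss_cov[of i d j] std_gauss_second[of i d] that
    by (auto simp: power2_eq_square)
  have "(\<integral>w. (\<Sum>i<d. f (fst w) i * snd w i)^2 \<partial>PZ)
     = (\<Sum>i<d. \<Sum>j<d. (\<integral>w. (f (fst w) i * f (fst w) j) * (snd w i * snd w j) \<partial>PZ))"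
    unfolding eq using int
    by (subst Bochner_Integration.integral_sum)
       (auto intro!: sum.cong Bochner_Integration.integral_sum Bochner_Integration.integrable_sum)
  also have "\<dots> = (\<Sum>i<d. \<Sum>j<d. (if j = i then (\<integral>y. (f y i)^2 \<partial>P) else 0))"
    by (intro sum.cong refl val) auto
  also have "\<dots> = (\<Sum>i<d. (\<integral>y. (f y i)^2 \<partial>P))"
    by (simp add: sum.delta)
  also have "\<dots> = fisher"
    unfolding fisher_def by (intro Bochner_Integration.integral_sum[symmetric] integrable_score_sq) simp
  finally show "(\<integral>w. (\<Sum>i<d. f (fst w) i * snd w i)^2 \<partial>PZ) = fisher" .
qed

text \<open>By symmetry of the noise, twice the left-hand side is the average over z of a second
  difference of ln p, which \<open>second_difference_le\<close> bounds by the square of a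
  first-order term plus a Taylor term. Young's inequality with weight e separates them: the first
  yields the Fisher information with coefficient c^2 / 2 up to the factor 1 + e, the second is of
  order c^4.\<close>

lemma entropy_step:
  assumes e: "e > 0"
  shows "(\<integral>w. u (fst w) - u (\<lambda>i\<in>{..<d}. fst w i + c * snd w i) \<partial>PZ)
    \<le> ((1 + e) * c^2 * fisher + (1 + 1/e) * (d * L)^2 * c^4 * (\<integral>z. (\<Sum>i<d. (z i)^2)^2 \<partial>std_gauss d)) / 2"
proof -
  define g where "g y z = u y - u (\<lambda>i\<in>{..<d}. y i + c * z i)" for y z
  define b where "b y z = (1 + e) * c^2 * (\<Sum>i<d. f y i * z i)^2 + (1 + 1/e) * (d * L)^2 * c^4 * (\<Sum>i<d. (z i)^2)^2" for y z
  let ?N = "std_gauss d" and ?n = "\<lambda>z. \<lambda>i\<in>{..<d}. - z i :: real"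
  have ig: "integrable (P \<Otimes>\<^sub>M ?N) (case_prod g)"
    using integrable_minus[OF integrable_u_shift[of c]] by (simp add: g_def split_beta')
  have ib: "integrable (P \<Otimes>\<^sub>M ?N) (case_prod b)"
    unfolding b_def split_beta'
    by (intro Bochner_Integration.integrable_add integrable_mult_right integral_score_dot_sq(1)
        PN.integrable_snd_only(1)[OF integrable_std_gauss_norm4])
  \<comment> \<open>Freezing the noise z makes the perturbation a translation by a fixed vector, the
    setting of \<open>second_difference_le\<close>.\<close>
  define K where "K z = (\<integral>y. g y z \<partial>P)" for z
  have iK: "integrable ?N K" using PN.integrable_snd[OF ig] by (simp add: K_def[abs_def])
  then have [measurable]: "K \<in> borel_measurable (lebd d)"
    by (metis borel_measurable_integrable measurable_cong_sets sets_gauss)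
  \<comment> \<open>Fubini gives integrability of the dominating function in y for almost every z
    only.\<close>
  have K_le: "AE z in ?N. K z + K (?n z) \<le> (\<integral>y. b y z \<partial>P)"
    using PN.AE_integrable_snd[OF ib]
  proof eventually_elim
    case (elim z)
    have n: "(\<lambda>i\<in>{..<d}. y i + c * ?n z i) = (\<lambda>i\<in>{..<d}. y i + - (c * z i))" for y
      by (intro restrict_ext) simp
    have "K z + K (?n z) \<le> (\<integral>y. rem (\<lambda>i. c * z i) y \<partial>P)"
      unfolding K_def g_def n by (rule second_difference_le)
    also have "\<dots> \<le> (\<integral>y. b y z \<partial>P)"
    proof (rule integral_mono[OF integrable_rem elim])
      fix y
      have sq: "(\<bar>a\<bar> + r)^2 \<le> (1 + e) * a^2 + (1 + 1/e) * r^2" for a r :: real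
      proof -
        have "0 \<le> (e * \<bar>a\<bar> - r)^2 / e" using e by simp
        also have "\<dots> = e * a^2 - 2 * \<bar>a\<bar> * r + r^2 / e"
          using e by (simp add: power2_diff power_mult_distrib diff_divide_distrib add_divide_distrib) (simp add: power2_eq_square)
        finally show ?thesis by (simp add: power2_eq_square algebra_simps)
      qed
      have 1: "(\<Sum>i<d. f y i * (c * z i)) = c * (\<Sum>i<d. f y i * z i)"
        by (simp add: sum_distrib_left mult_ac)
      have 2: "(\<Sum>i<d. (c * z i)^2) = c^2 * (\<Sum>i<d. (z i)^2)"
        by (simp add: sum_distrib_left power_mult_distrib)
      have "c^4 = (c^2)^2" by simp
      then show "rem (\<lambda>i. c * z i) y \<le> b y z"
        using sq[of "c * (\<Sum>i<d. f y i * z i)" "d * L * (c^2 * (\<Sum>i<d. (z i)^2))"]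
        unfolding rem_def b_def 1 2 by (simp only: power_mult_distrib mult_ac)
    qed
    finally show ?case .
  qed
  have iK': "integrable ?N (\<lambda>z. K (?n z))" using iK by (simp add: std_gauss_sym)
  have "2 * (\<integral>w. case_prod g w \<partial>(P \<Otimes>\<^sub>M ?N)) = 2 * (\<integral>z. K z \<partial>?N)"
    using PN.integral_snd[OF ig] by (simp add: K_def)
  also have "\<dots> = (\<integral>z. K z \<partial>?N) + (\<integral>z. K (?n z) \<partial>?N)" by (simp add: std_gauss_sym)
  also have "\<dots> = (\<integral>z. K z + K (?n z) \<partial>?N)" using iK iK' by simp
  also have "\<dots> \<le> (\<integral>z. (\<integral>y. b y z \<partial>P) \<partial>?N)"
    using iK iK' PN.integrable_snd[OF ib] K_le by (intro integral_mono_AE) auto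
  also have "\<dots> = (\<integral>w. case_prod b w \<partial>(P \<Otimes>\<^sub>M ?N))" by (rule PN.integral_snd[OF ib])
  also have "\<dots> = (1 + e) * c^2 * fisher + (1 + 1/e) * (d * L)^2 * c^4 * (\<integral>z. (\<Sum>i<d. (z i)^2)^2 \<partial>?N)"
    unfolding b_def split_beta'
    using integral_score_dot_sq PN.integrable_snd_only[OF integrable_std_gauss_norm4]
    by (subst Bochner_Integration.integral_add) auto
  finally show ?thesis by (simp add: g_def split_beta')
qed

end

subsection \<open>Tweedie's formula\<close>

lemma gauss_dens_update:
  assumes i: "i < d"
  shows "gauss_dens d m v (x(i := x i + t)) = gauss_dens d m v x * exp (- (2 * (x i - m i) * t + t^2) / (2 * v))"
proof -
  have "(\<Sum>j<d. ((x(i := x i + t)) j - m j)^2) = (x i + t - m i)^2 + (\<Sum>j\<in>{..<d}-{i}. (x j - m j)^2)"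
    using i by (subst sum.remove[of _ i]) (auto intro!: sum.cong)
  moreover have "(\<Sum>j<d. (x j - m j)^2) = (x i - m i)^2 + (\<Sum>j\<in>{..<d}-{i}. (x j - m j)^2)"
    using i by (subst sum.remove[of _ i]) auto
  ultimately have "(\<Sum>j<d. ((x(i := x i + t)) j - m j)^2) = (\<Sum>j<d. (x j - m j)^2) + (2 * (x i - m i) * t + t^2)"
    by (simp add: power2_eq_square algebra_simps)
  then show ?thesis
    by (simp add: gauss_dens_eq exp_add[symmetric] add_divide_distrib diff_divide_distrib)
qed

lemma gauss_dens_deriv:
  assumes i: "i < d" and v: "v > 0"
  shows "((\<lambda>t. gauss_dens d m v (x(i := x i + t))) has_real_derivative
     gauss_dens d m v (x(i := x i + t)) * ((m i - (x i + t)) / v)) (at t)"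
  unfolding gauss_dens_update[OF i]
  using v by (auto intro!: derivative_eq_intros simp: field_simps power2_eq_square)

text \<open>A uniform bound lets a multiple of \<open>p\<close> dominate the difference quotients of
  a blurred density. The exponential is compared with 1 / (1 + r^2 / (2 v)), and the factor 1 + 2 v
  comes from |r| <= 1 + r^2 <= (1 + 2 v) (1 + r^2 / (2 v)).\<close>

lemma gauss_dens_deriv_bounded:
  assumes i: "i < d" and v: "v > 0"
  shows "\<bar>gauss_dens d m v x * ((m i - x i) / v)\<bar> \<le> (2 * pi * v) powr (- real d / 2) * (1 + 2 * v) / v"
proof -
  let ?r = "x i - m i"
  have "?r^2 \<le> (\<Sum>j<d. (x j - m j)^2)" using i by (intro member_le_sum[where f="\<lambda>j. (x j - m j)^2"]) auto
  then have "exp (- ((\<Sum>j<d. (x j - m j)^2) / (2 * v))) \<le> exp (- (?r^2 / (2 * v)))"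
    using v by (simp add: divide_right_mono)
  also have "\<dots> \<le> 1 / (1 + ?r^2 / (2 * v))"
    using exp_ge_add_one_self[of "?r^2 / (2 * v)"] v
    by (simp add: exp_minus inverse_eq_divide) (intro divide_left_mono, auto simp: add_pos_nonneg)
  finally have 1: "exp (- ((\<Sum>j<d. (x j - m j)^2) / (2 * v))) \<le> 1 / (1 + ?r^2 / (2 * v))" .
  have "s \<le> 1 + s^2" if "s \<ge> 0" for s :: real
    using sum_squares_bound[of s 1] that by simp
  from this[of "\<bar>?r\<bar>"] have "\<bar>?r\<bar> \<le> 1 + ?r^2" by simp
  also have "\<dots> \<le> (1 + 2 * v) * (1 + ?r^2 / (2 * v))" using v by (simp add: field_simps)
  finally have 2: "\<bar>?r\<bar> \<le> (1 + 2 * v) * (1 + ?r^2 / (2 * v))" .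
  have "exp (- ((\<Sum>j<d. (x j - m j)^2) / (2 * v))) * \<bar>?r\<bar> \<le> 1 / (1 + ?r^2 / (2 * v)) * ((1 + 2 * v) * (1 + ?r^2 / (2 * v)))"
    using 1 2 v by (intro mult_mono) auto
  also have "\<dots> = 1 + 2 * v"
  proof -
    have "1 + ?r^2 / (2 * v) > 0" using v by (simp add: add_pos_nonneg)
    then show ?thesis by simp
  qed
  finally have "(2 * pi * v) powr (- real d / 2) * (exp (- ((\<Sum>j<d. (x j - m j)^2) / (2 * v))) * \<bar>?r\<bar>) / v
      \<le> (2 * pi * v) powr (- real d / 2) * (1 + 2 * v) / v"
    using v by (intro divide_right_mono mult_left_mono) auto
  then show ?thesis using v by (simp add: gauss_dens_eq abs_mult abs_minus_commute mult.assoc)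
qed

context pos_dens begin

lemma blur_deriv:
  assumes v: "v > 0" and i: "i < d"
  shows "((\<lambda>t. blur d a v p (x(i := x i + t))) has_real_derivative
     (\<integral>y. p y * (gauss_dens d (\<lambda>i. a * y i) v x * ((a * y i - x i) / v)) \<partial>lebd d)) (at 0)"
proof -
  define G where "G y t = gauss_dens d (\<lambda>i. a * y i) v (x(i := x i + t))" for y t
  define B where "B = (2 * pi * v) powr (- real d / 2) * (1 + 2 * v) / v"
  have der: "(G y has_real_derivative G y t * ((a * y i - (x i + t)) / v)) (at t)" for y t
    unfolding G_def using gauss_dens_deriv[OF i v, of "\<lambda>i. a * y i"] by simp
  have lipG: "\<bar>G y t - G y 0\<bar> \<le> B * \<bar>t\<bar>" for y t
  proof -
    have "norm (G y t - G y 0) \<le> B * norm (t - 0)"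
    proof (rule field_differentiable_bound[OF convex_UNIV])
      fix t show "(G y has_field_derivative G y t * ((a * y i - (x i + t)) / v)) (at t)" by (rule der)
      show "norm (G y t * ((a * y i - (x i + t)) / v)) \<le> B"
        using gauss_dens_deriv_bounded[OF i v, of "\<lambda>i. a * y i" "x(i := x i + t)"] by (simp add: G_def B_def)
    qed auto
    then show ?thesis by simp
  qed
  have [measurable]: "(\<lambda>y. G y t) \<in> borel_measurable (lebd d)" for t unfolding G_def by measurable
  have "((\<lambda>t. (blur d a v p (x(i := x i + t)) - blur d a v p (x(i := x i + 0))) / t) \<longlongrightarrow>
      (\<integral>y. p y * (G y 0 * ((a * y i - (x i + 0)) / v)) \<partial>lebd d)) (at 0)"
    unfolding tendsto_at_iff_sequentially
  proof (intro allI impI)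
    \<comment> \<open>The limit is tested along null sequences, so that dominated convergence
      applies with \<open>p\<close> times the derivative bound as the dominating function.\<close>
    fix X :: "nat \<Rightarrow> real" assume X0: "\<forall>i. X i \<in> UNIV - {0}" and X: "X \<longlonglongrightarrow> 0"
    have eq: "(blur d a v p (x(i := x i + X n)) - blur d a v p (x(i := x i + 0))) / X n
       = (\<integral>y. p y * ((G y (X n) - G y 0) / X n) \<partial>lebd d)" for n
    proof -
      have "blur d a v p (x(i := x i + X n)) - blur d a v p (x(i := x i + 0)) = (\<integral>y. p y * G y (X n) - p y * G y 0 \<partial>lebd d)"
        unfolding blur_def G_def by (rule Bochner_Integration.integral_diff[symmetric]; rule integrable_blur[OF v])
      then show ?thesis by (simp add: diff_divide_distrib right_diff_distrib integral_divide_zero[symmetric] del: integral_divide_zero)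
    qed
    have "(\<lambda>n. \<integral>y. p y * ((G y (X n) - G y 0) / X n) \<partial>lebd d) \<longlonglongrightarrow> (\<integral>y. p y * (G y 0 * ((a * y i - (x i + 0)) / v)) \<partial>lebd d)"
    proof (rule integral_dominated_convergence[where w="\<lambda>y. p y * B"])
      show "(\<lambda>y. p y * (G y 0 * ((a * y i - (x i + 0)) / v))) \<in> borel_measurable (lebd d)" using i by measurable
      show "integrable (lebd d) (\<lambda>y. p y * B)" using integrable_p by simp
      show "AE y in lebd d. (\<lambda>n. p y * ((G y (X n) - G y 0) / X n)) \<longlonglongrightarrow> p y * (G y 0 * ((a * y i - (x i + 0)) / v))"
      proof (intro AE_I2 tendsto_mult_left)
        fix y
        have "((\<lambda>t. (G y t - G y 0) / t) \<longlongrightarrow> G y 0 * ((a * y i - (x i + 0)) / v)) (at 0)"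
          using der[of y 0] by (simp add: has_field_derivative_iff)
        then show "(\<lambda>n. (G y (X n) - G y 0) / X n) \<longlonglongrightarrow> G y 0 * ((a * y i - (x i + 0)) / v)"
          using X0 X unfolding tendsto_at_iff_sequentially by (auto simp: o_def)
      qed
      fix n
      show "AE y in lebd d. norm (p y * ((G y (X n) - G y 0) / X n)) \<le> p y * B"
      proof (rule AE_I2)
        fix y assume "y \<in> space (lebd d)"
        then have "p y > 0" using pos by simp
        moreover have "\<bar>G y (X n) - G y 0\<bar> / \<bar>X n\<bar> \<le> B"
          using lipG[of y "X n"] X0 by (simp add: field_simps)
        ultimately show "norm (p y * ((G y (X n) - G y 0) / X n)) \<le> p y * B"
          by (simp add: abs_mult mult_left_mono times_divide_eq_right[symmetric] del: times_divide_eq_right)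
      qed
    qed measurable
    then show "((\<lambda>t. (blur d a v p (x(i := x i + t)) - blur d a v p (x(i := x i + 0))) / t) \<circ> X) \<longlonglongrightarrow>
      (\<integral>y. p y * (G y 0 * ((a * y i - (x i + 0)) / v)) \<partial>lebd d)" unfolding o_def eq .
  qed
  then show ?thesis by (simp add: has_field_derivative_iff G_def)
qed

text \<open>The score is given only as the gradient of the logarithm. Exponentiating recovers the
  derivative of the density, and uniqueness of derivatives compares it with differentiation under
  the integral sign. Read conditionally: given the noised value x, the mean of x - a Y is - v times
  the score at x.\<close>

lemma tweedie:
  assumes v: "v > 0" and i: "i < d" and x: "x \<in> Rd d"
    and grad: "has_grad d (\<lambda>x. ln (blur d a v p x)) f"
  shows "(\<integral>y. p y * gauss_dens d (\<lambda>i. a * y i) v x * (x i - a * y i) \<partial>lebd d) = - v * (blur d a v p x * f x i)"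
proof -
  have pos': "blur d a v p (x(i := x i + t)) > 0" for t
    using x i by (intro blur_pos[OF v]) (auto simp: Rd_def PiE_iff extensional_def)
  have "((\<lambda>t. ln (blur d a v p (x(i := x i + t)))) has_real_derivative f x i) (at 0)"
    using grad x i unfolding has_grad_def by blast
  then have "((\<lambda>t. exp (ln (blur d a v p (x(i := x i + t))))) has_real_derivative
     exp (ln (blur d a v p (x(i := x i + 0)))) * f x i) (at 0)"
    by (rule DERIV_fun_exp)
  then have "((\<lambda>t. blur d a v p (x(i := x i + t))) has_real_derivative blur d a v p x * f x i) (at 0)"
    using pos' pos'[of 0] by simp
  from DERIV_unique[OF this blur_deriv[OF v i]]
  have "v * (blur d a v p x * f x i) = (\<integral>y. v * (p y * (gauss_dens d (\<lambda>i. a * y i) v x * ((a * y i - x i) / v))) \<partial>lebd d)"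
    by simp
  also have "\<dots> = (\<integral>y. - (p y * gauss_dens d (\<lambda>i. a * y i) v x * (x i - a * y i)) \<partial>lebd d)"
    using v by (intro Bochner_Integration.integral_cong) (auto simp: field_simps)
  finally show ?thesis by simp
qed

section \<open>The joint law of a variable and its noised version\<close>

definition joint :: "real \<Rightarrow> real \<Rightarrow> (nat \<Rightarrow> real) \<times> (nat \<Rightarrow> real) \<Rightarrow> real" where
  "joint a v w = p (fst w) * gauss_dens d (\<lambda>i. a * fst w i) v (snd w)"

lemma joint_measurable [measurable]: "joint a v \<in> borel_measurable (lebd d \<Otimes>\<^sub>M lebd d)"
  unfolding joint_def[abs_def] by measurable

lemma joint_pos: "v > 0 \<Longrightarrow> w \<in> space (lebd d \<Otimes>\<^sub>M lebd d) \<Longrightarrow> joint a v w > 0"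
  by (auto simp: joint_def space_pair_measure intro!: mult_pos_pos pos gauss_dens_pos)

lemma joint_eq_distr:
  assumes v: "v > 0"
  shows "density (lebd d \<Otimes>\<^sub>M lebd d) (\<lambda>w. ennreal (joint a v w))
    = distr PZ (lebd d \<Otimes>\<^sub>M lebd d) (\<lambda>w. (fst w, noised d a v (fst w) (snd w)))"
    (is "?D = distr _ _ ?T")
proof (rule measure_eqI)
  fix A assume "A \<in> sets ?D"
  then have A [measurable]: "A \<in> sets (lebd d \<Otimes>\<^sub>M lebd d)" by simp
  have T [measurable]: "?T \<in> PZ \<rightarrow>\<^sub>M lebd d \<Otimes>\<^sub>M lebd d" by measurable
  have 1: "(\<integral>\<^sup>+x. ennreal (joint a v (y, x)) * indicator A (y, x) \<partial>lebd d)
      = ennreal (p y) * (\<integral>\<^sup>+z. indicator A (?T (y, z)) \<partial>std_gauss d)" if y: "y \<in> space (lebd d)" for y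
  proof -
    have [measurable]: "(\<lambda>x. indicator A (y, x) :: ennreal) \<in> borel_measurable (lebd d)" using y by measurable
    have "(\<integral>\<^sup>+x. ennreal (joint a v (y, x)) * indicator A (y, x) \<partial>lebd d)
       = (\<integral>\<^sup>+x. ennreal (p y) * (ennreal (gauss_dens d (\<lambda>i. a * y i) v x) * indicator A (y, x)) \<partial>lebd d)"
      using pos[of y] y by (simp add: joint_def ennreal_mult mult.assoc less_imp_le)
    also have "\<dots> = ennreal (p y) * (\<integral>\<^sup>+x. indicator A (y, x) \<partial>gauss d (\<lambda>i. a * y i) v)"
      by (subst nn_integral_cmult) (auto simp: nn_integral_gauss)
    also have "(\<integral>\<^sup>+x. indicator A (y, x) \<partial>gauss d (\<lambda>i. a * y i) v) = (\<integral>\<^sup>+z. indicator A (?T (y, z)) \<partial>std_gauss d)"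
      by (subst gauss_eq_distr[OF v], subst nn_integral_distr) auto
    finally show ?thesis .
  qed
  have "emeasure ?D A = (\<integral>\<^sup>+w. ennreal (joint a v w) * indicator A w \<partial>(lebd d \<Otimes>\<^sub>M lebd d))"
    by (rule emeasure_density) measurable
  also have "\<dots> = (\<integral>\<^sup>+y. \<integral>\<^sup>+x. ennreal (joint a v (y, x)) * indicator A (y, x) \<partial>lebd d \<partial>lebd d)"
    by (rule lebd.nn_integral_fst[symmetric]) measurable
  also have "\<dots> = (\<integral>\<^sup>+y. ennreal (p y) * (\<integral>\<^sup>+z. indicator A (?T (y, z)) \<partial>std_gauss d) \<partial>lebd d)"
    by (intro nn_integral_cong 1)
  also have "\<dots> = (\<integral>\<^sup>+y. \<integral>\<^sup>+z. indicator A (?T (y, z)) \<partial>std_gauss d \<partial>P)"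
  proof (rule nn_integral_P[symmetric])
    have [measurable]: "(\<lambda>w. indicator A (?T w) :: ennreal) \<in> borel_measurable (lebd d \<Otimes>\<^sub>M std_gauss d)"
      by measurable
    show "(\<lambda>y. \<integral>\<^sup>+z. indicator A (?T (y, z)) \<partial>std_gauss d) \<in> borel_measurable (lebd d)" by measurable
  qed
  also have "\<dots> = (\<integral>\<^sup>+w. indicator A (?T w) \<partial>PZ)"
    by (rule std_gauss.nn_integral_fst) measurable
  also have "\<dots> = emeasure (distr PZ (lebd d \<Otimes>\<^sub>M lebd d) ?T) A"
    by (subst nn_integral_indicator[symmetric], simp, subst nn_integral_distr) auto
  finally show "emeasure ?D A = emeasure (distr PZ (lebd d \<Otimes>\<^sub>M lebd d) ?T) A" .
qed simp

lemma joint_integral: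
  fixes H :: "_ \<Rightarrow> real"
  assumes v: "v > 0" and [measurable]: "H \<in> borel_measurable (lebd d \<Otimes>\<^sub>M lebd d)"
  shows "integrable PZ (\<lambda>w. H (fst w, noised d a v (fst w) (snd w)))
     \<longleftrightarrow> integrable (lebd d \<Otimes>\<^sub>M lebd d) (\<lambda>w. joint a v w * H w)"
    and "(\<integral>w. H (fst w, noised d a v (fst w) (snd w)) \<partial>PZ)
     = (\<integral>w. joint a v w * H w \<partial>(lebd d \<Otimes>\<^sub>M lebd d))"
proof -
  have T [measurable]: "(\<lambda>w. (fst w, noised d a v (fst w) (snd w))) \<in> PZ \<rightarrow>\<^sub>M lebd d \<Otimes>\<^sub>M lebd d"
    by measurable
  have nn: "AE w in lebd d \<Otimes>\<^sub>M lebd d. joint a v w \<ge> 0"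
    using joint_pos[OF v] by (auto intro!: AE_I2 less_imp_le)
  show "integrable PZ (\<lambda>w. H (fst w, noised d a v (fst w) (snd w)))
     \<longleftrightarrow> integrable (lebd d \<Otimes>\<^sub>M lebd d) (\<lambda>w. joint a v w * H w)"
    using nn by (subst integrable_distr_eq[OF T, symmetric], simp, subst joint_eq_distr[OF v, symmetric])
      (simp add: integrable_density)
  show "(\<integral>w. H (fst w, noised d a v (fst w) (snd w)) \<partial>PZ)
     = (\<integral>w. joint a v w * H w \<partial>(lebd d \<Otimes>\<^sub>M lebd d))"
    using nn by (subst integral_distr[OF T, symmetric], simp, subst joint_eq_distr[OF v, symmetric])
      (simp add: integral_density)
qed

lemma blur_integral:
  fixes F :: "_ \<Rightarrow> real"
  assumes v: "v > 0" and [measurable]: "F \<in> borel_measurable (lebd d)"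
  shows "integrable PZ (\<lambda>w. F (noised d a v (fst w) (snd w)))
     \<longleftrightarrow> integrable (density (lebd d) (\<lambda>x. ennreal (blur d a v p x))) F"
    and "(\<integral>w. F (noised d a v (fst w) (snd w)) \<partial>PZ)
     = (\<integral>x. F x \<partial>density (lebd d) (\<lambda>x. ennreal (blur d a v p x)))"
proof -
  have T [measurable]: "(\<lambda>w. noised d a v (fst w) (snd w)) \<in> PZ \<rightarrow>\<^sub>M lebd d"
    by measurable
  show "integrable PZ (\<lambda>w. F (noised d a v (fst w) (snd w)))
     \<longleftrightarrow> integrable (density (lebd d) (\<lambda>x. ennreal (blur d a v p x))) F"
    unfolding blur_eq_distr[OF v] by (subst integrable_distr_eq[OF T]) auto
  show "(\<integral>w. F (noised d a v (fst w) (snd w)) \<partial>PZ)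
     = (\<integral>x. F x \<partial>density (lebd d) (\<lambda>x. ennreal (blur d a v p x)))"
    unfolding blur_eq_distr[OF v] by (subst integral_distr[OF T]) auto
qed

text \<open>Fubini with the noised variable held fixed replaces the noise by its conditional mean,
  which \<open>tweedie\<close> supplies. No derivative of \<open>F\<close> is taken, so
  \<open>F\<close> can be a component of the estimated score.\<close>

lemma tweedie_integral:
  assumes v: "v > 0" and i: "i < d"
    and grad: "has_grad d (\<lambda>x. ln (blur d a v p x)) f"
    and [measurable]: "F \<in> borel_measurable (lebd d)"
    and fm [measurable]: "(\<lambda>x. f x i) \<in> borel_measurable (lebd d)"
    and int: "integrable PZ (\<lambda>w. snd w i * F (noised d a v (fst w) (snd w)))"
  shows "(\<integral>w. snd w i * F (noised d a v (fst w) (snd w)) \<partial>PZ)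
     = - sqrt v * (\<integral>x. f x i * F x \<partial>density (lebd d) (\<lambda>x. ennreal (blur d a v p x)))"
proof -
  define H where "H w = (snd w i - a * fst w i) * F (snd w)" for w :: "(nat \<Rightarrow> real) \<times> (nat \<Rightarrow> real)"
  have Hm [measurable]: "H \<in> borel_measurable (lebd d \<Otimes>\<^sub>M lebd d)"
    unfolding H_def using i by measurable
  have H: "H (y, noised d a v y z) = sqrt v * (z i * F (noised d a v y z))" for y z
    using i by (simp add: H_def)
  have "integrable PZ (\<lambda>w. H (fst w, noised d a v (fst w) (snd w)))"
    unfolding H using int by (rule integrable_mult_right)
  then have ij: "integrable (lebd d \<Otimes>\<^sub>M lebd d) (\<lambda>w. joint a v w * H w)"
    by (subst (asm) joint_integral[OF v Hm])
  have "sqrt v * (\<integral>w. snd w i * F (noised d a v (fst w) (snd w)) \<partial>PZ)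
     = (\<integral>w. joint a v w * H w \<partial>(lebd d \<Otimes>\<^sub>M lebd d))"
    using joint_integral(2)[OF v Hm, of a] by (simp add: H)
  also have "\<dots> = (\<integral>x. (\<integral>y. joint a v (y, x) * H (y, x) \<partial>lebd d) \<partial>lebd d)"
    using lebd2.integral_snd[of d d "\<lambda>y x. joint a v (y, x) * H (y, x)"] ij
    by (simp add: split_beta')
  also have "\<dots> = (\<integral>x. - v * (blur d a v p x * (f x i * F x)) \<partial>lebd d)"
  proof (intro Bochner_Integration.integral_cong refl)
    fix x assume x: "x \<in> space (lebd d)"
    have "(\<integral>y. joint a v (y, x) * H (y, x) \<partial>lebd d)
      = (\<integral>y. (p y * gauss_dens d (\<lambda>i. a * y i) v x * (x i - a * y i)) * F x \<partial>lebd d)"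
      by (simp add: joint_def H_def mult.assoc)
    also have "\<dots> = (- v * (blur d a v p x * f x i)) * F x"
      using tweedie[OF v i _ grad, of x] x by simp
    finally show "(\<integral>y. joint a v (y, x) * H (y, x) \<partial>lebd d) = - v * (blur d a v p x * (f x i * F x))"
      by simp
  qed
  also have "\<dots> = - v * (\<integral>x. f x i * F x \<partial>density (lebd d) (\<lambda>x. ennreal (blur d a v p x)))"
    using blur_pos[OF v] by (subst integral_density) (auto intro!: AE_I2 less_imp_le)
  also have "\<dots> = sqrt v * (- sqrt v * (\<integral>x. f x i * F x \<partial>density (lebd d) (\<lambda>x. ennreal (blur d a v p x))))"
    using v by (simp add: mult.assoc[symmetric])
  finally show ?thesis using v by (simp only: mult_cancel_left real_sqrt_eq_0_iff) simp
qed

end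

subsection \<open>Relative entropy in dual form\<close>

text \<open>Jensen's inequality for the exponential, from 1 + l <= exp l. It reduces a relative
  entropy bound to checking that an explicit exponential has mean at most one.\<close>

lemma (in prob_space) expectation_nonpos_of_exp:
  assumes l: "integrable M l" and e: "(\<integral>\<^sup>+x. ennreal (exp (l x)) \<partial>M) \<le> 1"
  shows "(\<integral>x. l x \<partial>M) \<le> (0::real)"
proof -
  have [measurable]: "l \<in> borel_measurable M" using l by auto
  have i: "integrable M (\<lambda>x. exp (l x))"
    by (intro integrableI_nonneg le_less_trans[OF e]) auto
  have "ennreal (\<integral>x. exp (l x) \<partial>M) \<le> 1"
    using e by (subst nn_integral_eq_integral[OF i, symmetric]) auto
  then have "(\<integral>x. exp (l x) \<partial>M) \<le> 1" by simp
  moreover have "(\<integral>x. 1 + l x \<partial>M) \<le> (\<integral>x. exp (l x) \<partial>M)"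
    using l i by (intro integral_mono) (auto simp: exp_ge_add_one_self)
  moreover have "(\<integral>x. 1 + l x \<partial>M) = 1 + (\<integral>x. l x \<partial>M)"
    using l by (simp add: prob_space)
  ultimately show ?thesis by simp
qed

text \<open>Positive bounds on both sides keep g and ln g integrable under every probability law,
  and they survive averaging over a Markov kernel, which the induction along the chain
  exploits.\<close>

definition test_fun :: "nat \<Rightarrow> real \<Rightarrow> real \<Rightarrow> ((nat \<Rightarrow> real) \<Rightarrow> real) \<Rightarrow> bool" where
  "test_fun d \<alpha> \<beta> g \<longleftrightarrow> g \<in> borel_measurable (lebd d) \<and> 0 < \<alpha> \<and> (\<forall>x\<in>Rd d. \<alpha> \<le> g x \<and> g x \<le> \<beta>)"

text \<open>The Donsker--Varadhan dual form of \<open>KL(\<mu> \<parallel> \<nu>) \<le> D\<close>; it needs no density of \<open>\<nu>\<close>.\<close>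

definition kl_le :: "nat \<Rightarrow> (nat \<Rightarrow> real) measure \<Rightarrow> (nat \<Rightarrow> real) measure \<Rightarrow> real \<Rightarrow> bool" where
  "kl_le d \<mu> \<nu> D \<longleftrightarrow> (\<forall>\<alpha> \<beta> g. test_fun d \<alpha> \<beta> g \<longrightarrow> (\<integral>x. ln (g x) \<partial>\<mu>) \<le> ln (\<integral>x. g x \<partial>\<nu>) + D)"

lemma test_fun_integral:
  assumes "test_fun d \<alpha> \<beta> g" "prob_space \<mu>" "sets \<mu> = sets (lebd d)"
  shows "integrable \<mu> g" "integrable \<mu> (\<lambda>x. ln (g x))" "\<alpha> \<le> (\<integral>x. g x \<partial>\<mu>)" "(\<integral>x. g x \<partial>\<mu>) \<le> \<beta>"
    "ennreal (\<integral>x. g x \<partial>\<mu>) = (\<integral>\<^sup>+x. ennreal (g x) \<partial>\<mu>)"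
proof -
  interpret prob_space \<mu> by fact
  have sp: "space \<mu> = Rd d" using sets_eq_imp_space_eq[OF assms(3)] by simp
  have [measurable]: "g \<in> borel_measurable \<mu>"
    using assms(1,3) unfolding test_fun_def by (metis measurable_cong_sets)
  have a: "0 < \<alpha>" and b: "\<And>x. x \<in> space \<mu> \<Longrightarrow> \<alpha> \<le> g x \<and> g x \<le> \<beta>"
    using assms(1) sp by (auto simp: test_fun_def)
  show i: "integrable \<mu> g"
    using a b by (intro integrable_const_bound[where B=\<beta>] AE_I2) force+
  show "integrable \<mu> (\<lambda>x. ln (g x))"
  proof (intro integrable_const_bound[where B="\<bar>ln \<alpha>\<bar> + \<bar>ln \<beta>\<bar>"] AE_I2)
    fix x assume "x \<in> space \<mu>"
    then have "\<alpha> \<le> g x" "g x \<le> \<beta>" using b by auto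
    then have "ln \<alpha> \<le> ln (g x)" "ln (g x) \<le> ln \<beta>" using a by auto
    then show "norm (ln (g x)) \<le> \<bar>ln \<alpha>\<bar> + \<bar>ln \<beta>\<bar>" by auto
  qed measurable
  have "(\<integral>x. \<alpha> \<partial>\<mu>) \<le> (\<integral>x. g x \<partial>\<mu>)" using i b by (intro integral_mono) auto
  then show "\<alpha> \<le> (\<integral>x. g x \<partial>\<mu>)" by (simp add: prob_space)
  have "(\<integral>x. g x \<partial>\<mu>) \<le> (\<integral>x. \<beta> \<partial>\<mu>)" using i b by (intro integral_mono) auto
  then show "(\<integral>x. g x \<partial>\<mu>) \<le> \<beta>" by (simp add: prob_space)
  show "ennreal (\<integral>x. g x \<partial>\<mu>) = (\<integral>\<^sup>+x. ennreal (g x) \<partial>\<mu>)"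
    using a b by (intro nn_integral_eq_integral[OF i, symmetric] AE_I2) force
qed

section \<open>Gaussian Markov kernels acting on test functions\<close>

lemma gauss_kernel_measurable:
  assumes [measurable]: "\<And>i. i < d \<Longrightarrow> (\<lambda>x. m x i) \<in> borel_measurable (lebd d)" and h: "h > 0"
  shows "(\<lambda>x. gauss d (m x) h) \<in> lebd d \<rightarrow>\<^sub>M subprob_algebra (lebd d)"
proof (rule measurable_subprob_algebra)
  fix x show "subprob_space (gauss d (m x) h)"
    by (intro prob_space_imp_subprob_space prob_space_gauss h)
  show "sets (gauss d (m x) h) = sets (lebd d)" by simp
next
  fix A assume A [measurable]: "A \<in> sets (lebd d)"
  have [measurable]: "(\<lambda>w. gauss_dens d (m (fst w)) h (snd w)) \<in> borel_measurable (lebd d \<Otimes>\<^sub>M lebd d)"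
  proof (rule measurable_gauss_dens)
    fix i assume "i < d"
    then show "(\<lambda>w. m (fst w) i) \<in> borel_measurable (lebd d \<Otimes>\<^sub>M lebd d)"
      by (intro measurable_compose[OF measurable_fst assms(1)])
  qed measurable
  have "emeasure (gauss d (m x) h) A = (\<integral>\<^sup>+y. ennreal (gauss_dens d (m x) h y) * indicator A y \<partial>lebd d)" for x
    unfolding gauss_def by (rule emeasure_density) measurable
  moreover have "(\<lambda>x. \<integral>\<^sup>+y. ennreal (gauss_dens d (m x) h y) * indicator A y \<partial>lebd d) \<in> borel_measurable (lebd d)"
    by (rule lebd.borel_measurable_nn_integral_fst[of "\<lambda>w. ennreal (gauss_dens d (m (fst w)) h (snd w)) * indicator A (snd w)", simplified]) measurable
  ultimately show "(\<lambda>x. emeasure (gauss d (m x) h) A) \<in> borel_measurable (lebd d)" by simp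
qed

lemma test_fun_gauss:
  assumes g: "test_fun d \<alpha> \<beta> g"
    and m: "\<And>i. i < d \<Longrightarrow> (\<lambda>x. m x i) \<in> borel_measurable (lebd d)" and h: "h > 0"
  shows "test_fun d \<alpha> \<beta> (\<lambda>x. \<integral>y. g y \<partial>gauss d (m x) h)"
proof -
  note K = gauss_kernel_measurable[OF m h]
  have [measurable]: "g \<in> borel_measurable (lebd d)" using g by (simp add: test_fun_def)
  have "(\<lambda>x. enn2real (\<integral>\<^sup>+y. ennreal (g y) \<partial>gauss d (m x) h)) \<in> borel_measurable (lebd d)"
    by (intro measurable_compose[OF measurable_compose[OF K nn_integral_measurable_subprob_algebra]]) measurable
  moreover have "enn2real (\<integral>\<^sup>+y. ennreal (g y) \<partial>gauss d (m x) h) = (\<integral>y. g y \<partial>gauss d (m x) h)" for x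
    using test_fun_integral(3)[OF g prob_space_gauss[OF h, of d "m x"] sets_gauss] g
    by (simp add: test_fun_integral(5)[OF g prob_space_gauss[OF h] sets_gauss, symmetric] test_fun_def)
  ultimately show ?thesis
    using g test_fun_integral(3,4)[OF g prob_space_gauss[OF h] sets_gauss] by (simp add: test_fun_def)
qed

lemma integral_bind_gauss:
  assumes g: "test_fun d \<alpha> \<beta> g" and mu: "prob_space \<mu>" "sets \<mu> = sets (lebd d)"
    and m: "\<And>i. i < d \<Longrightarrow> (\<lambda>x. m x i) \<in> borel_measurable (lebd d)" and h: "h > 0"
  shows "prob_space (\<mu> \<bind> (\<lambda>x. gauss d (m x) h))" "sets (\<mu> \<bind> (\<lambda>x. gauss d (m x) h)) = sets (lebd d)"
    "(\<integral>x. g x \<partial>(\<mu> \<bind> (\<lambda>x. gauss d (m x) h))) = (\<integral>x. (\<integral>y. g y \<partial>gauss d (m x) h) \<partial>\<mu>)"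
proof -
  interpret prob_space \<mu> by fact
  have K: "(\<lambda>x. gauss d (m x) h) \<in> \<mu> \<rightarrow>\<^sub>M subprob_algebra (lebd d)"
    using gauss_kernel_measurable[OF m h] mu(2) by (simp cong: measurable_cong_sets)
  show 1: "prob_space (\<mu> \<bind> (\<lambda>x. gauss d (m x) h))"
    using K by (intro prob_space_bind) (auto intro!: AE_I2 prob_space_gauss h)
  show 2: "sets (\<mu> \<bind> (\<lambda>x. gauss d (m x) h)) = sets (lebd d)"
    by (rule sets_bind) (auto simp: not_empty)
  have a: "\<alpha> > 0" using g by (simp add: test_fun_def)
  have [measurable]: "g \<in> borel_measurable (lebd d)" using g by (simp add: test_fun_def)
  have "ennreal (\<integral>x. g x \<partial>(\<mu> \<bind> (\<lambda>x. gauss d (m x) h))) = (\<integral>\<^sup>+x. ennreal (g x) \<partial>(\<mu> \<bind> (\<lambda>x. gauss d (m x) h)))"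
    by (rule test_fun_integral(5)[OF g 1 2])
  also have "\<dots> = (\<integral>\<^sup>+x. \<integral>\<^sup>+y. ennreal (g y) \<partial>gauss d (m x) h \<partial>\<mu>)"
    by (rule nn_integral_bind[OF _ K]) measurable
  also have "\<dots> = (\<integral>\<^sup>+x. ennreal (\<integral>y. g y \<partial>gauss d (m x) h) \<partial>\<mu>)"
    using test_fun_integral(5)[OF g prob_space_gauss[OF h]] by simp
  also have "\<dots> = ennreal (\<integral>x. (\<integral>y. g y \<partial>gauss d (m x) h) \<partial>\<mu>)"
    using test_fun_integral(5)[OF test_fun_gauss[OF g m h] mu] by simp
  finally show "(\<integral>x. g x \<partial>(\<mu> \<bind> (\<lambda>x. gauss d (m x) h))) = (\<integral>x. (\<integral>y. g y \<partial>gauss d (m x) h) \<partial>\<mu>)"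
    using order_trans[OF less_imp_le[OF a] test_fun_integral(3)[OF g 1 2]]
      order_trans[OF less_imp_le[OF a] test_fun_integral(3)[OF test_fun_gauss[OF g m h] mu]]
    by (subst (asm) ennreal_inj) auto
qed

context pos_dens begin

text \<open>Comparing the joint law of variable and noised variable with a product law, and testing
  only the second component, is data processing: the log ratio involves the conditional Gaussians
  instead of their mixture.\<close>

lemma kl_le_initial:
  assumes v: "v > 0" and w: "w > 0"
    and int: "integrable PZ l"
    and l: "\<And>y z. l (y, z) = ln (gauss_dens d (\<lambda>i. a * y i) v (noised d a v y z))
       - ln (gauss_dens d m w (noised d a v y z))"
  shows "kl_le d (density (lebd d) (\<lambda>x. ennreal (blur d a v p x))) (gauss d m w) (\<integral>w. l w \<partial>PZ)"
  unfolding kl_le_def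
proof (intro allI impI)
  fix \<alpha> \<beta> g assume g: "test_fun d \<alpha> \<beta> g"
  let ?Q = "density (lebd d) (\<lambda>x. ennreal (blur d a v p x))"
  interpret Q: pos_dens d "blur d a v p" by (rule pos_dens_blur[OF v])
  have gm [measurable]: "g \<in> borel_measurable (lebd d)" and a: "\<alpha> > 0"
    and gb: "\<And>x. x \<in> Rd d \<Longrightarrow> \<alpha> \<le> g x" using g by (auto simp: test_fun_def)
  define C where "C = (\<integral>x. g x \<partial>gauss d m w)"
  have C: "C > 0" using test_fun_integral(3)[OF g prob_space_gauss[OF w, of d m] sets_gauss] a by (simp add: C_def)
  have iQ: "integrable ?Q (\<lambda>x. ln (g x))"
    using test_fun_integral(2)[OF g Q.prob_space_P] by (simp add: Q.P_def)
  have ig: "integrable PZ (\<lambda>w'. ln (g (noised d a v (fst w') (snd w'))))"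
    using iQ by (subst blur_integral[OF v]) auto
  \<comment> \<open>\<open>E\<close> is the exponential written as a function of the pair (earlier,
    noised). Times the joint density, the forward Gaussian cancels, and what remains integrates to
    one because \<open>C\<close> normalises \<open>g\<close>.\<close>
  define E where "E w' = ennreal (g (snd w') * gauss_dens d m w (snd w') / (gauss_dens d (\<lambda>i. a * fst w' i) v (snd w') * C))" for w'
  have Em [measurable]: "E \<in> borel_measurable (lebd d \<Otimes>\<^sub>M lebd d)" unfolding E_def by measurable
  have "(\<integral>w'. ln (g (noised d a v (fst w') (snd w'))) - l w' - ln C \<partial>PZ) \<le> 0"
  proof (rule PN.expectation_nonpos_of_exp)
    show "integrable PZ (\<lambda>w'. ln (g (noised d a v (fst w') (snd w'))) - l w' - ln C)"
      using ig int by (intro Bochner_Integration.integrable_diff) auto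
    have T: "(\<lambda>w. (fst w, noised d a v (fst w) (snd w))) \<in> PZ \<rightarrow>\<^sub>M lebd d \<Otimes>\<^sub>M lebd d"
      by measurable
    have "(\<integral>\<^sup>+w'. ennreal (exp (ln (g (noised d a v (fst w') (snd w'))) - l w' - ln C)) \<partial>PZ)
       = (\<integral>\<^sup>+w'. E (fst w', noised d a v (fst w') (snd w')) \<partial>PZ)"
    proof (intro nn_integral_cong)
      fix w' :: "(nat \<Rightarrow> real) \<times> (nat \<Rightarrow> real)"
      let ?x = "noised d a v (fst w') (snd w')"
      have "g ?x > 0" using gb[of ?x] a by simp
      moreover have "l w' = ln (gauss_dens d (\<lambda>i. a * fst w' i) v ?x) - ln (gauss_dens d m w ?x)"
        using l[of "fst w'" "snd w'"] by simp
      ultimately show "ennreal (exp (ln (g ?x) - l w' - ln C)) = E (fst w', ?x)"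
        using gauss_dens_pos[OF v] gauss_dens_pos[OF w] C
        by (simp add: E_def exp_diff exp_ln)
    qed
    also have "\<dots> = (\<integral>\<^sup>+w'. ennreal (joint a v w') * E w' \<partial>(lebd d \<Otimes>\<^sub>M lebd d))"
      by (subst nn_integral_distr[OF T, symmetric], simp, subst joint_eq_distr[OF v, symmetric],
          subst nn_integral_density) auto
    also have "\<dots> = (\<integral>\<^sup>+w'. ennreal (p (fst w')) * (ennreal (1 / C) * (ennreal (gauss_dens d m w (snd w')) * ennreal (g (snd w')))) \<partial>(lebd d \<Otimes>\<^sub>M lebd d))"
    proof (intro nn_integral_cong)
      fix w' assume "w' \<in> space (lebd d \<Otimes>\<^sub>M lebd d)"
      then have "p (fst w') > 0" "g (snd w') > 0" using pos gb[of "snd w'"] a by (auto simp: space_pair_measure)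
      moreover have "gauss_dens d (\<lambda>i. a * fst w' i) v (snd w') > 0" by (rule gauss_dens_pos[OF v])
      ultimately show "ennreal (joint a v w') * E w' = ennreal (p (fst w')) * (ennreal (1 / C) * (ennreal (gauss_dens d m w (snd w')) * ennreal (g (snd w'))))"
        using C by (simp add: joint_def E_def ennreal_mult[symmetric] field_simps)
    qed
    also have "\<dots> = (\<integral>\<^sup>+y. \<integral>\<^sup>+x. ennreal (p y) * (ennreal (1 / C) * (ennreal (gauss_dens d m w x) * ennreal (g x))) \<partial>lebd d \<partial>lebd d)"
      by (subst lebd.nn_integral_fst[symmetric]) (auto intro!: borel_measurable_times_ennreal)
    also have "\<dots> = (\<integral>\<^sup>+y. ennreal (p y) * (ennreal (1 / C) * ennreal C) \<partial>lebd d)"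
      unfolding C_def test_fun_integral(5)[OF g prob_space_gauss[OF w] sets_gauss]
      by (intro nn_integral_cong) (simp add: nn_integral_cmult nn_integral_gauss)
    also have "\<dots> = 1" using C by (simp add: ennreal_mult[symmetric] mass)
    finally show "(\<integral>\<^sup>+w'. ennreal (exp (ln (g (noised d a v (fst w') (snd w'))) - l w' - ln C)) \<partial>PZ) \<le> 1" by simp
  qed
  also have "(\<integral>w'. ln (g (noised d a v (fst w') (snd w'))) - l w' - ln C \<partial>PZ)
     = (\<integral>w'. ln (g (noised d a v (fst w') (snd w'))) \<partial>PZ) - (\<integral>w'. l w' \<partial>PZ) - ln C"
    using ig int by (subst Bochner_Integration.integral_diff, simp, simp, subst Bochner_Integration.integral_diff) (auto simp: PN.prob_space)
  also have "(\<integral>w'. ln (g (noised d a v (fst w') (snd w'))) \<partial>PZ) = (\<integral>x. ln (g x) \<partial>?Q)"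
    by (rule blur_integral(2)[OF v]) measurable
  finally show "(\<integral>x. ln (g x) \<partial>?Q) \<le> ln (\<integral>x. g x \<partial>gauss d m w) + (\<integral>w'. l w' \<partial>PZ)"
    by (simp add: C_def)
qed

text \<open>Gibbs' inequality is built in: any probability density \<open>r\<close> may stand in for the density of the
  noised variable, so the entropy of the latter is never needed.\<close>

lemma kl_le_reverse_step:
  assumes v: "v > 0" and h: "h > 0"
    and m: "\<And>i. i < d \<Longrightarrow> (\<lambda>x. m x i) \<in> borel_measurable (lebd d)"
    and r: "pos_dens d r"
    and kl: "kl_le d (density (lebd d) (\<lambda>x. ennreal (blur d a v p x))) \<mu> D"
    and mu: "prob_space \<mu>" "sets \<mu> = sets (lebd d)"
    and int: "integrable PZ l"
    and l: "\<And>y z. l (y, z) = ln (p y) + ln (gauss_dens d (\<lambda>i. a * y i) v (noised d a v y z))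
       - ln (gauss_dens d (m (noised d a v y z)) h y) - ln (r (noised d a v y z))"
  shows "kl_le d P (\<mu> \<bind> (\<lambda>x. gauss d (m x) h)) (D + (\<integral>w. l w \<partial>PZ))"
  unfolding kl_le_def
proof (intro allI impI)
  fix \<alpha> \<beta> g assume g: "test_fun d \<alpha> \<beta> g"
  let ?Q = "density (lebd d) (\<lambda>x. ennreal (blur d a v p x))"
  interpret Q: pos_dens d "blur d a v p" by (rule pos_dens_blur[OF v])
  interpret R: pos_dens d r by fact
  \<comment> \<open>Averaging over the reverse kernel makes \<open>G\<close> a test function of the
    noised variable, so the bound \<open>kl\<close> applies to it: this is the chain rule for
    relative entropy in dual form.\<close>
  define G where "G x = (\<integral>y. g y \<partial>gauss d (m x) h)" for x
  have Gt: "test_fun d \<alpha> \<beta> G" unfolding G_def by (rule test_fun_gauss[OF g m h])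
  have gm [measurable]: "g \<in> borel_measurable (lebd d)" and a: "\<alpha> > 0"
    and gb: "\<And>x. x \<in> Rd d \<Longrightarrow> \<alpha> \<le> g x" using g by (auto simp: test_fun_def)
  have Gm [measurable]: "G \<in> borel_measurable (lebd d)" and Gb: "\<And>x. x \<in> Rd d \<Longrightarrow> \<alpha> \<le> G x"
    using Gt by (auto simp: test_fun_def)
  have qm [measurable]: "(\<lambda>w. gauss_dens d (m (snd w)) h (fst w)) \<in> borel_measurable (lebd d \<Otimes>\<^sub>M lebd d)"
  proof (rule measurable_gauss_dens)
    fix i assume "i < d"
    then show "(\<lambda>w. m (snd w) i) \<in> borel_measurable (lebd d \<Otimes>\<^sub>M lebd d)"
      by (intro measurable_compose[OF measurable_snd m])
  qed measurable
  have ig: "integrable PZ (\<lambda>w. ln (g (fst w)))"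
    using test_fun_integral(2)[OF g prob_space_P sets_P] by (rule PN.integrable_fst_only(1))
  have "integrable ?Q (\<lambda>x. ln (G x))"
    using test_fun_integral(2)[OF Gt Q.prob_space_P] by (simp add: Q.P_def)
  then have iG: "integrable PZ (\<lambda>w. ln (G (noised d a v (fst w) (snd w))))"
    by (subst blur_integral[OF v]) auto
  \<comment> \<open>Multiplication by the joint density leaves r / G at the noised variable times
    the reverse kernel density times g. Integrating the earlier variable first reproduces
    \<open>G\<close>, so only the mass of \<open>r\<close> remains.\<close>
  define E where "E w = ennreal (g (fst w) * gauss_dens d (m (snd w)) h (fst w) * r (snd w) / (joint a v w * G (snd w)))" for w
  have Em [measurable]: "E \<in> borel_measurable (lebd d \<Otimes>\<^sub>M lebd d)" unfolding E_def by measurable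
  have "(\<integral>w. ln (g (fst w)) - l w - ln (G (noised d a v (fst w) (snd w))) \<partial>PZ) \<le> 0"
  proof (rule PN.expectation_nonpos_of_exp)
    show "integrable PZ (\<lambda>w. ln (g (fst w)) - l w - ln (G (noised d a v (fst w) (snd w))))"
      using ig int iG by (intro Bochner_Integration.integrable_diff) auto
    have T: "(\<lambda>w. (fst w, noised d a v (fst w) (snd w))) \<in> PZ \<rightarrow>\<^sub>M lebd d \<Otimes>\<^sub>M lebd d"
      by measurable
    have "(\<integral>\<^sup>+w. ennreal (exp (ln (g (fst w)) - l w - ln (G (noised d a v (fst w) (snd w))))) \<partial>PZ)
       = (\<integral>\<^sup>+w. E (fst w, noised d a v (fst w) (snd w)) \<partial>PZ)"
    proof (intro nn_integral_cong)
      fix w assume "w \<in> space PZ"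
      then have y: "fst w \<in> Rd d" by (auto simp: space_pair_measure)
      let ?x = "noised d a v (fst w) (snd w)"
      have "g (fst w) > 0" "G ?x > 0" "p (fst w) > 0" "r ?x > 0"
        using gb[OF y] Gb[of ?x] a pos[OF y] R.pos[of ?x] by auto
      moreover have "l w = ln (p (fst w)) + ln (gauss_dens d (\<lambda>i. a * fst w i) v ?x) - ln (gauss_dens d (m ?x) h (fst w)) - ln (r ?x)"
        using l[of "fst w" "snd w"] by simp
      ultimately show "ennreal (exp (ln (g (fst w)) - l w - ln (G ?x))) = E (fst w, ?x)"
        using gauss_dens_pos[OF v] gauss_dens_pos[OF h]
        by (simp add: E_def joint_def exp_diff exp_add exp_ln)
    qed
    also have "\<dots> = (\<integral>\<^sup>+w. ennreal (joint a v w) * E w \<partial>(lebd d \<Otimes>\<^sub>M lebd d))"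
      by (subst nn_integral_distr[OF T, symmetric], simp, subst joint_eq_distr[OF v, symmetric],
          subst nn_integral_density) auto
    also have "\<dots> = (\<integral>\<^sup>+w. ennreal (r (snd w) / G (snd w)) * (ennreal (gauss_dens d (m (snd w)) h (fst w)) * ennreal (g (fst w))) \<partial>(lebd d \<Otimes>\<^sub>M lebd d))"
    proof (intro nn_integral_cong)
      fix w assume w: "w \<in> space (lebd d \<Otimes>\<^sub>M lebd d)"
      then have "r (snd w) > 0" "g (fst w) > 0" "G (snd w) > 0"
        using R.pos gb[of "fst w"] Gb[of "snd w"] a by (auto simp: space_pair_measure)
      moreover have "joint a v w > 0" by (rule joint_pos[OF v w])
      ultimately show "ennreal (joint a v w) * E w = ennreal (r (snd w) / G (snd w)) * (ennreal (gauss_dens d (m (snd w)) h (fst w)) * ennreal (g (fst w)))"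
        by (simp add: E_def ennreal_mult[symmetric] field_simps)
    qed
    also have "\<dots> = (\<integral>\<^sup>+x. \<integral>\<^sup>+y. ennreal (r x / G x) * (ennreal (gauss_dens d (m x) h y) * ennreal (g y)) \<partial>lebd d \<partial>lebd d)"
      by (subst lebd2.nn_integral_snd[symmetric]) (auto intro!: borel_measurable_times_ennreal)
    also have "\<dots> = (\<integral>\<^sup>+x. ennreal (r x / G x) * ennreal (G x) \<partial>lebd d)"
      unfolding G_def test_fun_integral(5)[OF g prob_space_gauss[OF h] sets_gauss]
      by (intro nn_integral_cong) (simp add: nn_integral_cmult nn_integral_gauss)
    also have "\<dots> = (\<integral>\<^sup>+x. ennreal (r x) \<partial>lebd d)"
    proof (intro nn_integral_cong)
      fix x assume "x \<in> space (lebd d)"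
      then show "ennreal (r x / G x) * ennreal (G x) = ennreal (r x)"
        using R.pos[of x] Gb[of x] a by (simp add: ennreal_mult[symmetric])
    qed
    finally show "(\<integral>\<^sup>+w. ennreal (exp (ln (g (fst w)) - l w - ln (G (noised d a v (fst w) (snd w))))) \<partial>PZ) \<le> 1"
      by (simp add: R.mass)
  qed
  also have "(\<integral>w. ln (g (fst w)) - l w - ln (G (noised d a v (fst w) (snd w))) \<partial>PZ)
     = (\<integral>w. ln (g (fst w)) \<partial>PZ) - (\<integral>w. l w \<partial>PZ)
       - (\<integral>w. ln (G (noised d a v (fst w) (snd w))) \<partial>PZ)"
    using ig int iG by simp
  also have "(\<integral>w. ln (G (noised d a v (fst w) (snd w))) \<partial>PZ) = (\<integral>x. ln (G x) \<partial>?Q)"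
    by (rule blur_integral(2)[OF v]) measurable
  also have "(\<integral>w. ln (g (fst w)) \<partial>PZ) = (\<integral>y. ln (g y) \<partial>P)"
    using test_fun_integral(2)[OF g prob_space_P sets_P] by (rule PN.integrable_fst_only(2))
  finally have "(\<integral>y. ln (g y) \<partial>P) \<le> (\<integral>x. ln (G x) \<partial>?Q) + (\<integral>w. l w \<partial>PZ)" by simp
  also have "(\<integral>x. ln (G x) \<partial>?Q) \<le> ln (\<integral>x. G x \<partial>\<mu>) + D"
    using kl Gt unfolding kl_le_def by blast
  also have "(\<integral>x. G x \<partial>\<mu>) = (\<integral>x. g x \<partial>(\<mu> \<bind> (\<lambda>x. gauss d (m x) h)))"
    unfolding G_def by (rule integral_bind_gauss(3)[OF g mu m h, symmetric])
  finally show "(\<integral>x. ln (g x) \<partial>P) \<le> ln (\<integral>x. g x \<partial>(\<mu> \<bind> (\<lambda>x. gauss d (m x) h))) + (D + (\<integral>w. l w \<partial>PZ))"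
    by simp
qed

end

subsection \<open>One step of the reverse chain\<close>

lemma exp_minus_le_quadratic:
  fixes h :: real assumes "h \<ge> 0" shows "exp (- h) \<le> 1 - h + h^2 / 2"
proof -
  have 1: "1 + h + h^2 / 2 \<le> exp h" by (rule exp_lower_Taylor_quadratic[OF assms])
  \<comment> \<open>The two quadratic Taylor polynomials multiply to 1 + h^4 / 4, so a lower bound
    for exp h becomes an upper bound for exp (- h).\<close>
  have "(1 - h + h^2 / 2) * (1 + h + h^2 / 2) = 1 + h^4 / 4" by (simp add: power2_eq_square power4_eq_xxxx algebra_simps)
  moreover have "(1 - h + h^2 / 2) * (1 + h + h^2 / 2) \<le> (1 - h + h^2 / 2) * exp h"
  proof (intro mult_left_mono 1)
    have "1 - h + h^2 / 2 = ((1 - h)^2 + 1) / 2" by (simp add: power2_eq_square field_simps)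
    moreover have "((1 - h)^2 + 1) / 2 \<ge> 0" by (simp add: add_nonneg_nonneg)
    ultimately show "0 \<le> 1 - h + h^2 / 2" by (simp only:)
  qed
  ultimately have "1 \<le> (1 - h + h^2 / 2) * exp h" by (simp add: zero_le_even_power' order_trans[of 1 "1 + h^4 / 4"])
  then show ?thesis by (simp add: exp_minus field_simps)
qed

lemma exp_minus_ge_cubic:
  fixes h :: real assumes "h \<ge> 0" shows "1 - h + h^2 / 2 - h^3 / 6 \<le> exp (- h)"
proof -
  have "((\<lambda>h. exp (- h) - (1 - h + h^2 / 2 - h^3 / 6)) has_real_derivative (1 - x + x^2 / 2) - exp (- x)) (at x)" for x :: real
    by (auto intro!: derivative_eq_intros simp: field_simps)
  then have "exp (- 0) - (1 - 0 + 0^2 / 2 - 0^3 / 6) \<le> exp (- h) - (1 - h + h^2 / 2 - h^3 / 6)"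
    using exp_minus_le_quadratic assms
    by (intro DERIV_nonneg_imp_nondecreasing[where f="\<lambda>h. exp (- h) - (1 - h + h^2 / 2 - h^3 / 6)"]) force+
  then show ?thesis by simp
qed

context
  fixes h a v :: real
  assumes h: "0 < h" "h \<le> 1"
  defines "a \<equiv> exp (- h / 2)" and "v \<equiv> 1 - exp (- h)"
begin

lemma step_v_pos: "v > 0" "v / a^2 = exp h - 1"
  using h by (simp_all add: v_def a_def exp_minus field_simps power2_eq_square exp_add[symmetric])

lemma step_var_le: "v / a^2 \<le> h + h^2"
  using exp_bound[of h] h unfolding step_v_pos(2) by simp

lemma step_inv_a: "0 \<le> 1 / a - (1 + h / 2)" "1 / a - (1 + h / 2) \<le> h^2"
proof -
  have e: "1 / a = exp (h / 2)" by (simp add: a_def exp_minus field_simps)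
  show "0 \<le> 1 / a - (1 + h / 2)" using exp_ge_add_one_self[of "h / 2"] by (simp add: e)
  have "exp (h / 2) \<le> 1 + h / 2 + (h / 2)^2" using h by (intro exp_bound) auto
  also have "(h / 2)^2 \<le> h^2" using h by (intro power_mono) auto
  finally show "1 / a - (1 + h / 2) \<le> h^2" by (simp add: e)
qed

text \<open>1 + h / 2 is the Euler approximation of 1 / a, so 1 - a (1 + h / 2) is of order h^2 and
  its square survives the division by the kernel variance.\<close>

lemma step_contraction: "(1 - a * (1 + h / 2))^2 / (2 * h) \<le> h^2"
proof -
  have a_eq: "a = exp (- (h / 2))" by (simp add: a_def)
  have "(1 - h / 2) * (1 + h / 2) \<le> a * (1 + h / 2)"
    using exp_ge_add_one_self[of "- (h / 2)"] h unfolding a_eq by (intro mult_right_mono) auto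
  then have 1: "1 - a * (1 + h / 2) \<le> h^2 / 4" by (simp add: power2_eq_square field_simps)
  have "a * (1 + h / 2) \<le> a * exp (h / 2)" using exp_ge_add_one_self[of "h / 2"] by (intro mult_left_mono) (auto simp: a_eq)
  also have "\<dots> = 1" by (simp add: a_eq exp_add[symmetric])
  finally have 0: "0 \<le> 1 - a * (1 + h / 2)" by simp
  have "(1 - a * (1 + h / 2))^2 \<le> (h^2 / 4)^2" using 0 1 by (rule power_mono[rotated])
  also have "\<dots> \<le> h^2 * (2 * h)"
  proof -
    have "(h^2 / 4)^2 = h^3 * (h / 16)" by (simp add: power2_eq_square power3_eq_cube field_simps)
    also have "\<dots> \<le> h^3 * 2" using h by (intro mult_left_mono) auto
    finally show ?thesis by (simp add: power2_eq_square power3_eq_cube)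
  qed
  finally show ?thesis using h by (simp add: field_simps)
qed

text \<open>v / a equals 2 sinh (h / 2), whose expansion starts with h and has no quadratic term;
  quadratic bounds for the two exponentials suffice.\<close>

lemma step_drift: "\<bar>h - v / a\<bar> \<le> h^2"
proof -
  have "v / a = exp (h / 2) - exp (- (h / 2))"
    by (simp add: v_def a_def exp_minus field_simps exp_add[symmetric])
  moreover have "exp (h / 2) \<le> 1 + h / 2 + (h / 2)^2" using h by (intro exp_bound) auto
  moreover have "1 + h / 2 \<le> exp (h / 2)" "1 - h / 2 \<le> exp (- (h / 2))"
    using exp_ge_add_one_self[of "h / 2"] exp_ge_add_one_self[of "- (h / 2)"] by auto
  moreover have "exp (- (h / 2)) \<le> 1 - h / 2 + (h / 2)^2 / 2" using h by (intro exp_minus_le_quadratic) auto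
  moreover have "(h / 2)^2 = h^2 / 4" by (simp add: power2_eq_square)
  moreover have "h^2 \<ge> 0" by simp
  ultimately show ?thesis by (simp only: abs_le_iff) linarith
qed

text \<open>These are the terms of a step proportional to the dimension: the Jacobian of the
  rescaling, the two Gaussian normalising constants, the noise energy and the noise part of the
  kernel residual. Both ln h - ln v and (1 + h / 2)^2 v / h - 1 are h / 2 to first order, so
  together they cancel the leading - h / 2; seeing this takes an upper bound for v with its cubic
  term.\<close>

lemma step_normaliser: "- h / 2 + (ln h - ln v - 1 + (1 + h / 2)^2 * v / h) / 2 \<le> h^2"
proof -
  have v1: "h - h^2 / 2 \<le> v" using exp_minus_le_quadratic[of h] h by (simp add: v_def)
  have v2: "v \<le> h - h^2 / 2 + h^3 / 6" using exp_minus_ge_cubic[of h] h by (simp add: v_def)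
  have pos: "h - h^2 / 2 > 0" using h by (simp add: power2_eq_square field_simps)
  have "ln h - ln v = ln (h / v)" using h step_v_pos by (simp add: ln_div)
  also have "\<dots> \<le> h / v - 1" using h step_v_pos by (intro ln_le_minus_one) auto
  also have "h / v \<le> h / (h - h^2 / 2)" using v1 pos h step_v_pos by (intro divide_left_mono) auto
  also have "h / (h - h^2 / 2) \<le> 1 + h / 2 + h^2 / 2"
  proof -
    have "(1 + h / 2 + h^2 / 2) * (h - h^2 / 2) = h + (h^3 / 4) * (1 - h)"
      by (simp add: power2_eq_square power3_eq_cube field_simps)
    moreover have "(h^3 / 4) * (1 - h) \<ge> 0" using h by simp
    ultimately show ?thesis using pos by (simp add: divide_le_eq)
  qed
  finally have 1: "ln h - ln v \<le> h / 2 + h^2 / 2" by simp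
  have "(1 + h / 2)^2 * v / h \<le> (1 + h / 2)^2 * (h - h^2 / 2 + h^3 / 6) / h"
    using v2 h by (intro divide_right_mono mult_left_mono) auto
  also have "\<dots> = (1 + h / 2)^2 * (1 - h / 2 + h^2 / 6)"
    using h by (simp add: field_simps power2_eq_square power3_eq_cube)
  also have "\<dots> = 1 + h / 2 + h^2 / 24 * (- 2 + h + h^2)"
    by (simp add: field_simps power2_eq_square)
  also have "\<dots> \<le> 1 + h / 2"
  proof -
    have "h^2 \<le> 1" using h by (simp add: power_le_one)
    then have "h^2 / 24 * (- 2 + h + h^2) \<le> 0" using h by (intro mult_nonneg_nonpos) auto
    then show ?thesis by simp
  qed
  finally have 2: "(1 + h / 2)^2 * v / h \<le> 1 + h / 2" .
  have "- h / 2 + (X - 1 + Y) / 2 \<le> q" if "X \<le> h / 2 + q / 2" "Y \<le> 1 + h / 2" "q \<ge> 0" for X Y q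
    using that by argo
  from this[OF 1 2] show ?thesis by simp
qed

text \<open>The weight in \<open>entropy_step\<close> is set to sqrt h. Since c^2 = v / a^2 is h up
  to order h^2, the excess of the leading coefficient and the term with c^4 / sqrt h are then both
  of order h^(3/2).\<close>

lemma step_entropy_coeffs:
  assumes "I \<ge> 0" "M \<ge> 0"
  shows "((1 + sqrt h) * (sqrt v / a)^2 * I + (1 + 1 / sqrt h) * W * (sqrt v / a)^4 * M) / 2
     \<le> h / 2 * I + h * sqrt h * (2 * I + 4 * \<bar>W\<bar> * M)"
proof -
  define s where "s = sqrt h"
  have s: "0 < s" "s \<le> 1" "s^2 = h" using h by (auto simp: s_def)
  have c2: "(sqrt v / a)^2 = v / a^2" using step_v_pos(1) by (simp only: power_divide) simp
  have c2n: "0 \<le> v / a^2" using step_v_pos(1) by (intro divide_nonneg_nonneg) auto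
  have hs: "h \<le> s" using s by (metis mult_left_le power2_eq_square less_imp_le)
  have c2s: "v / a^2 \<le> 2 * h" using step_var_le h by (simp add: power2_eq_square) (smt (verit) mult_left_le)
  have "(1 + s) * (v / a^2) \<le> (1 + s) * (h + h^2)" using s step_var_le by (intro mult_left_mono) auto
  also have "\<dots> = h * (1 + s + h + s * h)" by (simp add: power2_eq_square algebra_simps)
  also have "\<dots> \<le> h * (1 + s + s + s)"
  proof -
    have "s * h \<le> s" using s h by (simp add: mult_left_le)
    then show ?thesis using h hs by (intro mult_left_mono) linarith+
  qed
  also have "\<dots> \<le> h * (1 + 4 * s)" using s h by (intro mult_left_mono) auto
  finally have 1: "(1 + s) * (v / a^2) * I \<le> h * (1 + 4 * s) * I" using assms by (intro mult_right_mono)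
  have "(v / a^2)^2 \<le> (2 * h)^2" using c2n c2s by (intro power_mono)
  then have "(1 + 1 / s) * (v / a^2)^2 \<le> (2 / s) * (2 * h)^2"
    using s by (intro mult_mono) (auto simp: field_simps)
  also have "\<dots> = 8 * (h * s)"
  proof -
    have "h^2 = h * s * s" using s by (simp add: power2_eq_square)
    then show ?thesis using s by (simp add: power_mult_distrib)
  qed
  finally have "(1 + 1 / s) * (v / a^2)^2 * (\<bar>W\<bar> * M) \<le> 8 * (h * s) * (\<bar>W\<bar> * M)" using assms by (intro mult_right_mono) auto
  moreover have "(1 + 1 / s) * (v / a^2)^2 * (W * M) \<le> (1 + 1 / s) * (v / a^2)^2 * (\<bar>W\<bar> * M)"
    using s assms by (intro mult_left_mono mult_right_mono) auto
  moreover have "(sqrt v / a)^4 = (v / a^2)^2" unfolding c2[symmetric] by simp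
  ultimately show ?thesis using 1 unfolding c2 s_def[symmetric]
    by (simp add: algebra_simps)
qed

end

section \<open>The comparison density and the expected log ratio of a step\<close>

context score_dens begin

text \<open>This is the density of a Y when Y has density \<open>p\<close>. As comparison density it
  turns ln r of the noised variable into ln p at y + (sqrt v / a) z plus the constant d h / 2, so
  that the cross entropy is controlled by \<open>entropy_step\<close>.\<close>

lemma pos_dens_rescaled:
  assumes a: "a > 0"
  shows "pos_dens d (\<lambda>x. (1 / a) ^ d * p (\<lambda>i\<in>{..<d}. x i / a))"
proof
  have T: "(\<lambda>x. \<lambda>i\<in>{..<d}. x i / a) \<in> lebd d \<rightarrow>\<^sub>M lebd d" by measurable
  show m: "(\<lambda>x. (1 / a) ^ d * p (\<lambda>i\<in>{..<d}. x i / a)) \<in> borel_measurable (lebd d)"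
    using measurable_compose[OF T meas] by measurable
  show "0 < (1 / a) ^ d * p (\<lambda>i\<in>{..<d}. x i / a)" for x using a by (intro mult_pos_pos pos) auto
  have "(\<integral>\<^sup>+x. ennreal (p x) \<partial>lebd d) = ennreal (\<bar>1 / a\<bar> ^ d) * (\<integral>\<^sup>+x. ennreal (p (\<lambda>i\<in>{..<d}. 0 + 1 / a * x i)) \<partial>lebd d)"
    using a by (intro nn_integral_lebd_affine[of "1 / a" _ d "\<lambda>_. 0"]) auto
  also have "\<dots> = (\<integral>\<^sup>+x. ennreal ((1 / a) ^ d) * ennreal (p (\<lambda>i\<in>{..<d}. x i / a)) \<partial>lebd d)"
    using a measurable_compose[OF T meas] by (subst nn_integral_cmult) auto
  finally show "(\<integral>\<^sup>+x. ennreal ((1 / a) ^ d * p (\<lambda>i\<in>{..<d}. x i / a)) \<partial>lebd d) = 1"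
    using a by (simp add: mass ennreal_mult')
qed

end

lemma kl_le_mono: "kl_le d \<mu> \<nu> D \<Longrightarrow> D \<le> D' \<Longrightarrow> kl_le d \<mu> \<nu> D'"
  unfolding kl_le_def by (meson add_left_mono order_trans)

lemma abs_integral_mult_le:
  fixes f g :: "'a \<Rightarrow> real"
  assumes [measurable]: "f \<in> borel_measurable M" "g \<in> borel_measurable M"
    and f: "integrable M (\<lambda>x. f x ^ 2)" and g: "integrable M (\<lambda>x. g x ^ 2)"
  shows "\<bar>\<integral>x. f x * g x \<partial>M\<bar> \<le> ((\<integral>x. f x ^ 2 \<partial>M) + (\<integral>x. g x ^ 2 \<partial>M)) / 2"
proof -
  have fg: "integrable M (\<lambda>x. f x * g x)" by (rule integrable_mult_of_squares[OF assms])
  have "\<bar>\<integral>x. f x * g x \<partial>M\<bar> \<le> (\<integral>x. \<bar>f x * g x\<bar> \<partial>M)" by (rule integral_abs_bound)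
  also have "\<dots> \<le> (\<integral>x. (f x ^ 2 + g x ^ 2) / 2 \<partial>M)"
  proof (rule integral_mono)
    fix x show "\<bar>f x * g x\<bar> \<le> (f x ^ 2 + g x ^ 2) / 2"
      using sum_squares_bound[of "\<bar>f x\<bar>" "\<bar>g x\<bar>"] by (simp add: abs_mult)
  qed (use f g fg in auto)
  also have "\<dots> = ((\<integral>x. f x ^ 2 \<partial>M) + (\<integral>x. g x ^ 2 \<partial>M)) / 2" using f g by simp
  finally show ?thesis .
qed

context pos_dens begin

lemma pair_moments:
  assumes i: "i < d" and sm: "integrable P (\<lambda>x. (x i)^2)"
  shows "integrable PZ (\<lambda>w. (fst w i)^2)"
    "(\<integral>w. (fst w i)^2 \<partial>PZ) = (\<integral>y. (y i)^2 \<partial>P)"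
    "integrable PZ (\<lambda>w. (snd w i)^2)"
    "(\<integral>w. (snd w i)^2 \<partial>PZ) = 1"
    "integrable PZ (\<lambda>w. fst w i * snd w i)"
    "(\<integral>w. fst w i * snd w i \<partial>PZ) = 0"
proof -
  show "integrable PZ (\<lambda>w. (fst w i)^2)"
    "(\<integral>w. (fst w i)^2 \<partial>PZ) = (\<integral>y. (y i)^2 \<partial>P)"
    using PN.integrable_fst_only[OF sm] by auto
  show "integrable PZ (\<lambda>w. (snd w i)^2)"
    "(\<integral>w. (snd w i)^2 \<partial>PZ) = 1"
    using PN.integrable_snd_only[OF integrable_std_gauss_power[OF i, of 2]] std_gauss_second[OF i] by auto
  have y: "integrable P (\<lambda>y. y i)"
    using integrable_mult_of_squares[of "\<lambda>y. y i" P "\<lambda>_. 1"] sm i by simp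
  have z: "integrable (std_gauss d) (\<lambda>z. z i)" using integrable_std_gauss_power[OF i, of 1] by simp
  show "integrable PZ (\<lambda>w. fst w i * snd w i)"
    "(\<integral>w. fst w i * snd w i \<partial>PZ) = 0"
    using PN.integrable_prod_fst_snd[OF y z] std_gauss_mean[OF i] by auto
qed

lemma blur_second_moment:
  assumes v: "v > 0" and i: "i < d" and sm: "integrable P (\<lambda>x. (x i)^2)"
  shows "integrable (density (lebd d) (\<lambda>x. ennreal (blur d a v p x))) (\<lambda>x. (x i)^2)"
    and "(\<integral>x. (x i)^2 \<partial>density (lebd d) (\<lambda>x. ennreal (blur d a v p x))) = a^2 * (\<integral>y. (y i)^2 \<partial>P) + v"
proof -
  note m = pair_moments[OF i sm]
  have F: "(\<lambda>x. (x i)^2) \<in> borel_measurable (lebd d)" using i by measurable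
  have eq: "(noised d a v (fst w) (snd w) i)^2 = a^2 * (fst w i)^2 + 2 * a * sqrt v * (fst w i * snd w i) + v * (snd w i)^2" for w
    using v i by (simp add: power2_sum power_mult_distrib)
  show "integrable (density (lebd d) (\<lambda>x. ennreal (blur d a v p x))) (\<lambda>x. (x i)^2)"
    unfolding blur_integral(1)[OF v F, symmetric] eq using m
    by (intro Bochner_Integration.integrable_add integrable_mult_right) auto
  show "(\<integral>x. (x i)^2 \<partial>density (lebd d) (\<lambda>x. ennreal (blur d a v p x))) = a^2 * (\<integral>y. (y i)^2 \<partial>P) + v"
    unfolding blur_integral(2)[OF v F, symmetric] eq using m
    by (subst Bochner_Integration.integral_add, simp, simp, subst Bochner_Integration.integral_add) auto
qed

end

context score_dens begin

lemma fisher_eq: "fisher = (\<Sum>i<d. \<integral>x. (f x i)^2 \<partial>P)"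
  unfolding fisher_def by (intro Bochner_Integration.integral_sum integrable_score_sq) simp

lemma fisher_nonneg: "fisher \<ge> 0"
  unfolding fisher_def by (intro integral_nonneg_AE AE_I2 sum_nonneg) simp

context
  fixes h a v :: real
    and f' S :: "(nat \<Rightarrow> real) \<Rightarrow> nat \<Rightarrow> real" and Q :: "(nat \<Rightarrow> real) measure"
  assumes h: "0 < h" "h \<le> 1"
    and a_def: "a = exp (- h / 2)" and v_def: "v = 1 - exp (- h)"
    and Q_def: "Q = density (lebd d) (\<lambda>x. ennreal (blur d a v p x))"
    and grad': "has_grad d (\<lambda>x. ln (blur d a v p x)) f'"
    and fm [measurable]: "\<And>i. i < d \<Longrightarrow> (\<lambda>x. f' x i) \<in> borel_measurable (lebd d)"
    and Sm [measurable]: "\<And>i. i < d \<Longrightarrow> (\<lambda>x. S x i) \<in> borel_measurable (lebd d)"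
    and fi: "\<And>i. i < d \<Longrightarrow> integrable Q (\<lambda>x. (f' x i)^2)"
    and Si: "\<And>i. i < d \<Longrightarrow> integrable Q (\<lambda>x. (S x i)^2)"
begin

lemma v_pos: "v > 0" and a_pos: "a > 0"
  using h by (auto simp: v_def a_def)

lemma sets_Q [measurable_cong]: "sets Q = sets (lebd d)"
  by (simp add: Q_def)

abbreviation "X w \<equiv> noised d a v (fst w) (snd w)"

lemma X_measurable [measurable]: "X \<in> PZ \<rightarrow>\<^sub>M lebd d"
  by measurable

lemma integral_X:
  fixes F :: "_ \<Rightarrow> real"
  assumes "F \<in> borel_measurable (lebd d)"
  shows "integrable PZ (\<lambda>w. F (X w)) \<longleftrightarrow> integrable Q F" "(\<integral>w. F (X w) \<partial>PZ) = (\<integral>x. F x \<partial>Q)"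
  using blur_integral[OF v_pos assms] by (simp_all add: Q_def)

lemma noised_second_moment: "i < d \<Longrightarrow> integrable Q (\<lambda>x. (x i)^2)"
  unfolding Q_def using blur_second_moment(1)[OF v_pos _ second_moment] by simp

lemmas moments = pair_moments[OF _ second_moment]

text \<open>The residual without the estimated score is written in two ways. Its square is expanded
  in variable and noise, which are independent; its product with the estimated score is expanded in
  noised variable and noise, so that Tweedie's formula can replace the noise by the true
  score.\<close>

lemma kernel_error:
  assumes i: "i < d"
  shows "integrable PZ (\<lambda>w. (fst w i - (X w i + h * (X w i / 2 + S (X w) i)))^2)"
    and "(\<integral>w. (fst w i - (X w i + h * (X w i / 2 + S (X w) i)))^2 \<partial>PZ)
      = (1 - a * (1 + h / 2))^2 * (\<integral>y. (y i)^2 \<partial>P) + (1 + h / 2)^2 * v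
        - 2 * h * (1 / a - (1 + h / 2)) * (\<integral>x. x i * S x i \<partial>Q)
        - 2 * h * (v / a) * (\<integral>x. f' x i * S x i \<partial>Q) + h^2 * (\<integral>x. (S x i)^2 \<partial>Q)"
proof -
  define b where "b = 1 + h / 2"
  note [measurable] = i
  have sv: "(sqrt v)^2 = v" using v_pos by simp
  have sq: "y + 2 * h * (sqrt v / a) * (- sqrt v * F) = y - 2 * h * (v / a) * F" for y F
    using v_pos by simp
  have Sc [measurable]: "(\<lambda>w. S (X w) i) \<in> borel_measurable PZ"
    using measurable_compose[OF X_measurable Sm[OF i]] by simp
  have iS: "integrable PZ (\<lambda>w. (S (X w) i)^2)" using integral_X(1)[of "\<lambda>x. (S x i)^2"] Si[OF i] i by simp
  have iX: "integrable PZ (\<lambda>w. X w i * S (X w) i)"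
    using integral_X(1)[of "\<lambda>x. x i * S x i"] integrable_mult_of_squares[of "\<lambda>x. x i" Q "\<lambda>x. S x i"]
      noised_second_moment[OF i] Si[OF i] i by simp
  have iz: "integrable PZ (\<lambda>w. snd w i * S (X w) i)"
    using moments(3)[OF i i] iS by (intro integrable_mult_of_squares) auto
  have tw: "(\<integral>w. snd w i * S (X w) i \<partial>PZ) = - sqrt v * (\<integral>x. f' x i * S x i \<partial>Q)"
    unfolding Q_def by (rule tweedie_integral[OF v_pos i grad' Sm[OF i] fm[OF i] iz])
  have eq: "(fst w i - (X w i + h * (X w i / 2 + S (X w) i)))^2
     = (1 - a * b)^2 * (fst w i)^2 + b^2 * v * (snd w i)^2 - 2 * (1 - a * b) * b * sqrt v * (fst w i * snd w i)
       - 2 * h * (1 / a - b) * (X w i * S (X w) i) + 2 * h * (sqrt v / a) * (snd w i * S (X w) i)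
       + h^2 * (S (X w) i)^2" for w
  proof -
    define y z s x A where "y = fst w i" and "z = snd w i" and "s = S (X w) i" and "x = X w i" and "A = y - b * x"
    have x: "x = a * y + sqrt v * z" using i by (simp add: x_def y_def z_def)
    have A1: "A = (1 - a * b) * y - b * sqrt v * z" by (simp add: A_def x algebra_simps)
    have A2: "A = (1 / a - b) * x - (sqrt v / a) * z"
      using a_pos by (simp add: A_def x field_simps)
    have "(y - (x + h * (x / 2 + s)))^2 = (A - h * s)^2"
      by (simp add: A_def b_def algebra_simps)
    also have "\<dots> = A^2 - 2 * h * (A * s) + h^2 * s^2" by (simp add: power2_eq_square algebra_simps)
    also have "A^2 = (1 - a * b)^2 * y^2 + b^2 * (sqrt v)^2 * z^2 - 2 * (1 - a * b) * b * sqrt v * (y * z)"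
      unfolding A1 power2_diff power_mult_distrib by (simp add: mult_ac)
    also have "A * s = (1 / a - b) * (x * s) - (sqrt v / a) * (z * s)"
      unfolding A2 by (simp add: left_diff_distrib mult.assoc)
    finally have "(y - (x + h * (x / 2 + s)))^2 = (1 - a * b)^2 * y^2 + b^2 * v * z^2 - 2 * (1 - a * b) * b * sqrt v * (y * z)
       - 2 * h * (1 / a - b) * (x * s) + 2 * h * (sqrt v / a) * (z * s) + h^2 * s^2"
      unfolding sv by (simp add: right_diff_distrib mult.assoc)
    then show ?thesis unfolding y_def z_def s_def x_def .
  qed
  note ints = moments[OF i i] iS iX iz
  show "integrable PZ (\<lambda>w. (fst w i - (X w i + h * (X w i / 2 + S (X w) i)))^2)"
    unfolding eq using ints
    by (intro Bochner_Integration.integrable_add Bochner_Integration.integrable_diff integrable_mult_right) auto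
  have "(\<integral>w. (fst w i - (X w i + h * (X w i / 2 + S (X w) i)))^2 \<partial>PZ)
     = (1 - a * b)^2 * (\<integral>w. (fst w i)^2 \<partial>PZ) + b^2 * v * (\<integral>w. (snd w i)^2 \<partial>PZ) - 2 * (1 - a * b) * b * sqrt v * (\<integral>w. fst w i * snd w i \<partial>PZ)
       - 2 * h * (1 / a - b) * (\<integral>w. X w i * S (X w) i \<partial>PZ) + 2 * h * (sqrt v / a) * (\<integral>w. snd w i * S (X w) i \<partial>PZ)
       + h^2 * (\<integral>w. (S (X w) i)^2 \<partial>PZ)"
    unfolding eq using ints
    by (simp only: Bochner_Integration.integral_add Bochner_Integration.integral_diff Bochner_Integration.integrable_add
        Bochner_Integration.integrable_diff integrable_mult_right integral_mult_right_zero)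
  also have "(\<integral>w. X w i * S (X w) i \<partial>PZ) = (\<integral>x. x i * S x i \<partial>Q)"
    using integral_X(2)[of "\<lambda>x. x i * S x i"] i by simp
  also have "(\<integral>w. (S (X w) i)^2 \<partial>PZ) = (\<integral>x. (S x i)^2 \<partial>Q)"
    using integral_X(2)[of "\<lambda>x. (S x i)^2"] i by simp
  finally show "(\<integral>w. (fst w i - (X w i + h * (X w i / 2 + S (X w) i)))^2 \<partial>PZ)
      = (1 - a * (1 + h / 2))^2 * (\<integral>y. (y i)^2 \<partial>P) + (1 + h / 2)^2 * v
        - 2 * h * (1 / a - (1 + h / 2)) * (\<integral>x. x i * S x i \<partial>Q)
        - 2 * h * (v / a) * (\<integral>x. f' x i * S x i \<partial>Q) + h^2 * (\<integral>x. (S x i)^2 \<partial>Q)"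
    unfolding tw moments[OF i i] b_def[symmetric] sq mult_1_right mult_zero_right diff_zero .
qed

text \<open>The log ratio splits into an increment of ln p, bounded by \<open>entropy_step\<close>,
  Gaussian constants, bounded by \<open>step_normaliser\<close>, and the residual of
  \<open>kernel_error\<close>. In the residual, the cross term with the true score and the square of
  the estimated score complete to the score error once the later Fisher information is added;
  subtracting it again produces the telescoping difference.\<close>

lemma reverse_step:
  assumes mu: "prob_space \<mu>" "sets \<mu> = sets (lebd d)" and kl: "kl_le d Q \<mu> D"
    and B: "(\<Sum>i<d. \<integral>y. (y i)^2 \<partial>P) \<le> B" "fisher \<le> B" "(\<Sum>i<d. \<integral>x. (x i)^2 \<partial>Q) \<le> B"
      "(\<Sum>i<d. \<integral>x. (f' x i)^2 \<partial>Q) \<le> B" "(\<Sum>i<d. \<integral>x. (S x i)^2 \<partial>Q) \<le> B"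
    and E: "(\<Sum>i<d. \<integral>x. (S x i - f' x i)^2 \<partial>Q) \<le> E"
  shows "kl_le d P (\<mu> \<bind> (\<lambda>x. gauss d (\<lambda>i. x i + h * (x i / 2 + S x i)) h))
    (D + (h / 2 * (fisher - (\<Sum>i<d. \<integral>x. (f' x i)^2 \<partial>Q)) + h / 2 * E
      + h * sqrt h * (5 * B + 4 * (d * L)^2 * (\<integral>z. (\<Sum>i<d. (z i)^2)^2 \<partial>std_gauss d) + d)))"
proof -
  define m where "m x = (\<lambda>i. x i + h * (x i / 2 + S x i))" for x
  define r where "r x = (1 / a) ^ d * p (\<lambda>i\<in>{..<d}. x i / a)" for x
  define l where "l w = ln (p (fst w)) + ln (gauss_dens d (\<lambda>i. a * fst w i) v (X w))
       - ln (gauss_dens d (m (X w)) h (fst w)) - ln (r (X w))" for w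
  define e where "e w = u (fst w) - u (\<lambda>i\<in>{..<d}. fst w i + (sqrt v / a) * snd w i)" for w
  define T where "T i w = (fst w i - (X w i + h * (X w i / 2 + S (X w) i)))^2" for i w
  define M4 where "M4 = (\<integral>z. (\<Sum>i<d. (z i)^2)^2 \<partial>std_gauss d)"
  have m: "(\<lambda>x. m x i) \<in> borel_measurable (lebd d)" if "i < d" for i
    using that unfolding m_def by measurable
  have l_eq: "l w = e w - (d * h / 2 + d / 2 * (ln v - ln h)) - (\<Sum>i<d. (snd w i)^2) / 2 + (\<Sum>i<d. T i w) / (2 * h)" for w
  proof -
    have 1: "(\<lambda>i\<in>{..<d}. X w i / a) = (\<lambda>i\<in>{..<d}. fst w i + (sqrt v / a) * snd w i)"
      using a_pos by (intro restrict_ext) (simp add: field_simps)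
    have 2: "ln (r (X w)) = d * (h / 2) + u (\<lambda>i\<in>{..<d}. X w i / a)"
    proof -
      have "p (\<lambda>i\<in>{..<d}. X w i / a) > 0" by (intro pos restrict_in_Rd)
      moreover have "ln (1 / a) = h / 2" by (simp add: a_def ln_div)
      ultimately show ?thesis using a_pos unfolding r_def u_def by (subst ln_mult) (auto simp: ln_realpow)
    qed
    have 3: "ln (gauss_dens d (\<lambda>i. a * fst w i) v (X w)) = - (d / 2) * ln (2 * pi * v) - (\<Sum>i<d. (snd w i)^2) / 2"
    proof -
      have "(\<Sum>i<d. (X w i - a * fst w i)^2) = v * (\<Sum>i<d. (snd w i)^2)"
        using v_pos by (simp add: sum_distrib_left power_mult_distrib)
      then show ?thesis using v_pos by (simp only: ln_gauss_dens) simp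
    qed
    have 4: "ln (gauss_dens d (m (X w)) h (fst w)) = - (d / 2) * ln (2 * pi * h) - (\<Sum>i<d. T i w) / (2 * h)"
      using h by (simp only: ln_gauss_dens T_def m_def)
    have 5: "ln (2 * pi * v) = ln (2 * pi) + ln v" "ln (2 * pi * h) = ln (2 * pi) + ln h"
      using v_pos h by (simp_all add: ln_mult)
    show ?thesis
      unfolding l_def e_def 3 4 5 2 1 u_def[symmetric] by argo
  qed
  have ie: "integrable PZ e"
    using integrable_minus[OF integrable_u_shift[of "sqrt v / a"]] by (simp add: e_def[abs_def])
  have iz: "integrable PZ (\<lambda>w. \<Sum>i<d. (snd w i)^2)"
    using moments(3) by (intro Bochner_Integration.integrable_sum) auto
  have iT1: "integrable PZ (T i)" if "i < d" for i
    using kernel_error(1)[OF that] by (simp add: T_def[abs_def])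
  then have iT: "integrable PZ (\<lambda>w. \<Sum>i<d. T i w)"
    by (intro Bochner_Integration.integrable_sum) auto
  have il: "integrable PZ l"
    unfolding l_eq using ie iz iT by (intro Bochner_Integration.integrable_add Bochner_Integration.integrable_diff) auto
  define YY XS FS SS FF where "YY = (\<Sum>i<d. \<integral>y. (y i)^2 \<partial>P)" and "XS = (\<Sum>i<d. \<integral>x. x i * S x i \<partial>Q)"
    and "FS = (\<Sum>i<d. \<integral>x. f' x i * S x i \<partial>Q)" and "SS = (\<Sum>i<d. \<integral>x. (S x i)^2 \<partial>Q)"
    and "FF = (\<Sum>i<d. \<integral>x. (f' x i)^2 \<partial>Q)"
  have fQ [measurable]: "(\<lambda>x. f' x i) \<in> borel_measurable Q" "(\<lambda>x. S x i) \<in> borel_measurable Q" "(\<lambda>x. x i) \<in> borel_measurable Q"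
    if "i < d" for i
    using fm[OF that] Sm[OF that] measurable_lebd_component[OF that] by (simp_all cong: measurable_cong_sets add: sets_Q)
  have "\<bar>XS\<bar> \<le> (\<Sum>i<d. ((\<integral>x. (x i)^2 \<partial>Q) + (\<integral>x. (S x i)^2 \<partial>Q)) / 2)"
    unfolding XS_def using fQ noised_second_moment Si
    by (intro order_trans[OF sum_abs] sum_mono abs_integral_mult_le) auto
  also have "\<dots> \<le> B"
    using B(3,5) by (simp add: sum.distrib sum_divide_distrib[symmetric])
  finally have XS: "\<bar>XS\<bar> \<le> B" .
  have "\<bar>FS\<bar> \<le> (\<Sum>i<d. ((\<integral>x. (f' x i)^2 \<partial>Q) + (\<integral>x. (S x i)^2 \<partial>Q)) / 2)"
    unfolding FS_def using fQ fi Si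
    by (intro order_trans[OF sum_abs] sum_mono abs_integral_mult_le) auto
  also have "\<dots> \<le> B"
    using B(4,5) by (simp add: sum.distrib sum_divide_distrib[symmetric])
  finally have FS: "\<bar>FS\<bar> \<le> B" .
  have E': "SS - 2 * FS + FF \<le> E"
  proof -
    have "(\<integral>x. (S x i - f' x i)^2 \<partial>Q) = (\<integral>x. (S x i)^2 \<partial>Q) - 2 * (\<integral>x. f' x i * S x i \<partial>Q) + (\<integral>x. (f' x i)^2 \<partial>Q)"
      if i: "i < d" for i
    proof -
      have fS: "integrable Q (\<lambda>x. f' x i * S x i)" using fQ[OF i] fi[OF i] Si[OF i] by (intro integrable_mult_of_squares)
      have "(\<integral>x. (S x i - f' x i)^2 \<partial>Q) = (\<integral>x. (S x i)^2 - 2 * (f' x i * S x i) + (f' x i)^2 \<partial>Q)"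
        by (intro Bochner_Integration.integral_cong) (auto simp: power2_eq_square algebra_simps)
      then show ?thesis using fS fi[OF i] Si[OF i] by simp
    qed
    then show ?thesis using E
      by (simp add: SS_def FS_def FF_def sum.distrib[symmetric] sum_subtractf[symmetric] sum_distrib_left)
  qed
  have T_sum: "(\<integral>w. (\<Sum>i<d. T i w) \<partial>PZ) = (1 - a * (1 + h / 2))^2 * YY + d * ((1 + h / 2)^2 * v)
        - 2 * h * (1 / a - (1 + h / 2)) * XS - 2 * h * (v / a) * FS + h^2 * SS"
  proof -
    have "(\<integral>w. (\<Sum>i<d. T i w) \<partial>PZ) = (\<Sum>i<d. \<integral>w. T i w \<partial>PZ)"
      using iT1 by (intro Bochner_Integration.integral_sum) auto
    also have "\<dots> = (\<Sum>i<d. (1 - a * (1 + h / 2))^2 * (\<integral>y. (y i)^2 \<partial>P) + (1 + h / 2)^2 * v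
        - 2 * h * (1 / a - (1 + h / 2)) * (\<integral>x. x i * S x i \<partial>Q)
        - 2 * h * (v / a) * (\<integral>x. f' x i * S x i \<partial>Q) + h^2 * (\<integral>x. (S x i)^2 \<partial>Q))"
      unfolding T_def by (intro sum.cong refl kernel_error(2)) simp
    finally show ?thesis
      by (simp only: YY_def XS_def FS_def SS_def sum.distrib sum_subtractf sum_distrib_left sum_constant card_lessThan)
  qed
  have z_sum: "(\<integral>w. (\<Sum>i<d. (snd w i)^2) \<partial>PZ) = d"
    using moments(3,4) by (subst Bochner_Integration.integral_sum) auto
  have dd: "d * (- h / 2 + (ln h - ln v - 1 + Z) / 2) = - (d * h / 2 + d / 2 * (ln v - ln h)) - d / 2 + d / 2 * Z" for Z
    by (simp add: field_simps)
  have "(\<integral>w. l w \<partial>PZ) = (\<integral>w. e w \<partial>PZ) - (d * h / 2 + d / 2 * (ln v - ln h)) - d / 2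
      + (\<integral>w. (\<Sum>i<d. T i w) \<partial>PZ) / (2 * h)"
    unfolding l_eq using ie iz iT z_sum
    by (subst Bochner_Integration.integral_add, simp, simp, subst Bochner_Integration.integral_diff, simp, simp,
        subst Bochner_Integration.integral_diff) (auto simp: PN.prob_space)
  also have "(\<integral>w. (\<Sum>i<d. T i w) \<partial>PZ) / (2 * h) = (1 - a * (1 + h / 2))^2 / (2 * h) * YY + d / 2 * ((1 + h / 2)^2 * v / h)
        - (1 / a - (1 + h / 2)) * XS - (v / a) * FS + h / 2 * SS"
    unfolding T_sum using h by (simp add: add_divide_distrib diff_divide_distrib) (simp add: power2_eq_square)
  finally have l_val: "(\<integral>w. l w \<partial>PZ) = (\<integral>w. e w \<partial>PZ) - (d * h / 2 + d / 2 * (ln v - ln h)) - d / 2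
      + ((1 - a * (1 + h / 2))^2 / (2 * h) * YY + d / 2 * ((1 + h / 2)^2 * v / h)
        - (1 / a - (1 + h / 2)) * XS - (v / a) * FS + h / 2 * SS)" .
  have ent: "(\<integral>w. e w \<partial>PZ) \<le> h / 2 * fisher + h * sqrt h * (2 * fisher + 4 * (d * L)^2 * M4)"
  proof -
    have "M4 \<ge> 0" unfolding M4_def by (intro integral_nonneg_AE AE_I2) simp
    from step_entropy_coeffs[OF h fisher_nonneg this, of "(d * L)^2", folded a_def v_def, unfolded abs_power2]
    show ?thesis
      using entropy_step[of "sqrt h" "sqrt v / a", folded M4_def] h unfolding e_def[symmetric]
      by (meson order_trans real_sqrt_gt_zero)
  qed
  have f1: "(\<integral>w. l w \<partial>PZ) \<le> h / 2 * fisher + (h * sqrt h * (2 * fisher) + h * sqrt h * (4 * (d * L)^2 * M4))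
      + d * (- h / 2 + (ln h - ln v - 1 + (1 + h / 2)^2 * v / h) / 2)
      + (1 - a * (1 + h / 2))^2 / (2 * h) * YY - (1 / a - (1 + h / 2)) * XS - (v / a) * FS + h / 2 * SS"
    unfolding dd distrib_left[symmetric] using l_val ent by argo
  have f2: "d * (- h / 2 + (ln h - ln v - 1 + (1 + h / 2)^2 * v / h) / 2) \<le> d * h^2"
    using step_normaliser[OF h, folded v_def] by (intro mult_left_mono) auto
  have f3: "(1 - a * (1 + h / 2))^2 / (2 * h) * YY \<le> h^2 * B"
    using step_contraction[OF h, folded a_def] B(1) unfolding YY_def[symmetric]
    by (intro mult_mono) (auto simp: YY_def intro!: sum_nonneg)
  have f4: "- (1 / a - (1 + h / 2)) * XS \<le> h^2 * B"
  proof -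
    have "- (1 / a - (1 + h / 2)) * XS = (1 / a - (1 + h / 2)) * (- XS)" by (rule minus_mult_commute)
    also have "\<dots> \<le> (1 / a - (1 + h / 2)) * \<bar>XS\<bar>"
      using step_inv_a(1)[OF h, folded a_def] by (intro mult_left_mono) auto
    also have "\<dots> \<le> h^2 * B"
      using step_inv_a[OF h, folded a_def] XS by (intro mult_mono) auto
    finally show ?thesis .
  qed
  \<comment> \<open>The coefficient v / a of the cross term is traded for h, so that the term fits
    into a perfect square with the other score terms.\<close>
  have f5: "(h - v / a) * FS \<le> h^2 * B"
  proof -
    have "(h - v / a) * FS \<le> \<bar>h - v / a\<bar> * \<bar>FS\<bar>" unfolding abs_mult[symmetric] by (rule abs_ge_self)
    also have "\<dots> \<le> h^2 * B"
      using step_drift[OF h, folded a_def v_def] FS by (intro mult_mono) auto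
    finally show ?thesis .
  qed
  have f6: "h / 2 * SS - h * FS + h / 2 * FF \<le> h / 2 * E"
    using mult_left_mono[OF E', of "h / 2"] h by (simp add: algebra_simps)
  have f7: "h * sqrt h * (2 * fisher) \<le> h * sqrt h * (2 * B)"
    using B(2) h by (intro mult_left_mono) auto
  \<comment> \<open>For h at most 1 the quadratic errors are absorbed into the rate h sqrt h of the
    entropy term.\<close>
  have f8: "h^2 * (3 * B + d) \<le> h * sqrt h * (3 * B + d)"
  proof (rule mult_right_mono)
    have "h \<le> sqrt h" using h by (intro real_le_rsqrt) (simp add: power2_eq_square mult_left_le)
    then show "h^2 \<le> h * sqrt h" using h by (simp add: power2_eq_square)
    show "0 \<le> 3 * B + d" using order_trans[OF fisher_nonneg B(2)] by simp
  qed
  have gen: "l \<le> hf - hFF + hE + (kB + R + kW)"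
    if "l \<le> hf + (kf + kW) + N + Y - X - vF + hS" "N \<le> dq" "Y \<le> qB" "- X \<le> qB" "hF - vF \<le> qB"
      "hS - hF + hFF \<le> hE" "kf \<le> kB" "qB + qB + qB + dq \<le> R" for l hf kf kW N Y X vF hS dq qB hF hFF hE kB R :: real
    using that by linarith
  have "h^2 * (3 * B + d) = h^2 * B + h^2 * B + h^2 * B + d * h^2" by (simp add: algebra_simps)
  note gen[OF f1 f2 f3 f4[unfolded mult_minus_left] f5[unfolded left_diff_distrib] f6 f7 f8[unfolded this]]
  also have "h * sqrt h * (2 * B) + h * sqrt h * (3 * B + d) + h * sqrt h * (4 * (d * L)^2 * M4)
     = h * sqrt h * (5 * B + 4 * (d * L)^2 * M4 + d)" by (simp add: algebra_simps)
  finally have "(\<integral>w. l w \<partial>PZ) \<le> h / 2 * (fisher - FF) + h / 2 * E + h * sqrt h * (5 * B + 4 * (d * L)^2 * M4 + d)"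
    by (simp only: right_diff_distrib)
  moreover have "kl_le d P (\<mu> \<bind> (\<lambda>x. gauss d (m x) h)) (D + (\<integral>w. l w \<partial>PZ))"
    using pos_dens_rescaled[OF a_pos]
    by (intro kl_le_reverse_step[OF v_pos h(1) m _ kl[unfolded Q_def] mu il, where r=r]) (auto simp: r_def[abs_def] l_def)
  ultimately show ?thesis
    unfolding m_def FF_def M4_def by (elim kl_le_mono) simp
qed

end
end

subsection \<open>The forward process and the predictor chain\<close>

lemma le_one_plus_square: "s \<ge> 0 \<Longrightarrow> s \<le> 1 + s^2" for s :: real
  using sum_squares_bound[of s 1] by simp

text \<open>Since the score averages to zero, its value at the origin is a mean of differences of
  scores, which the Lipschitz bound controls. The bound depends on the law only through a second
  moment, hence can be made uniform in time.\<close>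

lemma (in score_dens) fisher_le:
  assumes mean: "\<And>i. i < d \<Longrightarrow> (\<integral>x. f x i \<partial>P) = 0" and B: "(\<Sum>i<d. \<integral>x. (x i)^2 \<partial>P) \<le> B"
  shows "fisher \<le> d * (2 * (L * (1 + B))^2 + 2 * L^2 * B)"
proof -
  have N: "(\<integral>x. (\<Sum>i<d. (x i)^2) \<partial>P) \<le> B"
    using B second_moment by (subst Bochner_Integration.integral_sum) auto
  have zero_le: "\<bar>f zero i\<bar> \<le> L * (1 + B)" if i: "i < d" for i
  proof -
    have fm: "(\<lambda>x. f x i) \<in> borel_measurable P"
      by (subst measurable_cong_sets[OF sets_P refl]) (rule score_measurable[OF i])
    have fi: "integrable P (\<lambda>x. f x i)"
      using integrable_mult_of_squares[OF fm borel_measurable_const integrable_score_sq[OF i], of 1] by simp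
    have "f zero i = (\<integral>x. f zero i - f x i \<partial>P)" using fi mean[OF i] by (simp add: P.prob_space[unfolded space_P])
    also have "\<bar>\<dots>\<bar> \<le> (\<integral>x. \<bar>f zero i - f x i\<bar> \<partial>P)" by (rule integral_abs_bound)
    also have "\<dots> \<le> (\<integral>x. L * (1 + (\<Sum>i<d. (x i)^2)) \<partial>P)"
    proof (rule integral_mono)
      fix x assume "x \<in> space P"
      then have "\<bar>f zero i - f x i\<bar> \<le> L * vdist d zero x" using lipschitz_vec_component[OF lip zero_Rd _ i] by simp
      also have "vdist d zero x \<le> 1 + (vdist d zero x)^2"
        by (rule le_one_plus_square[OF vdist_nonneg])
      also have "(vdist d zero x)^2 = (\<Sum>i<d. (x i)^2)" by (simp add: vdist_sq zero_def)
      finally show "\<bar>f zero i - f x i\<bar> \<le> L * (1 + (\<Sum>i<d. (x i)^2))" using L_nonneg by (simp add: mult_left_mono)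
    qed (use fi integrable_norm_sq in auto)
    also have "\<dots> = L * (1 + (\<integral>x. (\<Sum>i<d. (x i)^2) \<partial>P))" using integrable_norm_sq by (simp add: P.prob_space[unfolded space_P])
    also have "\<dots> \<le> L * (1 + B)" using N L_nonneg by (intro mult_left_mono) auto
    finally show ?thesis .
  qed
  have "(\<integral>x. (f x i)^2 \<partial>P) \<le> 2 * (L * (1 + B))^2 + 2 * L^2 * B" if i: "i < d" for i
  proof -
    have "(\<integral>x. (f x i)^2 \<partial>P) \<le> (\<integral>x. 2 * (f zero i)^2 + 2 * L^2 * (\<Sum>i<d. (x i)^2) \<partial>P)"
    proof (rule integral_mono)
      show "integrable P (\<lambda>x. 2 * (f zero i)^2 + 2 * L^2 * (\<Sum>i<d. (x i)^2))"
        using integrable_norm_sq by (intro Bochner_Integration.integrable_add integrable_mult_right) auto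
    qed (use integrable_score_sq[OF i] score_sq_le i in auto)
    also have "\<dots> = 2 * (f zero i)^2 + 2 * L^2 * (\<integral>x. (\<Sum>i<d. (x i)^2) \<partial>P)"
      using integrable_norm_sq by (subst Bochner_Integration.integral_add) (auto simp: P.prob_space[unfolded space_P])
    also have "\<dots> \<le> 2 * (L * (1 + B))^2 + 2 * L^2 * B"
    proof (intro add_mono mult_left_mono N)
      have "\<bar>f zero i\<bar> \<le> \<bar>L * (1 + B)\<bar>" using zero_le[OF i] by simp
      then show "(f zero i)^2 \<le> (L * (1 + B))^2" by (simp only: abs_le_square_iff)
    qed auto
    finally show ?thesis .
  qed
  then have "fisher \<le> (\<Sum>i<d. 2 * (L * (1 + B))^2 + 2 * L^2 * B)"
    unfolding fisher_eq by (intro sum_mono) auto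
  then show ?thesis by simp
qed

locale ddpm = pos_dens +
  fixes sc :: "real \<Rightarrow> (nat \<Rightarrow> real) \<Rightarrow> nat \<Rightarrow> real" and s :: "(nat \<Rightarrow> real) \<Rightarrow> real \<Rightarrow> nat \<Rightarrow> real"
    and L Ls e :: real
  assumes L_nonneg: "L \<ge> 0"
    and grad_t: "\<And>t. t \<ge> 0 \<Longrightarrow> has_grad d (\<lambda>x. ln (fwd_dens d p t x)) (sc t)"
    and lip_t: "\<And>t. t \<ge> 0 \<Longrightarrow> lipschitz_vec d L (sc t)"
    and s_lip: "\<And>t. t \<ge> 0 \<Longrightarrow> lipschitz_vec d Ls (\<lambda>x. s x t)"
    and err: "\<And>t. t \<ge> 0 \<Longrightarrow> (\<integral>\<^sup>+x. ennreal (fwd_dens d p t x * (vdist d (sc t x) (s x t))^2) \<partial>lebd d) \<le> ennreal (e^2)"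
    and m2: "\<And>i. i < d \<Longrightarrow> integrable P (\<lambda>x. (x i)^2)"
begin

definition Pt :: "real \<Rightarrow> (nat \<Rightarrow> real) measure" where
  "Pt t = density (lebd d) (\<lambda>x. ennreal (fwd_dens d p t x))"

definition V :: real where "V = (\<Sum>i<d. \<integral>x. (x i)^2 \<partial>P)"

definition FI :: "real \<Rightarrow> real" where "FI t = (\<Sum>i<d. \<integral>x. (sc t x i)^2 \<partial>Pt t)"

lemma V_nonneg: "V \<ge> 0"
  unfolding V_def by (intro sum_nonneg integral_nonneg_AE AE_I2) simp

lemma Pt_0: "Pt 0 = P"
  by (simp add: Pt_def P_def)

lemma sets_Pt [simp, measurable_cong]: "sets (Pt t) = sets (lebd d)"
  by (simp add: Pt_def)

lemma pos_t: "t \<ge> 0 \<Longrightarrow> pos_dens d (fwd_dens d p t)"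
  by (rule fwd_dens_pos_dens) unfold_locales

lemma P_t: "t \<ge> 0 \<Longrightarrow> pos_dens.P d (fwd_dens d p t) = Pt t"
  by (simp add: pos_dens.P_def[OF pos_t] Pt_def)

lemma moment_t:
  assumes "t \<ge> 0" "i < d"
  shows "integrable (Pt t) (\<lambda>x. (x i)^2)"
    and "(\<integral>x. (x i)^2 \<partial>Pt t) = exp (- t) * (\<integral>x. (x i)^2 \<partial>P) + (1 - exp (- t))"
proof -
  have "integrable (Pt t) (\<lambda>x. (x i)^2) \<and> (\<integral>x. (x i)^2 \<partial>Pt t) = exp (- t) * (\<integral>x. (x i)^2 \<partial>P) + (1 - exp (- t))"
  proof (cases "t = 0")
    case True then show ?thesis using m2[OF assms(2)] by (simp add: Pt_0)
  next
    case False
    then have "1 - exp (- t) > 0" using assms by simp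
    from blur_second_moment[OF this assms(2) m2[OF assms(2)], of "exp (- t / 2)"] show ?thesis
      using False by (simp add: Pt_def fwd_dens_blur power2_eq_square exp_add[symmetric])
  qed
  then show "integrable (Pt t) (\<lambda>x. (x i)^2)"
    "(\<integral>x. (x i)^2 \<partial>Pt t) = exp (- t) * (\<integral>x. (x i)^2 \<partial>P) + (1 - exp (- t))" by auto
qed

lemma moment_sum_le: "t \<ge> 0 \<Longrightarrow> (\<Sum>i<d. \<integral>x. (x i)^2 \<partial>Pt t) \<le> V + d"
proof -
  assume t: "t \<ge> 0"
  have "(\<Sum>i<d. \<integral>x. (x i)^2 \<partial>Pt t) = exp (- t) * V + d * (1 - exp (- t))"
    using t by (simp add: moment_t V_def sum.distrib sum_distrib_left)
  also have "\<dots> \<le> 1 * V + d"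
    using t V_nonneg by (intro add_mono mult_right_mono mult_left_le) auto
  finally show ?thesis by simp
qed

lemma score_t: "t \<ge> 0 \<Longrightarrow> score_dens d (fwd_dens d p t) (sc t) L"
  by (intro score_dens.intro pos_t score_dens_axioms.intro grad_t lip_t L_nonneg)
     (auto simp: P_t moment_t)

lemma fisher_t: "t \<ge> 0 \<Longrightarrow> score_dens.fisher d (fwd_dens d p t) (sc t) = FI t"
  by (simp add: score_dens.fisher_eq[OF score_t] FI_def P_t)

lemma FI_nonneg: "FI t \<ge> 0"
  unfolding FI_def by (intro sum_nonneg integral_nonneg_AE AE_I2) simp

lemma sc_measurable: "t \<ge> 0 \<Longrightarrow> i < d \<Longrightarrow> (\<lambda>x. sc t x i) \<in> borel_measurable (lebd d)"
  by (rule lipschitz_vec_measurable[OF lip_t])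

lemma s_measurable: "t \<ge> 0 \<Longrightarrow> i < d \<Longrightarrow> (\<lambda>x. s x t i) \<in> borel_measurable (lebd d)"
  by (rule lipschitz_vec_measurable[OF s_lip])

lemma integrable_sc_sq: "t \<ge> 0 \<Longrightarrow> i < d \<Longrightarrow> integrable (Pt t) (\<lambda>x. (sc t x i)^2)"
  using score_dens.integrable_score_sq[OF score_t] by (simp add: P_t)

text \<open>Tweedie's formula with the constant test function: the noise is centred. The formula
  presupposes positive variance, hence positive time.\<close>

lemma score_mean_zero:
  assumes t: "t > 0" and i: "i < d"
  shows "(\<integral>x. sc t x i \<partial>Pt t) = 0"
proof -
  let ?a = "exp (- t / 2)" and ?v = "1 - exp (- t)"
  have v: "?v > 0" using t by simp
  have eq: "fwd_dens d p t = blur d ?a ?v p" using t by (simp add: fwd_dens_blur)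
  have iz: "integrable (std_gauss d) (\<lambda>z. z i)" using integrable_std_gauss_power[OF i, of 1] by simp
  have "(\<integral>w. snd w i * (\<lambda>_. 1) (noised d ?a ?v (fst w) (snd w)) \<partial>PZ)
     = - sqrt ?v * (\<integral>x. sc t x i * (\<lambda>_. 1) x \<partial>density (lebd d) (\<lambda>x. ennreal (blur d ?a ?v p x)))"
    using t i PN.integrable_snd_only(1)[OF iz] grad_t[of t] sc_measurable[of t i]
    by (intro tweedie_integral[OF v i]) (auto simp: eq)
  then show ?thesis
    using PN.integrable_snd_only(2)[OF iz] std_gauss_mean[OF i] v by (simp add: Pt_def eq)
qed

text \<open>Bounds second moments and Fisher informations at all times at once. For positive time
  the Fisher information is controlled by \<open>fisher_le\<close> through the zero mean of the
  score; time 0 is covered by the summand \<open>FI 0\<close>.\<close>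

definition FB :: real where
  "FB = V + d + FI 0 + d * (2 * (L * (1 + (V + d)))^2 + 2 * L^2 * (V + d))"

lemma FB_bounds: "t \<ge> 0 \<Longrightarrow> FI t \<le> FB" "V + d \<le> FB" "FB \<ge> 0"
proof -
  have nn: "d * (2 * (L * (1 + (V + d)))^2 + 2 * L^2 * (V + d)) \<ge> 0" using V_nonneg by simp
  show "V + d \<le> FB" using nn FI_nonneg[of 0] by (simp add: FB_def)
  then show "FB \<ge> 0" using V_nonneg by simp
  assume t: "t \<ge> 0"
  show "FI t \<le> FB"
  proof (cases "t = 0")
    case True then show ?thesis using nn V_nonneg by (simp add: FB_def)
  next
    case False
    then have "FI t \<le> d * (2 * (L * (1 + (V + d)))^2 + 2 * L^2 * (V + d))"
      using score_dens.fisher_le[OF score_t[OF t], of "V + d"] t score_mean_zero moment_sum_le[OF t]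
      by (simp add: P_t fisher_t)
    then show ?thesis using V_nonneg FI_nonneg[of 0] by (simp add: FB_def)
  qed
qed

lemma score_error:
  assumes t: "t \<ge> 0"
  shows "(\<Sum>i<d. \<integral>x. (s x t i - sc t x i)^2 \<partial>Pt t) \<le> e^2"
    and "\<And>i. i < d \<Longrightarrow> integrable (Pt t) (\<lambda>x. (s x t i - sc t x i)^2)"
proof -
  interpret T: pos_dens d "fwd_dens d p t" by (rule pos_t[OF t])
  note [measurable] = sc_measurable[OF t] s_measurable[OF t]
  let ?g = "\<lambda>x. \<Sum>i<d. (s x t i - sc t x i)^2"
  have "(\<integral>\<^sup>+x. ennreal (?g x) \<partial>Pt t) = (\<integral>\<^sup>+x. ennreal (fwd_dens d p t x) * ennreal (?g x) \<partial>lebd d)"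
    unfolding P_t[OF t, symmetric] by (rule T.nn_integral_P) measurable
  also have "\<dots> = (\<integral>\<^sup>+x. ennreal (fwd_dens d p t x * (vdist d (sc t x) (s x t))^2) \<partial>lebd d)"
    using T.pos by (intro nn_integral_cong)
      (simp add: ennreal_mult[symmetric] less_imp_le sum_nonneg vdist_sq power2_commute[of "s _ t _"])
  also have "\<dots> \<le> ennreal (e^2)" by (rule err[OF t])
  finally have le: "(\<integral>\<^sup>+x. ennreal (?g x) \<partial>Pt t) \<le> ennreal (e^2)" .
  have gm: "?g \<in> borel_measurable (Pt t)" by measurable
  have ig: "integrable (Pt t) ?g"
    using gm by (intro integrableI_nonneg le_less_trans[OF le]) (auto intro!: AE_I2 sum_nonneg)
  show ii: "integrable (Pt t) (\<lambda>x. (s x t i - sc t x i)^2)" if i: "i < d" for i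
  proof (rule Bochner_Integration.integrable_bound[OF ig])
    show "(\<lambda>x. (s x t i - sc t x i)^2) \<in> borel_measurable (Pt t)" using i by measurable
    show "AE x in Pt t. norm ((s x t i - sc t x i)^2) \<le> norm (?g x)"
      using i by (auto intro!: AE_I2 order_trans[OF _ abs_ge_self] member_le_sum[where f="\<lambda>i. (s _ t i - sc t _ i)^2"])
  qed
  have "ennreal (\<integral>x. ?g x \<partial>Pt t) \<le> ennreal (e^2)"
    using le by (subst nn_integral_eq_integral[OF ig, symmetric]) (auto intro!: AE_I2 sum_nonneg)
  then have "(\<integral>x. ?g x \<partial>Pt t) \<le> e^2" by simp
  then show "(\<Sum>i<d. \<integral>x. (s x t i - sc t x i)^2 \<partial>Pt t) \<le> e^2"
    using ii by (subst (asm) Bochner_Integration.integral_sum) auto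
qed

lemma s_sq:
  assumes t: "t \<ge> 0"
  shows "(\<Sum>i<d. \<integral>x. (s x t i)^2 \<partial>Pt t) \<le> 2 * e^2 + 2 * FB"
    and "\<And>i. i < d \<Longrightarrow> integrable (Pt t) (\<lambda>x. (s x t i)^2)"
proof -
  note [measurable] = sc_measurable[OF t] s_measurable[OF t]
  have b: "(a::real)^2 \<le> 2 * (a - c)^2 + 2 * c^2" for a c
    using zero_le_power2[of "a - 2 * c"] by (simp add: power2_eq_square algebra_simps)
  have ib: "integrable (Pt t) (\<lambda>x. 2 * (s x t i - sc t x i)^2 + 2 * (sc t x i)^2)" if "i < d" for i
    using score_error(2)[OF t that] integrable_sc_sq[OF t that] by simp
  show ii: "integrable (Pt t) (\<lambda>x. (s x t i)^2)" if i: "i < d" for i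
    by (rule Bochner_Integration.integrable_bound[OF ib[OF i]])
       (use i b in \<open>auto intro!: AE_I2 order_trans[OF b abs_ge_self]\<close>)
  have "(\<Sum>i<d. \<integral>x. (s x t i)^2 \<partial>Pt t) \<le> (\<Sum>i<d. \<integral>x. 2 * (s x t i - sc t x i)^2 + 2 * (sc t x i)^2 \<partial>Pt t)"
    using ii ib b by (intro sum_mono integral_mono) auto
  also have "\<dots> = 2 * (\<Sum>i<d. \<integral>x. (s x t i - sc t x i)^2 \<partial>Pt t) + 2 * FI t"
    using score_error(2)[OF t] integrable_sc_sq[OF t] by (simp add: FI_def sum.distrib sum_distrib_left)
  also have "\<dots> \<le> 2 * e^2 + 2 * FB" using score_error(1)[OF t] FB_bounds(1)[OF t] by simp
  finally show "(\<Sum>i<d. \<integral>x. (s x t i)^2 \<partial>Pt t) \<le> 2 * e^2 + 2 * FB" .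
qed

text \<open>Independent of t and h: the T / h steps accumulate T sqrt h times this constant, which
  vanishes with h.\<close>

definition CC :: real where
  "CC = 5 * (2 * e^2 + 2 * FB) + 4 * (d * L)^2 * (\<integral>z. (\<Sum>i<d. (z i)^2)^2 \<partial>std_gauss d) + d"

lemma CC_nonneg: "CC \<ge> 0"
  using FB_bounds(3) unfolding CC_def
  by (intro add_nonneg_nonneg mult_nonneg_nonneg integral_nonneg_AE AE_I2) auto

lemma predictor_step:
  assumes t: "t \<ge> 0" and h: "0 < h" "h \<le> 1"
    and mu: "prob_space \<mu>" "sets \<mu> = sets (lebd d)" and kl: "kl_le d (Pt (t + h)) \<mu> D"
  shows "kl_le d (Pt t) (\<mu> \<bind> (\<lambda>x. gauss d (\<lambda>i. x i + h * (x i / 2 + s x (t + h) i)) h))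
    (D + (h / 2 * (FI t - FI (t + h)) + h / 2 * e^2 + h * sqrt h * CC))"
proof -
  interpret T: score_dens d "fwd_dens d p t" "sc t" L by (rule score_t[OF t])
  let ?a = "exp (- h / 2)" and ?v = "1 - exp (- h)"
  have th: "t + h \<ge> 0" using t h by simp
  \<comment> \<open>The evolution identity holds on \<open>Rd d\<close>; coordinate updates stay
    there, so the measure and the gradient both transfer to the blurred form.\<close>
  have step: "fwd_dens d p (t + h) x = blur d ?a ?v (fwd_dens d p t) x" if "x \<in> Rd d" for x
    using fwd_dens_step[OF _ t h(1) that] by (simp add: pos_dens_axioms)
  have upd: "x(i := c) \<in> Rd d" if "x \<in> Rd d" "i < d" for x i c
    using that by (auto simp: Rd_def PiE_iff extensional_def)
  have Q: "Pt (t + h) = density (lebd d) (\<lambda>x. ennreal (blur d ?a ?v (fwd_dens d p t) x))"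
    unfolding Pt_def using pos_dens.meas[OF pos_t[OF th]] T.blur_measurable[of ?a ?v]
    by (intro density_cong AE_I2) (auto simp: step)
  have g: "has_grad d (\<lambda>x. ln (blur d ?a ?v (fwd_dens d p t) x)) (sc (t + h))"
    using grad_t[OF th] unfolding has_grad_def by (simp add: step upd)
  have BB: "FB \<le> 2 * e^2 + 2 * FB" using FB_bounds(3) by (simp add: add_increasing)
  have le: "x \<le> 2 * e^2 + 2 * FB" if "x \<le> FB" for x using that BB by linarith
  have "kl_le d T.P (\<mu> \<bind> (\<lambda>x. gauss d (\<lambda>i. x i + h * (x i / 2 + s x (t + h) i)) h))
    (D + (h / 2 * (T.fisher - (\<Sum>i<d. \<integral>x. (sc (t + h) x i)^2 \<partial>Pt (t + h))) + h / 2 * e^2 + h * sqrt h * CC))"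
    unfolding CC_def
  proof (rule T.reverse_step[OF h refl refl Q g])
    show "(\<Sum>i<d. \<integral>y. (y i)^2 \<partial>T.P) \<le> 2 * e^2 + 2 * FB"
      using moment_sum_le[OF t] FB_bounds(2) by (intro le) (simp add: P_t[OF t])
    show "(\<Sum>i<d. \<integral>y. (y i)^2 \<partial>Pt (t + h)) \<le> 2 * e^2 + 2 * FB"
      using moment_sum_le[OF th] FB_bounds(2) by (intro le) simp
    show "T.fisher \<le> 2 * e^2 + 2 * FB"
      using FB_bounds(1)[OF t] by (intro le) (simp add: fisher_t[OF t])
    show "(\<Sum>i<d. \<integral>x. (sc (t + h) x i)^2 \<partial>Pt (t + h)) \<le> 2 * e^2 + 2 * FB"
      using FB_bounds(1)[OF th] by (intro le) (simp add: FI_def)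
  qed (use sc_measurable[OF th] s_measurable[OF th] integrable_sc_sq[OF th] s_sq[OF th] mu kl score_error(1)[OF th] in auto)
  then show ?thesis by (simp add: P_t[OF t] fisher_t[OF t] FI_def[of "t + h", symmetric])
qed

text \<open>Given the data, the forward variable at time T has exactly the variance of the prior, so
  in the log ratio of the two Gaussians the normalisers and the squared noise cancel. The mixed term
  averages to zero, leaving the contracted second moment.\<close>

lemma prior_step:
  assumes T: "T > 0"
  shows "kl_le d (Pt T) (gauss d (\<lambda>_. 0) (1 - exp (- T))) (exp (- T) * V / (2 * (1 - exp (- T))))"
proof -
  define a v where "a = exp (- T / 2)" and "v = 1 - exp (- T)"
  have v: "v > 0" using T by (simp add: v_def)
  have a2: "a^2 = exp (- T)" by (simp add: a_def power2_eq_square exp_add[symmetric])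
  define l where "l w = (\<Sum>i<d. a^2 * (fst w i)^2 + 2 * a * sqrt v * (fst w i * snd w i)) / (2 * v)" for w :: "(nat \<Rightarrow> real) \<times> (nat \<Rightarrow> real)"
  note m = pair_moments[OF _ m2]
  have il1: "integrable PZ (\<lambda>w. a^2 * (fst w i)^2 + 2 * a * sqrt v * (fst w i * snd w i))" if "i < d" for i
    using m[OF that that] by (intro Bochner_Integration.integrable_add integrable_mult_right)
  have il: "integrable PZ l"
    unfolding l_def using il1 by (intro integrable_divide_zero Bochner_Integration.integrable_sum) auto
  have "(\<integral>w. l w \<partial>PZ)
     = (\<Sum>i<d. \<integral>w. a^2 * (fst w i)^2 + 2 * a * sqrt v * (fst w i * snd w i) \<partial>PZ) / (2 * v)"
    unfolding l_def using il1 by (subst integral_divide_zero, subst Bochner_Integration.integral_sum) auto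
  also have "\<dots> = (\<Sum>i<d. a^2 * (\<integral>y. (y i)^2 \<partial>P)) / (2 * v)"
  proof -
    have "(\<integral>w. a^2 * (fst w i)^2 + 2 * a * sqrt v * (fst w i * snd w i) \<partial>PZ) = a^2 * (\<integral>y. (y i)^2 \<partial>P)"
      if "i < d" for i
      using m[OF that that] by (subst Bochner_Integration.integral_add) auto
    then show ?thesis by simp
  qed
  also have "\<dots> = exp (- T) * V / (2 * v)" by (simp add: V_def sum_distrib_left a2)
  finally have val: "(\<integral>w. l w \<partial>PZ) = exp (- T) * V / (2 * v)" .
  have "kl_le d (density (lebd d) (\<lambda>x. ennreal (blur d a v p x))) (gauss d (\<lambda>_. 0) v) (\<integral>w. l w \<partial>PZ)"
  proof (rule kl_le_initial[OF v v il])
    fix y z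
    have "(\<Sum>i<d. (noised d a v y z i - 0)^2) - (\<Sum>i<d. (noised d a v y z i - a * y i)^2)
       = (\<Sum>i<d. a^2 * (y i)^2 + 2 * a * sqrt v * (y i * z i))"
      unfolding sum_subtractf[symmetric] by (intro sum.cong) (auto simp: power2_eq_square algebra_simps)
    then show "l (y, z) = ln (gauss_dens d (\<lambda>i. a * y i) v (noised d a v y z)) - ln (gauss_dens d (\<lambda>_. 0) v (noised d a v y z))"
      unfolding ln_gauss_dens[OF v] l_def by (simp add: diff_divide_distrib[symmetric])
  qed
  then show ?thesis using T by (simp add: val Pt_def fwd_dens_blur a_def v_def)
qed

end

section \<open>From the dual relative entropy to total variation\<close>

lemma kl_le_measure_diff:
  assumes kl: "kl_le d \<mu> \<nu> D" and mu: "prob_space \<mu>" "sets \<mu> = sets (lebd d)"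
    and nu: "prob_space \<nu>" "sets \<nu> = sets (lebd d)" and D: "0 < D" "D \<le> 1" and A: "A \<in> sets (lebd d)"
  shows "measure \<mu> A - measure \<nu> A \<le> 2 * sqrt D"
proof -
  interpret M: prob_space \<mu> by fact
  interpret N: prob_space \<nu> by fact
  \<comment> \<open>Testing with the exponential of c times the indicator of A gives c (mu A - nu A)
    <= c^2 + D for c at most 1; the choice c = sqrt D balances both terms and yields the constant
    2.\<close>
  define c where "c = sqrt D"
  have c: "0 < c" "c \<le> 1" "c^2 = D" using D by (auto simp: c_def)
  define g where "g x = 1 + (exp c - 1) * indicator A x" for x :: "nat \<Rightarrow> real"
  have [measurable]: "A \<in> sets (lebd d)" by fact
  have gm: "g \<in> borel_measurable (lebd d)" unfolding g_def by measurable
  have "test_fun d 1 (exp c) g"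
    using c gm by (auto simp: test_fun_def g_def indicator_def)
  then have "(\<integral>x. ln (g x) \<partial>\<mu>) \<le> ln (\<integral>x. g x \<partial>\<nu>) + D" using kl unfolding kl_le_def by blast
  also have "(\<integral>x. ln (g x) \<partial>\<mu>) = (\<integral>x. c * indicator A x \<partial>\<mu>)"
    by (intro Bochner_Integration.integral_cong) (auto simp: g_def indicator_def)
  also have "\<dots> = c * measure \<mu> A" using A mu by (simp add: M.emeasure_eq_measure)
  also have "(\<integral>x. g x \<partial>\<nu>) = 1 + (exp c - 1) * measure \<nu> A"
  proof -
    have "integrable \<nu> (indicator A :: _ \<Rightarrow> real)" using A nu by (auto simp: N.emeasure_eq_measure)
    then show ?thesis unfolding g_def using A nu by (simp add: N.prob_space)
  qed
  also have "ln (1 + (exp c - 1) * measure \<nu> A) \<le> (exp c - 1) * measure \<nu> A"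
    using c by (intro ln_add_one_self_le_self mult_nonneg_nonneg) auto
  also have "\<dots> \<le> (c + c^2) * measure \<nu> A"
    using exp_bound[of c] c by (intro mult_right_mono) auto
  also have "\<dots> = c * measure \<nu> A + c^2 * measure \<nu> A" by (simp add: distrib_right)
  also have "c^2 * measure \<nu> A \<le> c^2" by (simp add: mult_left_le)
  finally have "c * (measure \<mu> A - measure \<nu> A) \<le> c * (2 * c)"
    unfolding c(3)[symmetric] by (simp add: right_diff_distrib power2_eq_square)
  then show ?thesis using c by (simp add: c_def)
qed

lemma kl_le_tv:
  assumes kl: "kl_le d \<mu> \<nu> D" and mu: "prob_space \<mu>" "sets \<mu> = sets (lebd d)"
    and nu: "prob_space \<nu>" "sets \<nu> = sets (lebd d)" and D: "0 < D" "D \<le> 1"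
  shows "tv d \<nu> \<mu> \<le> 2 * sqrt D"
  unfolding tv_def
proof (rule cSUP_least)
  show "sets (lebd d) \<noteq> {}" using sets.top[of "lebd d"] by blast
  fix A assume A: "A \<in> sets (lebd d)"
  interpret M: prob_space \<mu> by fact
  interpret N: prob_space \<nu> by fact
  have sp: "space \<mu> = space (lebd d)" "space \<nu> = space (lebd d)"
    using sets_eq_imp_space_eq[OF mu(2)] sets_eq_imp_space_eq[OF nu(2)] by auto
  \<comment> \<open>The estimate is one-sided; the complement of A supplies the other sign.\<close>
  have "measure \<mu> (space (lebd d) - A) = 1 - measure \<mu> A" "measure \<nu> (space (lebd d) - A) = 1 - measure \<nu> A"
    using M.prob_compl[of A] N.prob_compl[of A] A mu nu sp by auto
  then show "\<bar>measure \<nu> A - measure \<mu> A\<bar> \<le> 2 * sqrt D"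
    using kl_le_measure_diff[OF assms A] kl_le_measure_diff[OF assms sets.compl_sets[OF A]] by linarith
qed

section \<open>The predictor chain with vanishing step size\<close>

context ddpm begin

text \<open>With zero corrector steps \<open>lmc\<close> returns its argument, so each stage is one
  Gaussian kernel; the value 1 for the corrector step sizes meets the positivity demanded in the
  theorem. Stage k of the algorithm sits at forward time (n - k) h, and the bound carries the Fisher
  terms in telescoped form.\<close>

lemma pc_chain:
  assumes h: "0 < h" "h \<le> 1" and T: "T = real n * h" "T > 0"
    and D0: "D0 = exp (- T) * V / (2 * (1 - exp (- T)))"
  shows "k \<le> n \<Longrightarrow> prob_space (pc_law d s T h (\<lambda>_. 0) (\<lambda>_. 1) k)
    \<and> sets (pc_law d s T h (\<lambda>_. 0) (\<lambda>_. 1) k) = sets (lebd d)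
    \<and> kl_le d (Pt (real (n - k) * h)) (pc_law d s T h (\<lambda>_. 0) (\<lambda>_. 1) k)
        (D0 + h / 2 * (FI (real (n - k) * h) - FI T) + real k * (h / 2 * e^2 + h * sqrt h * CC))"
proof (induction k)
  case 0
  have "1 - exp (- T) > 0" using T by simp
  then show ?case using prior_step[OF T(2)] T by (simp add: D0 prob_space_gauss)
next
  case (Suc k)
  define t where "t = real (n - Suc k) * h"
  define \<mu> where "\<mu> = pc_law d s T h (\<lambda>_. 0) (\<lambda>_. 1) k"
  have t: "t \<ge> 0" using h by (simp add: t_def)
  have th: "real (n - k) * h = t + h" "T - real k * h = t + h"
    using Suc.prems by (simp_all add: t_def T of_nat_diff algebra_simps)
  have mu: "prob_space \<mu>" "sets \<mu> = sets (lebd d)"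
    and kl: "kl_le d (Pt (t + h)) \<mu> (D0 + h / 2 * (FI (t + h) - FI T) + real k * (h / 2 * e^2 + h * sqrt h * CC))"
    using Suc.IH[OF Suc_leD[OF Suc.prems]] unfolding th(1) \<mu>_def by auto
  have pc: "pc_law d s T h (\<lambda>_. 0) (\<lambda>_. 1) (Suc k)
     = \<mu> \<bind> (\<lambda>x. gauss d (\<lambda>i. x i + h * (x i / 2 + s x (t + h) i)) h)"
    by (simp add: \<mu>_def th)
  have m: "(\<lambda>x. x i + h * (x i / 2 + s x (t + h) i)) \<in> borel_measurable (lebd d)" if "i < d" for i
  proof -
    have [measurable]: "(\<lambda>x. s x (t + h) i) \<in> borel_measurable (lebd d)" using that t h by (intro s_measurable) auto
    show ?thesis using that by measurable
  qed
  \<comment> \<open>The constant test function instantiates \<open>integral_bind_gauss\<close>,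
    whose first two conclusions say that a kernel step yields a probability law on the same
    space.\<close>
  have one: "test_fun d 1 1 (\<lambda>_. 1)" by (simp add: test_fun_def)
  have "kl_le d (Pt t) (pc_law d s T h (\<lambda>_. 0) (\<lambda>_. 1) (Suc k))
     (D0 + h / 2 * (FI (t + h) - FI T) + real k * (h / 2 * e^2 + h * sqrt h * CC)
       + (h / 2 * (FI t - FI (t + h)) + h / 2 * e^2 + h * sqrt h * CC))"
    unfolding pc by (rule predictor_step[OF t h mu kl])
  then have "kl_le d (Pt t) (pc_law d s T h (\<lambda>_. 0) (\<lambda>_. 1) (Suc k))
     (D0 + h / 2 * (FI t - FI T) + real (Suc k) * (h / 2 * e^2 + h * sqrt h * CC))"
    by (rule kl_le_mono) (simp add: algebra_simps)
  moreover have "prob_space (pc_law d s T h (\<lambda>_. 0) (\<lambda>_. 1) (Suc k))"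
    "sets (pc_law d s T h (\<lambda>_. 0) (\<lambda>_. 1) (Suc k)) = sets (lebd d)"
    unfolding pc using integral_bind_gauss(1,2)[OF one mu m h(1)] by auto
  ultimately show ?case by (simp only: t_def)
qed

text \<open>The step size is chosen last, against fixed T, score and data, so the whole
  discretisation error fits below any given bound; the prior mismatch and the score error
  remain.\<close>

lemma predictor_converges:
  assumes T: "T > 0" and eta: "\<eta> > 0"
  obtains n h where "n \<ge> 1" "h > 0" "T = real n * h"
    "prob_space (pc_law d s T h (\<lambda>_. 0) (\<lambda>_. 1) n)"
    "sets (pc_law d s T h (\<lambda>_. 0) (\<lambda>_. 1) n) = sets (lebd d)"
    "kl_le d P (pc_law d s T h (\<lambda>_. 0) (\<lambda>_. 1) n) (exp (- T) * V / (2 * (1 - exp (- T))) + T / 2 * e^2 + \<eta>)"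
proof -
  \<comment> \<open>Up to the final one, which keeps it positive, \<open>W\<close> collects the
    coefficients of sqrt h in the total discretisation error; the requirement sqrt h <= eta / W then
    dictates \<open>\<delta>\<close>.\<close>
  define W where "W = FI 0 + T * CC + 1"
  have W: "W > 0" using FI_nonneg[of 0] CC_nonneg T by (simp add: W_def add_nonneg_pos)
  define \<delta> where "\<delta> = min 1 ((\<eta> / W)^2)"
  have \<delta>: "\<delta> > 0" using eta W by (simp add: \<delta>_def)
  obtain n :: nat where n: "T / \<delta> < real n" using reals_Archimedean2 by blast
  have n0: "real n > 0" using n T \<delta> by (smt (verit) divide_pos_pos)
  define h where "h = T / real n"
  have h0: "h > 0" and Tn: "T = real n * h" using T n0 by (auto simp: h_def)
  have "h \<le> \<delta>" using n n0 \<delta> by (simp add: h_def field_simps)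
  then have h1: "h \<le> 1" and "h \<le> (\<eta> / W)^2" by (auto simp: \<delta>_def)
  then have sh: "sqrt h \<le> \<eta> / W" using eta W by (intro real_le_lsqrt) auto
  have hs: "h \<le> sqrt h" using h0 h1 by (intro real_le_rsqrt) (simp add: power2_eq_square mult_left_le)
  have "h / 2 * FI 0 + T * (sqrt h * CC) \<le> sqrt h * FI 0 + sqrt h * (T * CC)"
    using FI_nonneg[of 0] hs h0 by (intro add_mono mult_right_mono) auto
  also have "\<dots> \<le> sqrt h * W" by (simp add: W_def algebra_simps h0 less_imp_le)
  also have "\<dots> \<le> (\<eta> / W) * W" using sh W by (intro mult_right_mono) auto
  finally have small: "h / 2 * FI 0 + T * (sqrt h * CC) \<le> \<eta>" using W by simp
  note chain = pc_chain[OF h0 h1 Tn T refl order_refl]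
  show ?thesis
  proof (rule that[of n h])
    show "n \<ge> 1" using n0 by simp
    have "kl_le d P (pc_law d s T h (\<lambda>_. 0) (\<lambda>_. 1) n)
       (exp (- T) * V / (2 * (1 - exp (- T))) + h / 2 * (FI 0 - FI T) + real n * (h / 2 * e^2 + h * sqrt h * CC))"
      using chain by (simp add: Pt_0)
    moreover have "h / 2 * (FI 0 - FI T) + real n * (h / 2 * e^2 + h * sqrt h * CC)
      = h / 2 * FI 0 - h / 2 * FI T + (T / 2 * e^2 + T * (sqrt h * CC))"
      unfolding Tn by (simp add: algebra_simps)
    moreover have "h / 2 * FI T \<ge> 0" using FI_nonneg[of T] h0 by simp
    ultimately show "kl_le d P (pc_law d s T h (\<lambda>_. 0) (\<lambda>_. 1) n) (exp (- T) * V / (2 * (1 - exp (- T))) + T / 2 * e^2 + \<eta>)"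
      using small by (elim kl_le_mono) linarith
  qed (use h0 Tn chain in auto)
qed

end

section \<open>The time horizon and the numerical constants\<close>

lemma prior_exponent_bound:
  fixes C x :: real and d :: nat
  assumes d: "d \<ge> 1" and C: "C \<ge> 1" and x: "0 < x" "x < 1"
  defines "T \<equiv> 8 * max (ln (C * real d)) (C * ln (1 / x))"
  shows "T > 0" "exp (- T) \<le> x^4 / d" "T \<le> 8 * C * d / x"
proof -
  have Cd: "real d \<le> C * d" "1 \<le> C * d" "C \<le> C * d"
    using d C by (auto simp: mult_ge1_I intro: order_trans)
  have lx: "ln (1 / x) > 0" using x by simp
  have lC: "ln (1 / x) \<le> C * ln (1 / x)" using C lx by (simp add: ln_div)
  have ld: "0 \<le> ln d" "ln d \<le> ln (C * d)" using d Cd by (auto simp: ln_le_cancel_iff)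
  show "T > 0" using less_le_trans[OF lx lC] unfolding T_def by (simp add: less_max_iff_disj)
  \<comment> \<open>The term ln d compensates a second moment of order d. Of the four powers of x,
    two are the target accuracy and two absorb the constant in that moment. The factor 8 in
    \<open>T\<close> covers both terms with room to spare.\<close>
  have "ln d + 4 * ln (1 / x) \<le> T"
    using ld lC lx max.cobounded1[of "ln (C * real d)" "C * ln (1 / x)"] max.cobounded2[of "C * ln (1 / x)" "ln (C * real d)"]
    unfolding T_def by linarith
  then have "exp (- T) \<le> exp (- (ln d + 4 * ln (1 / x)))" by simp
  also have "\<dots> = x^4 / d"
  proof -
    have "- (ln d + 4 * ln (1 / x)) = ln (x^4 / d)" using x d by (simp add: ln_div ln_realpow)
    then show ?thesis using x d by simp
  qed
  finally show "exp (- T) \<le> x^4 / d" .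
  \<comment> \<open>Replacing logarithms by their arguments is affordable, because the squared score
    error is of order x^8 / (C d)^2.\<close>
  have "ln (C * d) \<le> C * d / x"
  proof -
    have "ln (C * d) \<le> C * d" using ln_le_minus_one[of "C * d"] Cd by simp
    also have "\<dots> \<le> C * d / x" using divide_left_mono[of x 1 "C * d"] x Cd by simp
    finally show ?thesis .
  qed
  moreover have "C * ln (1 / x) \<le> C * d / x"
  proof -
    have "C * ln (1 / x) \<le> C * (1 / x)"
      using ln_le_minus_one[of "1 / x"] x C by (intro mult_left_mono) auto
    also have "\<dots> \<le> C * d / x" using Cd(3) x by (simp add: divide_right_mono)
    finally show ?thesis .
  qed
  ultimately show "T \<le> 8 * C * d / x" unfolding T_def by (simp add: max_def)
qed

text \<open>The denominator dominates C d, its logarithm being at least ln 4 and hence at least 1.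
  So e is at most x^4 / (8 C d), and its square outweighs the crude bound on T: the product is x^7 /
  (16 C d).\<close>

lemma score_error_bound:
  fixes C x L e T :: real and d :: nat
  assumes d: "d \<ge> 1" and C: "C \<ge> 1" and L: "L \<ge> 1" and x: "0 < x" "x < 1" and e: "0 \<le> e"
    and e_le: "e \<le> 1/8 * x ^ 4 / (real d * L^2 * C powr (5/2) * ln (1 / (x / 2)^2))"
    and T: "T \<le> 8 * C * d / x"
  shows "T / 2 * e^2 \<le> x^2 / 16"
proof -
  have "C * real d \<le> real d * L^2 * C powr (5/2) * ln (1 / (x / 2)^2)"
  proof -
    have 1: "1 \<le> L^2" using L by (simp add: one_le_power)
    have 2: "C \<le> C powr (5/2)" using powr_mono[of 1 "5/2" C] C by simp
    have 3: "1 \<le> ln (1 / (x / 2)^2)"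
    proof -
      have "x^2 \<le> 1" using x by (simp add: power_le_one)
      then have "4 \<le> 1 / (x / 2)^2" using x by (simp add: power_divide field_simps)
      then have "exp 1 \<le> 1 / (x / 2)^2" using exp_le by linarith
      then show ?thesis using x by (subst ln_ge_iff) auto
    qed
    have "C * real d = real d * 1 * C * 1" by simp
    also have "\<dots> \<le> real d * L^2 * C powr (5/2) * ln (1 / (x / 2)^2)"
      using 1 2 3 C by (intro mult_mono) auto
    finally show ?thesis .
  qed
  moreover have Cd: "C * real d \<ge> 1" using d C by (simp add: mult_ge1_I)
  ultimately have "1/8 * x ^ 4 / (real d * L^2 * C powr (5/2) * ln (1 / (x / 2)^2)) \<le> 1/8 * x ^ 4 / (C * real d)"
    using x by (intro divide_left_mono) auto
  then have "e \<le> x^4 / (8 * (C * d))" using e_le by simp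
  then have "e^2 \<le> (x^4 / (8 * (C * d)))^2" using e by (rule power_mono)
  then have "T / 2 * e^2 \<le> (8 * C * d / x) / 2 * (x^4 / (8 * (C * d)))^2"
    using T C d x by (intro mult_mono) auto
  also have "\<dots> = x^7 / (16 * (C * d))"
    using x C d by (simp add: field_simps power2_eq_square) (simp add: eval_nat_numeral)
  also have "\<dots> \<le> x^7 / 16" using Cd x by (intro divide_left_mono) auto
  also have "\<dots> \<le> x^2 / 16" using x by (simp add: power_decreasing)
  finally show ?thesis .
qed

theorem theorem4:
  "\<forall>K>0. \<exists>c1>0. \<exists>c2>0. \<exists>c3>0. \<exists>c4>0.
   \<forall>(d::nat) (p :: (nat \<Rightarrow> real) \<Rightarrow> real) (sc :: real \<Rightarrow> (nat \<Rightarrow> real) \<Rightarrow> (nat \<Rightarrow> real))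
     (s :: (nat \<Rightarrow> real) \<Rightarrow> real \<Rightarrow> (nat \<Rightarrow> real)) L Ls CLS M1 M2 \<epsilon> \<epsilon>TV.
     d \<ge> 1 \<and>
     p \<in> borel_measurable (lebd d) \<and> (\<forall>x\<in>Rd d. p x > 0) \<and>
     (\<integral>\<^sup>+x. ennreal (p x) \<partial>lebd d) = 1 \<and>
     C1 d (\<lambda>x. ln (p x)) \<and>
     L \<ge> 1 \<and> LSI d p CLS \<and> CLS \<ge> 1 \<and>
     vnorm d (\<lambda>i. \<integral>x. x i * p x \<partial>lebd d) \<le> M1 \<and>
     (\<integral>\<^sup>+x. ennreal (p x * (vnorm d x)^2) \<partial>lebd d) \<le> ennreal M2 \<and>
     M2 \<le> K * real d \<and>
     (\<forall>t\<ge>0. has_grad d (\<lambda>x. ln (fwd_dens d p t x)) (sc t) \<and> lipschitz_vec d L (sc t)) \<and>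
     Ls \<ge> 1 \<and>
     (\<forall>t\<ge>0. (\<forall>j<d. C1 d (\<lambda>x. s x t j)) \<and> lipschitz_vec d Ls (\<lambda>x. s x t)) \<and>
     0 \<le> \<epsilon> \<and>
     (\<forall>t\<ge>0. (\<integral>\<^sup>+x. ennreal (fwd_dens d p t x * (vdist d (sc t x) (s x t))^2) \<partial>lebd d)
              \<le> ennreal (\<epsilon>^2)) \<and>
     0 < \<epsilon>TV \<and> \<epsilon>TV < 1 \<and>
     \<epsilon>TV ^ 3 \<le> c1 / ((1 + Ls / L)^2 * (1 + CLS / real d) * max (ln (CLS * real d)) CLS) \<and>
     \<epsilon> \<le> c2 * \<epsilon>TV ^ 4 / (real d * L^2 * CLS powr (5/2) * ln (1 / (\<epsilon>TV / 2)^2))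
   \<longrightarrow> (\<exists>T h (n::nat) (Ns :: nat \<Rightarrow> nat) (hs :: nat \<Rightarrow> real).
          n \<ge> 1 \<and> h > 0 \<and> T = real n * h \<and> (\<forall>m. hs m > 0) \<and>
          c3 * max (ln (CLS * real d)) (CLS * ln (1 / \<epsilon>TV)) \<le> T \<and>
          T \<le> c4 * max (ln (CLS * real d)) (CLS * ln (1 / \<epsilon>TV)) \<and>
          tv d (pc_law d s T h Ns hs n) (density (lebd d) (\<lambda>x. ennreal (p x))) < \<epsilon>TV)"
proof (intro allI impI, goal_cases)
  case (1 K)
  show ?case
  \<comment> \<open>\<open>T\<close> is taken to be exactly 8 times the maximum, whence 8 for both
    bounds on it. The first constant is a cube because its purpose is x <= 1 / (4 (1 + K)), which
    makes x^2 K at most 1 / 16 and so absorbs the constant K of the second moment. The value 1 / 8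
    brings the score error down to x^2 / 16.\<close>
  proof (rule exI[of _ "(1 / (4 * (1 + K)))^3"], rule conjI, use 1 in simp,
      rule exI[of _ "1/8"], rule conjI, simp, rule exI[of _ 8], rule conjI, simp, rule exI[of _ 8], rule conjI, simp,
      intro allI impI, goal_cases)
    case (1 d p sc s L Ls CLS M1 M2 e x)
    then have d: "d \<ge> 1" and pm: "p \<in> borel_measurable (lebd d)" and pp: "\<And>x. x \<in> Rd d \<Longrightarrow> p x > 0"
      and p1: "(\<integral>\<^sup>+x. ennreal (p x) \<partial>lebd d) = 1" and L: "L \<ge> 1" and C: "CLS \<ge> 1"
      and M2: "(\<integral>\<^sup>+x. ennreal (p x * (vnorm d x)^2) \<partial>lebd d) \<le> ennreal M2" "M2 \<le> K * real d"
      and sc: "\<And>t. t \<ge> 0 \<Longrightarrow> has_grad d (\<lambda>x. ln (fwd_dens d p t x)) (sc t)" "\<And>t. t \<ge> 0 \<Longrightarrow> lipschitz_vec d L (sc t)"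
      and Ls: "Ls \<ge> 1" and s: "\<And>t. t \<ge> 0 \<Longrightarrow> lipschitz_vec d Ls (\<lambda>x. s x t)" and e: "0 \<le> e"
      and err: "\<And>t. t \<ge> 0 \<Longrightarrow> (\<integral>\<^sup>+x. ennreal (fwd_dens d p t x * (vdist d (sc t x) (s x t))^2) \<partial>lebd d) \<le> ennreal (e^2)"
      and x: "0 < x" "x < 1"
      and x3: "x ^ 3 \<le> (1 / (4 * (1 + K)))^3 / ((1 + Ls / L)^2 * (1 + CLS / real d) * max (ln (CLS * real d)) CLS)"
      and e_le: "e \<le> 1/8 * x ^ 4 / (real d * L^2 * CLS powr (5/2) * ln (1 / (x / 2)^2))"
      by blast+
    interpret pos_dens d p by unfold_locales (use pm pp p1 in auto)
    have nn: "(\<integral>\<^sup>+x. ennreal (\<Sum>i<d. (x i)^2) \<partial>P) \<le> ennreal (K * d)"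
    proof -
      have "(\<integral>\<^sup>+x. ennreal (\<Sum>i<d. (x i)^2) \<partial>P) = (\<integral>\<^sup>+x. ennreal (p x) * ennreal (\<Sum>i<d. (x i)^2) \<partial>lebd d)"
        by (rule nn_integral_P) measurable
      also have "\<dots> = (\<integral>\<^sup>+x. ennreal (p x * (vnorm d x)^2) \<partial>lebd d)"
        using pp by (intro nn_integral_cong) (simp add: ennreal_mult[symmetric] less_imp_le sum_nonneg vnorm_sq)
      also have "\<dots> \<le> ennreal (K * d)" using M2 by (meson ennreal_leI order_trans)
      finally show ?thesis .
    qed
    have gm: "(\<lambda>x. \<Sum>i<d. (x i)^2) \<in> borel_measurable P" by measurable
    have ig: "integrable P (\<lambda>x. \<Sum>i<d. (x i)^2)"
      using gm by (intro integrableI_nonneg le_less_trans[OF nn]) (auto intro!: AE_I2 sum_nonneg)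
    have m2: "integrable P (\<lambda>x. (x i)^2)" if i: "i < d" for i
    proof (rule Bochner_Integration.integrable_bound[OF ig])
      show "(\<lambda>x. (x i)^2) \<in> borel_measurable P" using i by measurable
      show "AE x in P. norm ((x i)^2) \<le> norm (\<Sum>i<d. (x i)^2)"
        using i by (auto intro!: AE_I2 order_trans[OF _ abs_ge_self] member_le_sum[where f="\<lambda>i. (_ i)^2"])
    qed
    interpret ddpm d p sc s L Ls e
      by unfold_locales (use L sc s err m2 in auto)
    have V: "V \<le> K * d"
    proof -
      have "ennreal (\<integral>x. (\<Sum>i<d. (x i)^2) \<partial>P) \<le> ennreal (K * d)"
        using nn by (subst nn_integral_eq_integral[OF ig, symmetric]) (auto intro!: AE_I2 sum_nonneg)
      then have "(\<integral>x. (\<Sum>i<d. (x i)^2) \<partial>P) \<le> K * d" using \<open>K > 0\<close> by (subst (asm) ennreal_le_iff) auto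
      then show ?thesis unfolding V_def using m2 by (subst (asm) Bochner_Integration.integral_sum) auto
    qed
    have x_le: "x \<le> 1 / (4 * (1 + K))"
    proof -
      have "1 \<le> (1 + Ls / L)^2 * (1 + CLS / real d) * max (ln (CLS * real d)) CLS"
        using L Ls C by (intro mult_ge1_I one_le_power) auto
      then have "(1 / (4 * (1 + K)))^3 / ((1 + Ls / L)^2 * (1 + CLS / real d) * max (ln (CLS * real d)) CLS) \<le> (1 / (4 * (1 + K)))^3 / 1"
        using \<open>K > 0\<close> by (intro divide_left_mono) auto
      with x3 have "x ^ 3 \<le> (1 / (4 * (1 + K)))^3" by simp
      then have "x ^ Suc 2 \<le> (1 / (4 * (1 + K))) ^ Suc 2" by simp
      then show ?thesis by (rule power_le_imp_le_base) (use \<open>K > 0\<close> in simp)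
    qed
    define T where "T = 8 * max (ln (CLS * real d)) (CLS * ln (1 / x))"
    note Tb = prior_exponent_bound[OF d C x, folded T_def]
    obtain n h where n: "n \<ge> 1" "h > 0" "T = real n * h"
      and pc: "prob_space (pc_law d s T h (\<lambda>_. 0) (\<lambda>_. 1) n)" "sets (pc_law d s T h (\<lambda>_. 0) (\<lambda>_. 1) n) = sets (lebd d)"
      and kl: "kl_le d P (pc_law d s T h (\<lambda>_. 0) (\<lambda>_. 1) n) (exp (- T) * V / (2 * (1 - exp (- T))) + T / 2 * e^2 + x^2 / 16)"
      using predictor_converges[OF Tb(1), of "x^2 / 16"] x by auto
    have "exp (- T) * V / (2 * (1 - exp (- T))) \<le> x^2 / 16"
    proof -
      have "x \<le> 1/4" using order_trans[OF x_le, of "1/4"] \<open>K > 0\<close> by (simp add: field_simps)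
      have "x^4 / d \<le> x^4 / 1" using x d by (intro divide_left_mono) auto
      also have "\<dots> \<le> x" using x power_decreasing[of 1 4 x] by simp
      finally have "x^4 / d \<le> x" .
      with Tb(2) \<open>x \<le> 1/4\<close> have "exp (- T) \<le> 1/4" by (meson order_trans)
      then have half: "1 \<le> 2 * (1 - exp (- T))" by simp
      have "exp (- T) * V / (2 * (1 - exp (- T))) \<le> exp (- T) * V / 1"
        using half V_nonneg Tb(1) by (intro divide_left_mono) auto
      also have "\<dots> \<le> x^4 / d * (K * d)"
        using Tb(2) V V_nonneg x d by (simp only: div_by_1) (intro mult_mono, auto)
      also have "\<dots> = x^2 * (x^2 * K)" using d by (simp add: power2_eq_square power4_eq_xxxx)
      also have "\<dots> \<le> x^2 * (1 / 16)"
      proof (intro mult_left_mono)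
        have "x^2 * K \<le> (1 / (4 * (1 + K)))^2 * K" using x x_le \<open>K > 0\<close> by (intro mult_right_mono power_mono) auto
        also have "\<dots> = 1/16 * (K / (1 + K)^2)" unfolding power_divide power_mult_distrib by simp
        also have "\<dots> \<le> 1/16 * 1"
          using \<open>K > 0\<close> by (intro mult_left_mono) (auto simp: divide_le_eq power2_eq_square algebra_simps)
        finally show "x^2 * K \<le> 1 / 16" by simp
      qed simp
      finally show ?thesis by simp
    qed
    moreover have "T / 2 * e^2 \<le> x^2 / 16" by (rule score_error_bound[OF d C L x e e_le Tb(3)])
    \<comment> \<open>Prior mismatch, score error and discretisation error each take x^2 / 16; the
      total variation is then at most 2 sqrt (3 / 16) x = (sqrt 3 / 2) x, which lies strictly below
      x.\<close>
    ultimately have "exp (- T) * V / (2 * (1 - exp (- T))) + T / 2 * e^2 + x^2 / 16 \<le> 3/16 * x^2" by simp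
    from kl_le_mono[OF kl this]
    have "tv d (pc_law d s T h (\<lambda>_. 0) (\<lambda>_. 1) n) P \<le> 2 * sqrt (3/16 * x^2)"
      using x power_le_one[of x 2] by (intro kl_le_tv[OF _ prob_space_P sets_P pc]) auto
    also have "\<dots> < x"
    proof -
      have "sqrt (3/16 * x^2) < sqrt ((x / 2)^2)" using x by (intro real_sqrt_less_mono) (simp add: power_divide)
      then show ?thesis using x by simp
    qed
    finally have "tv d (pc_law d s T h (\<lambda>_. 0) (\<lambda>_. 1) n) (density (lebd d) (\<lambda>x. ennreal (p x))) < x"
      by (simp add: P_def)
    then show ?case
      using n by (intro exI[of _ T] exI[of _ h] exI[of _ n] exI[of _ "\<lambda>_. 0"] exI[of _ "\<lambda>_. 1"]) (auto simp: T_def)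
  qed
qed

end
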